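(* There is a randomized algorithm which, given query access to $f:\{-1,1\}^n\to\{-1,1\}$ and parameters $d\in\mathbb{N}$ and $\varepsilon\in(0,1)$, provides query access to a fixed decision tree $T$ such that: (i) $T$ has depth $O(d^3/\varepsilon^2)$; (ii) with high probability $\mathrm{dist}(T,f)\le O(\mathrm{opt}_d)+\varepsilon$, where $\mathrm{opt}_d$ denotes the distance of $f$ to the closest depth-$d$ decision tree. Every query to $T$ is answered in $\mathrm{poly}(d,1/\varepsilon)\cdot n\log n$ time and with $\mathrm{poly}(d,1/\varepsilon)\cdot\log n$ queries to $f$.
   Context: $\mathrm{dist}(f,g)=\Pr_{\mathbf{x}}[f(\mathbf{x})\ne g(\mathbf{x})]$ with $\mathbf{x}$ uniform on $\{-1,1\}^n$. The depth of a decision tree is the maximum number of queries along a root-to-leaf path. "Provides query access to a fixed decision tree $T$" means all answers are consistent with a single decision tree determined by $f,d,\varepsilon$ and the algorithm's randomness. *)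

theory Defs
  imports "HOL-Probability.Probability"
begin

section \<open>Boolean functions and decision trees\<close>

definition cube :: "nat \<Rightarrow> (nat \<Rightarrow> int) set" where
  "cube n = {..<n} \<rightarrow>\<^sub>E {-1, 1}"

definition fdist :: "nat \<Rightarrow> ((nat \<Rightarrow> int) \<Rightarrow> int) \<Rightarrow> ((nat \<Rightarrow> int) \<Rightarrow> int) \<Rightarrow> real" where
  "fdist n f g = measure_pmf.prob (pmf_of_set (cube n)) {x. f x \<noteq> g x}"

datatype dtree = Leaf int | Node nat dtree dtree

fun dtree_on :: "nat \<Rightarrow> dtree \<Rightarrow> bool" where
  "dtree_on n (Leaf b) \<longleftrightarrow> b \<in> {-1, 1}"
| "dtree_on n (Node i l r) \<longleftrightarrow> i < n \<and> dtree_on n l \<and> dtree_on n r"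

fun tree_eval :: "dtree \<Rightarrow> (nat \<Rightarrow> int) \<Rightarrow> int" where
  "tree_eval (Leaf b) x = b"
| "tree_eval (Node i l r) x = (if x i = -1 then tree_eval l x else tree_eval r x)"

fun depth :: "dtree \<Rightarrow> nat" where
  "depth (Leaf b) = 0"
| "depth (Node i l r) = Suc (max (depth l) (depth r))"

definition opt :: "nat \<Rightarrow> nat \<Rightarrow> ((nat \<Rightarrow> int) \<Rightarrow> int) \<Rightarrow> real" where
  "opt n d f = (INF T \<in> {T. dtree_on n T \<and> depth T \<le> d}. fdist n f (tree_eval T))"

section \<open>Randomized oracle algorithms on a word RAM\<close>

text \<open>
  An algorithm is a program of a fixed finite size, independent of all inputs. It runs on
  words of \<open>w\<close> bits: every expression evaluates to a number below \<open>2 ^ w\<close>, so also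
  addresses are words. There are finitely many (program-dependent) registers and arrays in use,
  each named by a natural number.
\<close>

datatype binop = Add | Sub | Mul | Div | Mod | Less | Equal

datatype expr = Const nat | Reg nat | Arr nat expr | Bin binop expr expr

datatype com =
    Skip
  | Assign nat expr
  | Store nat expr expr    \<comment> \<open>array name, index, value\<close>
  | Seq com com
  | Cond expr com com
  | While expr com
  | Flip nat               \<comment> \<open>next bit of the random tape into a register\<close>
  | Query nat nat          \<comment> \<open>register for the answer, array holding the queried point\<close>

record state =
  regs :: "nat \<Rightarrow> nat"
  arrs :: "nat \<Rightarrow> nat \<Rightarrow> nat"
  tape_pos :: nat

fun apply_binop :: "binop \<Rightarrow> nat \<Rightarrow> nat \<Rightarrow> nat" where
  "apply_binop Add a b = a + b"
| "apply_binop Sub a b = a - b"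
| "apply_binop Mul a b = a * b"
| "apply_binop Div a b = a div b"
| "apply_binop Mod a b = a mod b"
| "apply_binop Less a b = (if a < b then 1 else 0)"
| "apply_binop Equal a b = (if a = b then 1 else 0)"

fun eval_expr :: "nat \<Rightarrow> state \<Rightarrow> expr \<Rightarrow> nat" where
  "eval_expr w s (Const k) = k mod 2 ^ w"
| "eval_expr w s (Reg v) = regs s v mod 2 ^ w"
| "eval_expr w s (Arr a e) = arrs s a (eval_expr w s e) mod 2 ^ w"
| "eval_expr w s (Bin p e e') = apply_binop p (eval_expr w s e) (eval_expr w s e') mod 2 ^ w"

fun expr_cost :: "expr \<Rightarrow> nat" where
  "expr_cost (Const k) = 1"
| "expr_cost (Reg v) = 1"
| "expr_cost (Arr a e) = expr_cost e + 1"
| "expr_cost (Bin p e e') = expr_cost e + expr_cost e' + 1"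

text \<open>Signs are stored in memory as bits: 0 stands for -1 and 1 for 1.\<close>

definition sign_of :: "nat \<Rightarrow> int" where
  "sign_of b = (if b = 0 then -1 else 1)"

definition bit_of :: "int \<Rightarrow> nat" where
  "bit_of y = (if y = -1 then 0 else 1)"

text \<open>
  \<open>exec w n f \<omega> c s t q s'\<close>: with word size \<open>w\<close>, oracle \<open>f\<close> on \<open>n\<close> variables and random
  tape \<open>\<omega>\<close>, the command \<open>c\<close> started in \<open>s\<close> halts in \<open>s'\<close> after \<open>t\<close> time steps and \<open>q\<close> oracle
  queries. Invoking the oracle is a single step; the time for writing the queried point is
  charged to the commands that write it.
\<close>

inductive exec ::
  "nat \<Rightarrow> nat \<Rightarrow> ((nat \<Rightarrow> int) \<Rightarrow> int) \<Rightarrow> (nat \<Rightarrow> bool) \<Rightarrow>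
   com \<Rightarrow> state \<Rightarrow> nat \<Rightarrow> nat \<Rightarrow> state \<Rightarrow> bool"
  for w n f \<omega>
where
  Skip: "exec w n f \<omega> Skip s 1 0 s"
| Assign: "exec w n f \<omega> (Assign v e) s (expr_cost e + 1) 0
    (s\<lparr>regs := (regs s)(v := eval_expr w s e)\<rparr>)"
| Store: "exec w n f \<omega> (Store a e e') s (expr_cost e + expr_cost e' + 1) 0
    (s\<lparr>arrs := (arrs s)(a := (arrs s a)(eval_expr w s e := eval_expr w s e'))\<rparr>)"
| Seq: "exec w n f \<omega> c1 s t1 q1 s' \<Longrightarrow> exec w n f \<omega> c2 s' t2 q2 s'' \<Longrightarrow>
    exec w n f \<omega> (Seq c1 c2) s (t1 + t2) (q1 + q2) s''"
| CondTrue: "eval_expr w s e \<noteq> 0 \<Longrightarrow> exec w n f \<omega> c1 s t q s' \<Longrightarrow>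
    exec w n f \<omega> (Cond e c1 c2) s (expr_cost e + 1 + t) q s'"
| CondFalse: "eval_expr w s e = 0 \<Longrightarrow> exec w n f \<omega> c2 s t q s' \<Longrightarrow>
    exec w n f \<omega> (Cond e c1 c2) s (expr_cost e + 1 + t) q s'"
| WhileFalse: "eval_expr w s e = 0 \<Longrightarrow>
    exec w n f \<omega> (While e c) s (expr_cost e + 1) 0 s"
| WhileTrue: "eval_expr w s e \<noteq> 0 \<Longrightarrow> exec w n f \<omega> c s t1 q1 s' \<Longrightarrow>
    exec w n f \<omega> (While e c) s' t2 q2 s'' \<Longrightarrow>
    exec w n f \<omega> (While e c) s (expr_cost e + 1 + t1 + t2) (q1 + q2) s''"
| Flip: "exec w n f \<omega> (Flip v) s 1 0
    (s\<lparr>regs := (regs s)(v := of_bool (\<omega> (tape_pos s))), tape_pos := Suc (tape_pos s)\<rparr>)"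
| Query: "exec w n f \<omega> (Query v a) s 1 1
    (s\<lparr>regs := (regs s)(v := bit_of (f (\<lambda>i\<in>{..<n}. sign_of (arrs s a i))))\<rparr>)"

inductive_cases SkipE: "exec w n f \<omega> Skip s t q s'"
inductive_cases AssignE: "exec w n f \<omega> (Assign v e) s t q s'"
inductive_cases StoreE: "exec w n f \<omega> (Store a e e') s t q s'"
inductive_cases SeqE: "exec w n f \<omega> (Seq c1 c2) s t q s'"
inductive_cases CondE: "exec w n f \<omega> (Cond e c1 c2) s t q s'"
inductive_cases WhileE: "exec w n f \<omega> (While e c) s t q s'"
inductive_cases FlipE: "exec w n f \<omega> (Flip v) s t q s'"
inductive_cases QueryE: "exec w n f \<omega> (Query v a) s t q s'"

lemma exec_deterministic:
  "exec w n f \<omega> c s t q s' \<Longrightarrow> exec w n f \<omega> c s t' q' s'' \<Longrightarrow> t' = t \<and> q' = q \<and> s'' = s'"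
proof (induction arbitrary: t' q' s'' rule: exec.induct)
  case (Skip s)
  then show ?case by (auto elim!: SkipE)
next
  case (Assign v e s)
  then show ?case by (auto elim!: AssignE)
next
  case (Store a e e' s)
  then show ?case by (auto elim!: StoreE)
next
  case (Seq c1 s t1 q1 s1 c2 t2 q2 s2)
  from Seq.prems show ?case
    by (rule SeqE) (metis Seq.IH)
next
  case (CondTrue s e c1 t q s' c2)
  from CondTrue.prems show ?case
    by (rule CondE) (use CondTrue.hyps in simp_all, metis CondTrue.IH)
next
  case (CondFalse s e c2 t q s' c1)
  from CondFalse.prems show ?case
    by (rule CondE) (use CondFalse.hyps in simp_all, metis CondFalse.IH)
next
  case (WhileFalse s e c)
  from WhileFalse.prems show ?case
    by (rule WhileE) (use WhileFalse.hyps in simp_all)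
next
  case (WhileTrue s e c t1 q1 s1 t2 q2 s2)
  from WhileTrue.prems show ?case
    by (rule WhileE) (use WhileTrue.hyps in simp_all, metis WhileTrue.IH)
next
  case (Flip v s)
  then show ?case by (auto elim!: FlipE)
next
  case (Query v a s)
  then show ?case by (auto elim!: QueryE)
qed

text \<open>
  The real parameter \<open>\<epsilon> \<in> (0,1)\<close> is accessible through its binary expansion:
  \<open>binary_digit \<epsilon> i\<close> is the digit of weight \<open>2 ^ -(i+1)\<close>.
\<close>

definition binary_digit :: "real \<Rightarrow> nat \<Rightarrow> nat" where
  "binary_digit \<epsilon> i = nat (\<lfloor>\<epsilon> * 2 ^ (i + 1)\<rfloor> mod 2)"

text \<open>
  Register 0 holds \<open>n\<close>, register 1 holds \<open>d\<close>, array 0 the point \<open>x\<close> at which the tree is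
  queried, array 1 the digits of \<open>\<epsilon>\<close>. Everything else is 0.
\<close>

definition init_state :: "nat \<Rightarrow> nat \<Rightarrow> real \<Rightarrow> (nat \<Rightarrow> int) \<Rightarrow> state" where
  "init_state n d \<epsilon> x =
     \<lparr>regs = (\<lambda>v. if v = 0 then n else if v = 1 then d else 0),
      arrs = (\<lambda>a i. if a = 0 \<and> i < n then bit_of (x i)
                    else if a = 1 then binary_digit \<epsilon> i else 0),
      tape_pos = 0\<rparr>"

text \<open>The answer is left in register 0.\<close>

definition answer_of :: "state \<Rightarrow> int" where
  "answer_of s = sign_of (regs s 0)"

text \<open>Words have \<open>O(log (n + d + 1/\<epsilon>))\<close> bits.\<close>

definition word_size :: "nat \<Rightarrow> nat \<Rightarrow> nat \<Rightarrow> real \<Rightarrow> nat" where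
  "word_size k n d \<epsilon> = nat \<lceil>real k * log 2 (real n + real d + 1 / \<epsilon>)\<rceil>"

text \<open>
  The program \<open>P\<close>, run afresh for each \<open>x\<close> but always with the same random tape \<open>\<omega>\<close>, answers
  every query \<open>x\<close> with the value at \<open>x\<close> of the one tree \<open>T\<close>, using at most \<open>t_max\<close> time steps
  and at most \<open>q_max\<close> oracle queries per answer. By determinism of \<open>exec\<close>, the existentially
  quantified run is the only run.
\<close>

definition provides_query_access ::
  "com \<Rightarrow> nat \<Rightarrow> nat \<Rightarrow> nat \<Rightarrow> real \<Rightarrow> ((nat \<Rightarrow> int) \<Rightarrow> int) \<Rightarrow> (nat \<Rightarrow> bool) \<Rightarrow>
   real \<Rightarrow> real \<Rightarrow> dtree \<Rightarrow> bool"
where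
  "provides_query_access P w n d \<epsilon> f \<omega> t_max q_max T \<longleftrightarrow>
     (\<forall>x \<in> cube n. \<exists>t q s.
        exec w n f \<omega> P (init_state n d \<epsilon> x) t q s \<and>
        answer_of s = tree_eval T x \<and> real t \<le> t_max \<and> real q \<le> q_max)"

definition coins :: "(nat \<Rightarrow> bool) measure" where
  "coins = PiM UNIV (\<lambda>_. measure_pmf (bernoulli_pmf (1/2)))"

end

theory Submission
  imports Defs
begin

text \<open>
  The tree queries at each node the variable whose restriction increases the noise stability of \<open>f\<close>
  the most. A pair of noisy copies of a random point is a sample for the stability of \<open>f\<close> restricted
  at any variable that the noise does not flip, so the same \<open>O(log n)\<close> pairs estimate the gain of all
  variables at once, and a union bound covers all restrictions of small size.

  If \<open>f\<close> is close to a depth-\<open>d\<close> tree \<open>g\<close>, then comparing the noisy version of \<open>f\<close> with \<open>g\<close> through the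
  inequality of O'Donnell, Saks, Schramm and Servedio bounds the variance of \<open>f\<close> by
  \<open>O(dist f g) + d \<delta> + d sqrt s\<close>, where \<open>s\<close> is the largest squared influence of the noisy function.
  Querying that variable raises the stability by at least \<open>\<delta> s\<close>, and the stability starts at
  \<open>1 - O(dist f g + d \<delta>)\<close>. Averaging over \<open>O(d ^ 3 / \<epsilon> ^ 2)\<close> levels with \<open>\<delta> = \<epsilon> / d\<close>, the expected
  variance at a leaf is \<open>O(opt) + \<epsilon>\<close>, and it bounds the error of the majority label.
\<close>

section \<open>Averages over the cube\<close>

text \<open>A query rebuilds only the path of \<open>x\<close>, so two queries agree on one tree
  only if the choice at a node is a function of the tape, the level and the restriction. Hence level
  \<open>j\<close> owns \<open>m\<close> samples shared by all its nodes, and the tape position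
  never depends on \<open>x\<close>. The nodes are too many to be explored and are themselves
  random; but at most \<open>(2 n) ^ j\<close> restrictions can occur at level \<open>j\<close>, and
  accuracy at all of them at once costs only a factor \<open>O(D log n)\<close> in \<open>m\<close>.
  Noise enters because the influences of \<open>f\<close> itself would need separate queries for
  each variable, whereas two noisy queries serve all \<open>n\<close>. Two norms have to be joined:
  the comparison with a tree consumes mean absolute influences, the growth of the stability supplies
  mean squares. Cauchy-Schwarz followed by \<open>d sqrt s \<le> e / 4 + d^2 s / e\<close> makes the
  loss linear in \<open>s\<close>, so that it can be averaged over nodes and levels and charged to
  the total growth, which is \<open>O(opt + d \<delta>)\<close> up to estimation errors. The depth
  is what brings the coefficient of this total down to one. Fair coins yield flip probabilities
  \<open>2 ^ -a\<close> only, so \<open>\<delta>\<close> meets its target up to a factor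
  two.\<close>

definition bias :: "real \<Rightarrow> int \<Rightarrow> real" where
  "bias \<delta> v = (if v = -1 then \<delta> else 1 - \<delta>)"

text \<open>A product measure in which \<open>-1\<close> has probability \<open>\<delta>\<close>:
  the value \<open>1 / 2\<close> gives uniform points, a small \<open>\<delta>\<close> gives noise
  vectors, and one set of lemmas serves both.\<close>

definition wavg :: "nat \<Rightarrow> real \<Rightarrow> ((nat \<Rightarrow> int) \<Rightarrow> real) \<Rightarrow> real" where
  "wavg n \<delta> \<phi> = (\<Sum>x\<in>cube n. (\<Prod>i<n. bias \<delta> (x i)) * \<phi> x)"

abbreviation uavg :: "nat \<Rightarrow> ((nat \<Rightarrow> int) \<Rightarrow> real) \<Rightarrow> real" where
  "uavg n \<equiv> wavg n (1/2)"

lemma finite_cube [simp]: "finite (cube n)"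
  by (auto simp: cube_def intro!: finite_PiE)

lemma cube_vals: "x \<in> cube n \<Longrightarrow> i < n \<Longrightarrow> x i = -1 \<or> x i = 1"
  by (auto simp: cube_def PiE_def Pi_def)

lemma cube_upd [simp]: "x \<in> cube n \<Longrightarrow> i < n \<Longrightarrow> b = -1 \<or> b = 1 \<Longrightarrow> x(i := b) \<in> cube n"
  by (auto simp: cube_def PiE_def Pi_def extensional_def)

lemma card_cube: "card (cube n) = 2 ^ n"
  by (simp add: cube_def card_PiE numeral_2_eq_2[symmetric])

lemma cube_ne [simp]: "cube n \<noteq> {}"
  using card_cube[of n] by fastforce

lemma bias_half: "bias (1/2) v = 1/2"
  by (simp add: bias_def)

lemma uavg_eq: "uavg n \<phi> = (\<Sum>x\<in>cube n. \<phi> x) / 2 ^ n"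
  by (simp add: wavg_def bias_half power_one_over sum_distrib_left[symmetric] sum_divide_distrib divide_simps)

lemma sum_cube_split:
  fixes g :: "(nat \<Rightarrow> int) \<Rightarrow> real"
  assumes "i < n"
  shows "(\<Sum>x\<in>cube n. g x) = (\<Sum>y\<in>({..<n} - {i}) \<rightarrow>\<^sub>E {-1, 1}. g (y(i := -1)) + g (y(i := 1)))"
proof -
  let ?A = "({..<n} - {i}) \<rightarrow>\<^sub>E {-1, 1::int}"
  have eq: "cube n = (\<lambda>(b, y). y(i := b)) ` ({-1, 1} \<times> ?A)"
    using assms PiE_insert_eq[of i "{..<n} - {i}" "\<lambda>_. {-1, 1::int}"]
    by (simp add: cube_def insert_absorb insert_Diff_if)
  have inj: "inj_on (\<lambda>(b, y). y(i := b)) ({-1, 1} \<times> ?A)"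
    using inj_combinator[of i "{..<n} - {i}" "\<lambda>_. {-1, 1::int}"] by simp
  show ?thesis
    unfolding eq sum.reindex[OF inj] 
    using sum.cartesian_product[of "\<lambda>b y. g (y(i := b))" ?A "{-1, 1::int}", symmetric]
    by (simp add: case_prod_unfold o_def sum.distrib)
qed

text \<open>The conditional expectation given all coordinates but \<open>i\<close> has the same
  mean. The one-variable arguments below rest on this identity; no Fourier expansion is
  used.\<close>

lemma wavg_resample:
  assumes "i < n"
  shows "wavg n \<delta> \<phi> = wavg n \<delta> (\<lambda>x. \<delta> * \<phi> (x(i := -1)) + (1 - \<delta>) * \<phi> (x(i := 1)))"
proof -
  have w: "(\<Prod>j<n. bias \<delta> ((y(i := b)) j)) = bias \<delta> b * (\<Prod>j\<in>{..<n} - {i}. bias \<delta> (y j))" for y b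
    using assms by (simp add: prod.remove[of "{..<n}" i])
  show ?thesis
    unfolding wavg_def sum_cube_split[OF assms] w
    by (intro sum.cong) (auto simp: bias_def algebra_simps)
qed

lemma uavg_resample:
  assumes "i < n"
  shows "uavg n \<phi> = uavg n (\<lambda>x. (\<phi> (x(i := -1)) + \<phi> (x(i := 1))) / 2)"
  by (subst wavg_resample[OF assms]) (simp add: field_simps)

lemma wavg_const [simp]: "wavg n \<delta> (\<lambda>_. c) = c"
proof -
  have "(\<Sum>x\<in>cube n. \<Prod>i<n. bias \<delta> (x i)) = (\<Prod>i<n. \<Sum>v\<in>{-1, 1}. bias \<delta> v)"
    unfolding cube_def by (subst prod_sum_PiE) auto
  also have "\<dots> = 1" by (simp add: bias_def)
  finally show ?thesis by (simp add: wavg_def sum_distrib_right[symmetric])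
qed

lemma wavg_add: "wavg n \<delta> (\<lambda>x. \<phi> x + \<psi> x) = wavg n \<delta> \<phi> + wavg n \<delta> \<psi>"
  by (simp add: wavg_def algebra_simps sum.distrib)

lemma wavg_diff: "wavg n \<delta> (\<lambda>x. \<phi> x - \<psi> x) = wavg n \<delta> \<phi> - wavg n \<delta> \<psi>"
  by (simp add: wavg_def algebra_simps sum_subtractf)

lemma wavg_cmult: "wavg n \<delta> (\<lambda>x. c * \<phi> x) = c * wavg n \<delta> \<phi>"
  unfolding wavg_def sum_distrib_left by (intro sum.cong) auto

lemma wavg_multc: "wavg n \<delta> (\<lambda>x. \<phi> x * c) = wavg n \<delta> \<phi> * c"
  unfolding wavg_def sum_distrib_right by (intro sum.cong) auto

lemma wavg_divide: "wavg n \<delta> (\<lambda>x. \<phi> x / c) = wavg n \<delta> \<phi> / c"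
  by (simp add: wavg_def sum_divide_distrib)

lemmas wavg_linear = wavg_add wavg_diff wavg_cmult wavg_multc wavg_divide

lemma wavg_cong: "(\<And>x. x \<in> cube n \<Longrightarrow> \<phi> x = \<psi> x) \<Longrightarrow> wavg n \<delta> \<phi> = wavg n \<delta> \<psi>"
  by (simp add: wavg_def)

lemma wavg_mono:
  assumes "0 \<le> \<delta>" "\<delta> \<le> 1" "\<And>x. x \<in> cube n \<Longrightarrow> \<phi> x \<le> \<psi> x"
  shows "wavg n \<delta> \<phi> \<le> wavg n \<delta> \<psi>"
  unfolding wavg_def using assms
  by (intro sum_mono mult_left_mono prod_nonneg) (auto simp: bias_def)

lemma uavg_mono: "(\<And>x. x \<in> cube n \<Longrightarrow> \<phi> x \<le> \<psi> x) \<Longrightarrow> uavg n \<phi> \<le> uavg n \<psi>"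
  by (rule wavg_mono) auto

lemma wavg_abs:
  assumes "0 \<le> \<delta>" "\<delta> \<le> 1"
  shows "\<bar>wavg n \<delta> \<phi>\<bar> \<le> wavg n \<delta> (\<lambda>x. \<bar>\<phi> x\<bar>)"
proof -
  have "wavg n \<delta> \<phi> \<le> wavg n \<delta> (\<lambda>x. \<bar>\<phi> x\<bar>)" by (rule wavg_mono) (use assms in auto)
  moreover have "wavg n \<delta> (\<lambda>x. (-1) * \<phi> x) \<le> wavg n \<delta> (\<lambda>x. \<bar>\<phi> x\<bar>)"
    by (rule wavg_mono) (use assms in auto)
  ultimately show ?thesis unfolding wavg_cmult by (simp add: abs_le_iff)
qed

lemma uavg_abs: "\<bar>uavg n \<phi>\<bar> \<le> uavg n (\<lambda>x. \<bar>\<phi> x\<bar>)"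
  by (rule wavg_abs) auto

lemma wavg_swap: "wavg n \<delta> (\<lambda>x. wavg m \<delta>' (\<lambda>y. \<phi> x y)) = wavg m \<delta>' (\<lambda>y. wavg n \<delta> (\<lambda>x. \<phi> x y))"
  unfolding wavg_def sum_distrib_left
  by (subst sum.swap) (simp add: algebra_simps)

lemma uavg_square: "(uavg n \<phi>)\<^sup>2 \<le> uavg n (\<lambda>x. (\<phi> x)\<^sup>2)"
proof -
  let ?m = "uavg n \<phi>"
  have "0 \<le> uavg n (\<lambda>x. (\<phi> x - ?m)\<^sup>2)"
    using uavg_mono[of n "\<lambda>_. 0" "\<lambda>x. (\<phi> x - ?m)\<^sup>2"] by simp
  also have "(\<lambda>x. (\<phi> x - ?m)\<^sup>2) = (\<lambda>x. (\<phi> x)\<^sup>2 - 2 * ?m * \<phi> x + ?m\<^sup>2)"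
    by (auto simp: power2_eq_square algebra_simps)
  also have "uavg n \<dots> = uavg n (\<lambda>x. (\<phi> x)\<^sup>2) - ?m\<^sup>2"
    by (simp add: wavg_linear power2_eq_square)
  finally show ?thesis by simp
qed

text \<open>Cauchy-Schwarz; it turns the mean squared influences controlled by
  \<open>stab_progress\<close> into the mean absolute ones that \<open>osss\<close> asks
  for.\<close>

lemma uavg_abs_le_sqrt: "uavg n (\<lambda>x. \<bar>\<phi> x\<bar>) \<le> sqrt (uavg n (\<lambda>x. (\<phi> x)\<^sup>2))"
  using uavg_square[of n "\<lambda>x. \<bar>\<phi> x\<bar>"] by (intro real_le_rsqrt) simp

section \<open>Flipping and mixing points\<close>

text \<open>Noise acts by multiplication with a sign vector, so that for a fixed \<open>K\<close> in
  the cube it is a measure-preserving involution.\<close>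

definition twist :: "nat \<Rightarrow> (nat \<Rightarrow> int) \<Rightarrow> (nat \<Rightarrow> int) \<Rightarrow> nat \<Rightarrow> int" where
  "twist n x K = (\<lambda>i\<in>{..<n}. x i * K i)"

definition mix :: "nat set \<Rightarrow> (nat \<Rightarrow> int) \<Rightarrow> (nat \<Rightarrow> int) \<Rightarrow> nat \<Rightarrow> int" where
  "mix S x z = (\<lambda>i. if i \<in> S then x i else z i)"

lemma twist_cube [simp]: "x \<in> cube n \<Longrightarrow> K \<in> cube n \<Longrightarrow> twist n x K \<in> cube n"
  by (fastforce simp: twist_def cube_def PiE_def Pi_def extensional_def)

lemma twist_twist [simp]: "x \<in> cube n \<Longrightarrow> K \<in> cube n \<Longrightarrow> twist n (twist n x K) K = x"
proof
  fix i assume "x \<in> cube n" "K \<in> cube n"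
  then show "twist n (twist n x K) K i = x i"
    using cube_vals[of K n i] by (auto simp: twist_def cube_def PiE_def extensional_def)
qed

lemma twist_upd_plus: "i < n \<Longrightarrow> twist n z (K(i := 1)) = (twist n z K)(i := z i)"
  by (auto simp: twist_def)

lemma twist_upd_minus: "i < n \<Longrightarrow> twist n z (K(i := -1)) = (twist n z K)(i := - z i)"
  by (auto simp: twist_def)

lemma twist_upd_left: "i < n \<Longrightarrow> (twist n (z(i := b)) K)(i := c) = (twist n z K)(i := c)"
  by (auto simp: twist_def)

lemma uavg_twist:
  assumes "K \<in> cube n"
  shows "uavg n (\<lambda>z. \<phi> (twist n z K)) = uavg n \<phi>"
proof -
  have "bij_betw (\<lambda>z. twist n z K) (cube n) (cube n)"
    by (rule bij_betw_byWitness[where f' = "\<lambda>z. twist n z K"]) (use assms in auto)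
  then show ?thesis
    unfolding uavg_eq using sum.reindex_bij_betw[of _ "cube n" "cube n" \<phi>] by simp
qed

lemma mix_cube: "x \<in> cube n \<Longrightarrow> z \<in> cube n \<Longrightarrow> mix S x z \<in> cube n"
  by (auto simp: mix_def cube_def PiE_def Pi_def extensional_def)

text \<open>The map \<open>(x, z) \<mapsto> (mix (S x) x z, mix (S x) z x)\<close> is an involution, because \<open>S\<close> takes the
  same value at both points.\<close>

lemma uavg_mix_stopping:
  assumes S: "\<And>x z. x \<in> cube n \<Longrightarrow> z \<in> cube n \<Longrightarrow> S (mix (S x) x z) = S x"
  shows "uavg n (\<lambda>x. uavg n (\<lambda>z. G (mix (S x) x z))) = uavg n G"
proof -
  define \<Theta> where "\<Theta> = (\<lambda>(x, z). (mix (S x) x z, mix (S x) z x))"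
  have inv: "\<Theta> (\<Theta> p) = p" if "p \<in> cube n \<times> cube n" for p
  proof -
    obtain x z where p: "p = (x, z)" "x \<in> cube n" "z \<in> cube n" using \<open>p \<in> _\<close> by auto
    then have "S (mix (S x) x z) = S x" using S by auto
    then show ?thesis by (auto simp: \<Theta>_def p(1) mix_def fun_eq_iff)
  qed
  have cl: "\<Theta> p \<in> cube n \<times> cube n" if "p \<in> cube n \<times> cube n" for p
    using that by (auto simp: \<Theta>_def mix_cube)
  have bij: "bij_betw \<Theta> (cube n \<times> cube n) (cube n \<times> cube n)"
    by (rule bij_betw_byWitness[where f' = \<Theta>]) (use inv cl in blast)+
  have "(\<Sum>x\<in>cube n. \<Sum>z\<in>cube n. G (mix (S x) x z)) = (\<Sum>p\<in>cube n \<times> cube n. G (fst (\<Theta> p)))"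
    by (simp add: sum.cartesian_product \<Theta>_def case_prod_unfold)
  also have "\<dots> = (\<Sum>p\<in>cube n \<times> cube n. G (fst p))"
    by (rule sum.reindex_bij_betw[OF bij])
  also have "\<dots> = 2 ^ n * (\<Sum>x\<in>cube n. G x)"
    using card_cube[of n]
    by (simp add: sum.cartesian_product[symmetric, of "\<lambda>x z. G x", unfolded case_prod_unfold] sum_distrib_left)
  finally show ?thesis by (simp add: uavg_eq sum_divide_distrib[symmetric])
qed

section \<open>Noise stability\<close>

text \<open>The noise operator usually written \<open>T_\<rho>\<close>, with
  \<open>\<rho> = 1 - 2 * \<delta>\<close>.\<close>

definition noise :: "nat \<Rightarrow> real \<Rightarrow> ((nat \<Rightarrow> int) \<Rightarrow> real) \<Rightarrow> (nat \<Rightarrow> int) \<Rightarrow> real" where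
  "noise n \<delta> h z = wavg n \<delta> (\<lambda>K. h (twist n z K))"

text \<open>Noise stability at correlation \<open>(1 - 2 * \<delta>)^2\<close>: expanding the square
  gives the expected product of \<open>h\<close> at two independent noisy copies of one point, which
  is what a sample observes.\<close>

definition stab :: "nat \<Rightarrow> real \<Rightarrow> ((nat \<Rightarrow> int) \<Rightarrow> real) \<Rightarrow> real" where
  "stab n \<delta> h = uavg n (\<lambda>z. (noise n \<delta> h z)\<^sup>2)"

text \<open>The restriction remains a function of all \<open>n\<close> variables that ignores
  \<open>i\<close>, so nothing is renumbered along a path.\<close>

definition fixv :: "nat \<Rightarrow> int \<Rightarrow> ((nat \<Rightarrow> int) \<Rightarrow> real) \<Rightarrow> (nat \<Rightarrow> int) \<Rightarrow> real" where
  "fixv i b h z = h (z(i := b))"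

definition diffv :: "nat \<Rightarrow> ((nat \<Rightarrow> int) \<Rightarrow> real) \<Rightarrow> (nat \<Rightarrow> int) \<Rightarrow> real" where
  "diffv i F z = (F (z(i := 1)) - F (z(i := -1))) / 2"

text \<open>Pairs in which the noise flips \<open>i\<close> contribute 0 and the sum is not
  renormalised: the lost factor is the same for all \<open>i\<close>, so the comparison between
  variables is unaffected.\<close>

definition score :: "nat \<Rightarrow> real \<Rightarrow> ((nat \<Rightarrow> int) \<Rightarrow> real) \<Rightarrow> nat \<Rightarrow> real" where
  "score n \<delta> h i = uavg n (\<lambda>z. wavg n \<delta> (\<lambda>K. wavg n \<delta> (\<lambda>K'.
     h (twist n z K) * h (twist n z K') * of_bool (K i = 1 \<and> K' i = 1))))"

lemma noise_fixv_upd: "i < n \<Longrightarrow> noise n \<delta> (fixv i b h) (z(i := c)) = noise n \<delta> (fixv i b h) z"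
  by (simp add: noise_def fixv_def twist_upd_left)

text \<open>If neither noise vector flips \<open>i\<close>, both copies keep the value
  \<open>z i\<close> and are noisy copies for the restriction at that value. This happens with
  probability \<open>(1 - \<delta>)^2\<close>, independently of the other coordinates.\<close>

lemma score_eq:
  assumes i: "i < n"
  shows "score n \<delta> h i = (1 - \<delta>)\<^sup>2 * ((stab n \<delta> (fixv i (-1) h) + stab n \<delta> (fixv i 1 h)) / 2)"
proof -
  have one: "wavg n \<delta> (\<lambda>K. h (twist n z K) * of_bool (K i = 1)) = (1 - \<delta>) * noise n \<delta> (fixv i (z i) h) z" for z
    by (subst wavg_resample[OF i]) (simp add: twist_upd_plus[OF i] noise_def fixv_def wavg_cmult)
  have "score n \<delta> h i = uavg n (\<lambda>z. (wavg n \<delta> (\<lambda>K. h (twist n z K) * of_bool (K i = 1)))\<^sup>2)"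
    unfolding score_def power2_eq_square wavg_multc[symmetric] wavg_cmult[symmetric]
    by (intro wavg_cong) (simp add: of_bool_conj mult_ac)
  also have "\<dots> = (1 - \<delta>)\<^sup>2 * uavg n (\<lambda>z. (noise n \<delta> (fixv i (z i) h) z)\<^sup>2)"
    by (simp add: one power_mult_distrib wavg_cmult)
  also have "uavg n (\<lambda>z. (noise n \<delta> (fixv i (z i) h) z)\<^sup>2)
      = (stab n \<delta> (fixv i (-1) h) + stab n \<delta> (fixv i 1 h)) / 2"
    by (subst uavg_resample[OF i]) (simp add: noise_fixv_upd[OF i] stab_def wavg_add wavg_divide)
  finally show ?thesis .
qed

lemma noise_split:
  assumes i: "i < n"
  shows "noise n \<delta> h z = (1 - \<delta>) * noise n \<delta> (fixv i (z i) h) z + \<delta> * noise n \<delta> (fixv i (- z i) h) z"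
  unfolding noise_def
  by (subst wavg_resample[OF i])
     (simp add: twist_upd_plus[OF i] twist_upd_minus[OF i] wavg_add wavg_cmult fixv_def add.commute)

text \<open>With \<open>p\<close> and \<open>m\<close> the noisy restrictions at
  \<open>z i = 1\<close> and \<open>z i = -1\<close>, the exact gain is
  \<open>\<delta> * (1 - \<delta>)\<close> times the mean of \<open>(p - m)^2\<close>. The influence
  of the noisy \<open>h\<close> contains the extra factor \<open>(1 - 2 * \<delta>)^2 / 4\<close>,
  of which only the part at most 1 is given away.\<close>

lemma stab_progress:
  assumes i: "i < n" and \<delta>: "0 \<le> \<delta>" "\<delta> \<le> 1"
  shows "(stab n \<delta> (fixv i (-1) h) + stab n \<delta> (fixv i 1 h)) / 2
     \<ge> stab n \<delta> h + 4 * \<delta> * (1 - \<delta>) * uavg n (\<lambda>z. (diffv i (noise n \<delta> h) z)\<^sup>2)"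
proof -
  let ?P = "noise n \<delta> (fixv i 1 h)" and ?M = "noise n \<delta> (fixv i (-1) h)"
  have up: "noise n \<delta> h (z(i := 1)) = (1 - \<delta>) * ?P z + \<delta> * ?M z"
   and dn: "noise n \<delta> h (z(i := -1)) = (1 - \<delta>) * ?M z + \<delta> * ?P z" for z
    using noise_split[OF i, of \<delta> h "z(i := 1)"] noise_split[OF i, of \<delta> h "z(i := -1)"]
    by (simp_all add: noise_fixv_upd[OF i])
  have diff: "diffv i (noise n \<delta> h) z = (1 - 2 * \<delta>) * (?P z - ?M z) / 2" for z
    unfolding diffv_def up dn by (simp add: algebra_simps)
  have "stab n \<delta> h + 4 * \<delta> * (1 - \<delta>) * uavg n (\<lambda>z. (diffv i (noise n \<delta> h) z)\<^sup>2)
     = uavg n (\<lambda>z. (((1 - \<delta>) * ?M z + \<delta> * ?P z)\<^sup>2 + ((1 - \<delta>) * ?P z + \<delta> * ?M z)\<^sup>2) / 2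
          + 4 * \<delta> * (1 - \<delta>) * ((1 - 2 * \<delta>) * (?P z - ?M z) / 2)\<^sup>2)"
    unfolding stab_def diff wavg_add wavg_cmult
    by (subst uavg_resample[OF i]) (simp add: up dn)
  also have "\<dots> \<le> uavg n (\<lambda>z. ((?M z)\<^sup>2 + (?P z)\<^sup>2) / 2)"
  proof (rule uavg_mono)
    fix z
    let ?p = "?P z" and ?m = "?M z"
    have "(?m\<^sup>2 + ?p\<^sup>2) / 2 - (((1 - \<delta>) * ?m + \<delta> * ?p)\<^sup>2 + ((1 - \<delta>) * ?p + \<delta> * ?m)\<^sup>2) / 2
       - 4 * \<delta> * (1 - \<delta>) * ((1 - 2 * \<delta>) * (?p - ?m) / 2)\<^sup>2
      = \<delta> * (1 - \<delta>) * (1 - (1 - 2 * \<delta>)\<^sup>2) * (?p - ?m)\<^sup>2"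
      by (simp add: power2_eq_square field_simps)
    moreover have "(1 - 2 * \<delta>)\<^sup>2 \<le> 1\<^sup>2" using \<delta> by (intro power2_le_iff_abs_le[THEN iffD2]) auto
    then have "0 \<le> \<delta> * (1 - \<delta>) * (1 - (1 - 2 * \<delta>)\<^sup>2) * (?p - ?m)\<^sup>2" using \<delta> by (intro mult_nonneg_nonneg) auto
    ultimately show "(((1 - \<delta>) * ?m + \<delta> * ?p)\<^sup>2 + ((1 - \<delta>) * ?p + \<delta> * ?m)\<^sup>2) / 2
          + 4 * \<delta> * (1 - \<delta>) * ((1 - 2 * \<delta>) * (?p - ?m) / 2)\<^sup>2 \<le> (?m\<^sup>2 + ?p\<^sup>2) / 2"
      by linarith
  qed
  also have "\<dots> = (stab n \<delta> (fixv i (-1) h) + stab n \<delta> (fixv i 1 h)) / 2"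
    by (simp add: stab_def wavg_divide wavg_add)
  finally show ?thesis .
qed

text \<open>For each fixed \<open>K\<close> the twist is a measure-preserving involution and can be
  moved from one factor to the other.\<close>

lemma noise_self_adjoint:
  "uavg n (\<lambda>z. noise n \<delta> h z * g z) = uavg n (\<lambda>z. h z * noise n \<delta> g z)"
proof -
  have "uavg n (\<lambda>z. noise n \<delta> h z * g z) = wavg n \<delta> (\<lambda>K. uavg n (\<lambda>z. h (twist n z K) * g z))"
    by (simp add: noise_def wavg_multc[symmetric] wavg_swap[of n "1/2"])
  also have "\<dots> = wavg n \<delta> (\<lambda>K. uavg n (\<lambda>z. h z * g (twist n z K)))"
  proof (rule wavg_cong)
    fix K assume K: "K \<in> cube n"
    have "uavg n (\<lambda>z. h z * g (twist n z K)) = uavg n (\<lambda>z. h (twist n z K) * g (twist n (twist n z K) K))"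
      by (rule uavg_twist[OF K, symmetric])
    also have "\<dots> = uavg n (\<lambda>z. h (twist n z K) * g z)"
      by (rule wavg_cong) (simp add: K)
    finally show "uavg n (\<lambda>z. h (twist n z K) * g z) = uavg n (\<lambda>z. h z * g (twist n z K))" ..
  qed
  also have "\<dots> = uavg n (\<lambda>z. h z * noise n \<delta> g z)"
    by (simp add: noise_def wavg_cmult[symmetric] wavg_swap[of n "1/2"])
  finally show ?thesis .
qed

lemma uavg_noise: "uavg n (noise n \<delta> h) = uavg n h"
  using noise_self_adjoint[of n \<delta> h "\<lambda>_. 1"] by (simp add: noise_def[of _ _ "\<lambda>_. 1"])

section \<open>Comparison with a decision tree\<close>

text \<open>Turns a tree approximating \<open>f\<close> into one of no larger depth approximating
  the restriction of \<open>f\<close> at a node.\<close>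

fun fixt :: "nat set \<Rightarrow> (nat \<Rightarrow> int) \<Rightarrow> dtree \<Rightarrow> dtree" where
  "fixt S x (Leaf b) = Leaf b"
| "fixt S x (Node i l r) =
     (if i \<in> S then (if x i = -1 then fixt S x l else fixt S x r) else Node i (fixt S x l) (fixt S x r))"

abbreviation tval :: "dtree \<Rightarrow> (nat \<Rightarrow> int) \<Rightarrow> real" where
  "tval T z \<equiv> real_of_int (tree_eval T z)"

lemma tree_eval_fixt: "tree_eval (fixt S x T) z = tree_eval T (mix S x z)"
  by (induction T) (auto simp: mix_def)

lemma depth_fixt: "depth (fixt S x T) \<le> depth T"
  by (induction T) auto

lemma dtree_on_fixt: "dtree_on n T \<Longrightarrow> dtree_on n (fixt S x T)"
  by (induction T) auto

lemma tree_eval_vals: "dtree_on n T \<Longrightarrow> tree_eval T z = -1 \<or> tree_eval T z = 1"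
  by (induction T) auto

lemma abs_tval: "dtree_on n T \<Longrightarrow> \<bar>tval T z\<bar> = 1"
  using tree_eval_vals[of n T z] by auto

lemma mix_single: "mix {i} (\<lambda>_. b) z = z(i := b)"
  by (auto simp: mix_def)

text \<open>The O'Donnell--Saks--Schramm--Servedio inequality for a real function against a tree: averaging
  \<open>F\<close> over the variable at the root costs at most its influence, and leaves a function on which
  both subtrees can be treated inductively.\<close>

lemma osss:
  assumes "dtree_on n T" "depth T \<le> d" "0 \<le> M"
    and "\<And>i. i < n \<Longrightarrow> uavg n (\<lambda>z. \<bar>diffv i F z\<bar>) \<le> M"
  shows "\<bar>uavg n (\<lambda>z. F z * tval T z) - uavg n F * uavg n (tval T)\<bar> \<le> real d * M"
  using assms
proof (induction d arbitrary: T F)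
  case 0
  then obtain b where "T = Leaf b" by (cases T) auto
  then show ?case by (simp add: wavg_multc)
next
  case (Suc d)
  show ?case
  proof (cases T)
    case (Leaf b)
    then show ?thesis using \<open>0 \<le> M\<close> by (simp add: wavg_multc)
  next
    case (Node i l r)
    have i: "i < n" and dl: "depth l \<le> d" and dr: "depth r \<le> d" and on: "dtree_on n l" "dtree_on n r"
      using Suc.prems Node by auto
    define A where "A = (\<lambda>z. (F (z(i := -1)) + F (z(i := 1))) / 2)"
    \<comment> \<open>A subtree may query \<open>i\<close> again; fixing \<open>i\<close> in it
      makes the value of \<open>T\<close> on each half that of a tree at the unmodified
      point.\<close>
    define l' where "l' = fixt {i} (\<lambda>_. -1) l"
    define r' where "r' = fixt {i} (\<lambda>_. 1) r"
    have A_upd: "A (z(i := c)) = A z" for z c by (simp add: A_def)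
    have T_upd: "tval T (z(i := -1)) = tval l' z" "tval T (z(i := 1)) = tval r' z" for z
      by (simp_all add: Node l'_def r'_def tree_eval_fixt mix_single)
    have uA: "uavg n A = uavg n F"
      unfolding A_def by (rule uavg_resample[OF i, symmetric])
    \<comment> \<open>Averaging over coordinate \<open>i\<close> removes its own influence and, by
      convexity of the absolute value, does not increase any other.\<close>
    have MA: "uavg n (\<lambda>z. \<bar>diffv j A z\<bar>) \<le> M" if j: "j < n" for j
    proof (cases "j = i")
      case True
      then show ?thesis using \<open>0 \<le> M\<close> by (simp add: diffv_def A_upd)
    next
      case False
      have "diffv j A z = (diffv j F (z(i := -1)) + diffv j F (z(i := 1))) / 2" for z
        using False by (simp add: diffv_def A_def fun_upd_twist[of j i] field_simps)
      then have "\<bar>diffv j A z\<bar> \<le> (\<bar>diffv j F (z(i := -1))\<bar> + \<bar>diffv j F (z(i := 1))\<bar>) / 2" for z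
        by (simp only: abs_divide abs_numeral) (rule divide_right_mono[OF abs_triangle_ineq], simp)
      then have "uavg n (\<lambda>z. \<bar>diffv j A z\<bar>)
          \<le> uavg n (\<lambda>z. (\<bar>diffv j F (z(i := -1))\<bar> + \<bar>diffv j F (z(i := 1))\<bar>) / 2)"
        by (intro uavg_mono)
      also have "\<dots> = uavg n (\<lambda>z. \<bar>diffv j F z\<bar>)"
        by (rule uavg_resample[OF i, symmetric])
      finally show ?thesis using Suc.prems(4)[OF j] by simp
    qed
    have IH: "\<bar>uavg n (\<lambda>z. A z * tval t z) - uavg n F * uavg n (tval t)\<bar> \<le> real d * M"
      if "t = l' \<or> t = r'" for t
    proof -
      have "dtree_on n t" "depth t \<le> d"
        using that on dl dr depth_fixt[of "{i}" "\<lambda>_. -1" l] depth_fixt[of "{i}" "\<lambda>_. 1" r]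
        by (auto simp: l'_def r'_def intro: dtree_on_fixt)
      from Suc.IH[OF this \<open>0 \<le> M\<close> MA] show ?thesis by (simp add: uA)
    qed
    have diff: "\<bar>uavg n (\<lambda>z. F z * tval T z) - uavg n (\<lambda>z. A z * tval T z)\<bar> \<le> M"
    proof -
      have "\<bar>uavg n (\<lambda>z. F z * tval T z) - uavg n (\<lambda>z. A z * tval T z)\<bar>
          \<le> uavg n (\<lambda>z. \<bar>F z * tval T z - A z * tval T z\<bar>)"
        unfolding wavg_diff[symmetric] by (rule uavg_abs)
      also have "\<dots> \<le> uavg n (\<lambda>z. \<bar>diffv i F z\<bar>)"
      proof (rule uavg_mono)
        fix z assume "z \<in> cube n"
        \<comment> \<open>\<open>A z\<close> is the midpoint of the values of \<open>F\<close> at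
          \<open>z\<close> and at its neighbour in direction \<open>i\<close>, so its distance to
          \<open>F z\<close> is half their difference.\<close>
        then have "z(i := 1) = z \<or> z(i := -1) = z"
          using cube_vals[of z n i] i by (metis fun_upd_triv)
        then have "\<bar>F z - A z\<bar> = \<bar>diffv i F z\<bar>"
          by (elim disjE) (auto simp: A_def diffv_def field_simps abs_minus_commute)
        then show "\<bar>F z * tval T z - A z * tval T z\<bar> \<le> \<bar>diffv i F z\<bar>"
          using abs_tval[OF Suc.prems(1), of z] by (simp add: left_diff_distrib[symmetric] abs_mult)
      qed
      also have "\<dots> \<le> M" by (rule Suc.prems(4)[OF i])
      finally show ?thesis .
    qed
    have Al: "uavg n (\<lambda>z. A z * tval T z) = (uavg n (\<lambda>z. A z * tval l' z) + uavg n (\<lambda>z. A z * tval r' z)) / 2"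
      by (subst uavg_resample[OF i]) (simp add: A_upd T_upd wavg_add wavg_divide)
    \<comment> \<open>Both halves keep the same factor \<open>uavg n F\<close>, since
      \<open>A\<close> ignores \<open>i\<close> and thus has the same mean on each. Restricting
      \<open>F\<close> instead of averaging it would produce two different means.\<close>
    have Fl: "uavg n F * uavg n (tval T) = (uavg n F * uavg n (tval l') + uavg n F * uavg n (tval r')) / 2"
      by (subst uavg_resample[OF i, of "tval T"]) (simp add: T_upd wavg_add wavg_divide distrib_left)
    have mid: "\<bar>x - y\<bar> \<le> c" if "x = (a + b) / 2" "y = (p + q) / 2" "\<bar>a - p\<bar> \<le> c" "\<bar>b - q\<bar> \<le> c"
      for x y a b p q c :: real
      using that(3,4) unfolding that(1,2) abs_le_iff by argo
    have "\<bar>uavg n (\<lambda>z. A z * tval T z) - uavg n F * uavg n (tval T)\<bar> \<le> real d * M"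
      by (rule mid[OF Al Fl IH[OF disjI1[OF refl]] IH[OF disjI2[OF refl]]])
    with diff show ?thesis by (simp add: algebra_simps)
  qed
qed

text \<open>The path of \<open>z\<close> is fixed, and the twisted point leaves it only if one of
  the variables on it is flipped: a union bound over at most \<open>depth T\<close>
  variables.\<close>

lemma tree_noise:
  assumes "dtree_on n T" "0 \<le> \<delta>" "\<delta> \<le> 1" "z \<in> cube n"
  shows "wavg n \<delta> (\<lambda>K. of_bool (tree_eval T (twist n z K) \<noteq> tree_eval T z)) \<le> real (depth T) * \<delta>"
  using assms(1)
proof (induction T)
  case (Leaf b)
  then show ?case by simp
next
  case (Node i l r)
  define c where "c = (if z i = -1 then l else r)"
  have i: "i < n" and on: "dtree_on n l" "dtree_on n r" using Node.prems by auto
  have "wavg n \<delta> (\<lambda>K. of_bool (tree_eval (Node i l r) (twist n z K) \<noteq> tree_eval (Node i l r) z))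
      \<le> wavg n \<delta> (\<lambda>K. of_bool (K i = -1) + of_bool (tree_eval c (twist n z K) \<noteq> tree_eval c z))"
  proof (rule wavg_mono[OF assms(2,3)])
    fix K assume "K \<in> cube n"
    then have "K i = -1 \<or> twist n z K i = z i" using cube_vals[of K n i] i by (auto simp: twist_def)
    then show "of_bool (tree_eval (Node i l r) (twist n z K) \<noteq> tree_eval (Node i l r) z)
        \<le> (of_bool (K i = -1) + of_bool (tree_eval c (twist n z K) \<noteq> tree_eval c z) :: real)"
      by (elim disjE) (auto simp: c_def)
  qed
  also have "\<dots> = \<delta> + wavg n \<delta> (\<lambda>K. of_bool (tree_eval c (twist n z K) \<noteq> tree_eval c z))"
    by (simp add: wavg_add) (subst wavg_resample[OF i], simp)
  also have "\<dots> \<le> \<delta> + real (depth c) * \<delta>"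
    using Node.IH on by (auto simp: c_def)
  also have "\<dots> \<le> real (depth (Node i l r)) * \<delta>"
    using assms(2) by (auto simp: c_def algebra_simps intro!: mult_left_mono)
  finally show ?case .
qed

text \<open>The left side is the variance of a sign-valued function. With \<open>p\<close> the
  distance and \<open>g\<close> the tree, the correlation of \<open>h\<close> with \<open>g\<close>
  is \<open>1 - 2 * p\<close>, noise changes it by at most \<open>2 * d * \<delta>\<close>,
  \<open>osss\<close> splits it into the product of the means up to \<open>d * M\<close>, and
  replacing the mean of \<open>g\<close> by that of \<open>h\<close> costs the second
  \<open>2 * p\<close>.\<close>

lemma variance_le:
  assumes T: "dtree_on n T" "depth T \<le> d" and \<delta>: "0 \<le> \<delta>" "\<delta> \<le> 1"
    and h: "\<And>z. z \<in> cube n \<Longrightarrow> h z = -1 \<or> h z = 1"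
    and M: "0 \<le> M" "\<And>i. i < n \<Longrightarrow> uavg n (\<lambda>z. \<bar>diffv i (noise n \<delta> h) z\<bar>) \<le> M"
  shows "1 - (uavg n h)\<^sup>2 \<le> 4 * uavg n (\<lambda>z. of_bool (h z \<noteq> tval T z)) + 2 * real d * \<delta> + real d * M"
proof -
  let ?g = "tval T"
  define p where "p = uavg n (\<lambda>z. of_bool (h z \<noteq> ?g z))"
  have g: "?g z = -1 \<or> ?g z = 1" for z using tree_eval_vals[OF T(1), of z] by auto
  have hg: "uavg n (\<lambda>z. h z * ?g z) = 1 - 2 * p"
  proof -
    have "h z * ?g z = 1 - 2 * of_bool (h z \<noteq> ?g z)" if "z \<in> cube n" for z
      using h[OF that] g[of z] by (elim disjE) auto
    then have "uavg n (\<lambda>z. h z * ?g z) = uavg n (\<lambda>z. 1 - 2 * of_bool (h z \<noteq> ?g z))"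
      by (rule wavg_cong)
    then show ?thesis by (simp add: wavg_diff wavg_cmult p_def)
  qed
  have "\<bar>uavg n ?g - uavg n h\<bar> \<le> uavg n (\<lambda>z. \<bar>?g z - h z\<bar>)"
    unfolding wavg_diff[symmetric] by (rule uavg_abs)
  also have "\<dots> = uavg n (\<lambda>z. 2 * of_bool (h z \<noteq> ?g z))"
  proof (rule wavg_cong)
    fix z assume "z \<in> cube n"
    then show "\<bar>?g z - h z\<bar> = 2 * of_bool (h z \<noteq> ?g z)"
      using h[of z] g[of z] by (elim disjE) auto
  qed
  finally have gh: "\<bar>uavg n ?g - uavg n h\<bar> \<le> 2 * p" by (simp add: wavg_cmult p_def)
  have "\<bar>uavg n h\<bar> \<le> uavg n (\<lambda>z. \<bar>h z\<bar>)" by (rule uavg_abs)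
  also have "\<dots> \<le> uavg n (\<lambda>z. 1)" by (rule uavg_mono) (use h in force)
  finally have h1: "\<bar>uavg n h\<bar> \<le> 1" by simp
  have ng: "\<bar>?g z - noise n \<delta> ?g z\<bar> \<le> 2 * real d * \<delta>" if z: "z \<in> cube n" for z
  proof -
    have "?g z - noise n \<delta> ?g z = wavg n \<delta> (\<lambda>K. ?g z - ?g (twist n z K))"
      by (simp add: noise_def wavg_diff)
    also have "\<bar>\<dots>\<bar> \<le> wavg n \<delta> (\<lambda>K. \<bar>?g z - ?g (twist n z K)\<bar>)" by (rule wavg_abs[OF \<delta>])
    also have "\<dots> \<le> wavg n \<delta> (\<lambda>K. 2 * of_bool (tree_eval T (twist n z K) \<noteq> tree_eval T z))"
    proof (rule wavg_mono[OF \<delta>])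
      fix K
      show "\<bar>?g z - ?g (twist n z K)\<bar> \<le> 2 * of_bool (tree_eval T (twist n z K) \<noteq> tree_eval T z)"
        using tree_eval_vals[OF T(1), of z] tree_eval_vals[OF T(1), of "twist n z K"] by auto
    qed
    also have "\<dots> \<le> 2 * (real (depth T) * \<delta>)"
      unfolding wavg_cmult using tree_noise[OF T(1) \<delta> z] by simp
    also have "\<dots> \<le> 2 * real d * \<delta>" using T(2) \<delta> by (simp add: mult_right_mono)
    finally show ?thesis .
  qed
  have "uavg n (\<lambda>z. h z * ?g z) - uavg n (\<lambda>z. h z * noise n \<delta> ?g z)
      = uavg n (\<lambda>z. h z * (?g z - noise n \<delta> ?g z))"
    by (simp add: right_diff_distrib wavg_diff)
  also have "\<dots> \<le> uavg n (\<lambda>z. 2 * real d * \<delta>)"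
  proof (rule uavg_mono)
    fix z assume z: "z \<in> cube n"
    then show "h z * (?g z - noise n \<delta> ?g z) \<le> 2 * real d * \<delta>"
      using ng[OF z] h[OF z] by (auto simp: abs_le_iff)
  qed
  \<comment> \<open>Noise is known to be cheap on the shallow tree only, so it is charged to
    \<open>?g\<close> and then moved onto \<open>h\<close> by self-adjointness, where the influences
    are controlled.\<close>
  finally have 1: "1 - 2 * p \<le> uavg n (\<lambda>z. noise n \<delta> h z * ?g z) + 2 * real d * \<delta>"
    by (simp add: hg noise_self_adjoint)
  have 2: "uavg n (\<lambda>z. noise n \<delta> h z * ?g z) \<le> uavg n h * uavg n ?g + real d * M"
    using osss[OF T M] by (simp add: uavg_noise)
  have "uavg n h * (uavg n ?g - uavg n h) \<le> \<bar>uavg n h\<bar> * \<bar>uavg n ?g - uavg n h\<bar>"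
    by (metis abs_ge_self abs_mult)
  also have "\<dots> \<le> 1 * (2 * p)" by (rule mult_mono) (use h1 gh in auto)
  finally have "uavg n h * uavg n ?g \<le> (uavg n h)\<^sup>2 + 2 * p"
    by (simp add: power2_eq_square algebra_simps)
  with 1 2 show ?thesis unfolding p_def by linarith
qed

text \<open>The two noisy values agree unless \<open>h\<close> differs from \<open>T\<close> at one
  of the copies, each of them uniform, or \<open>T\<close> changes between \<open>z\<close> and one
  of them. Each of these four events lowers the product by at most 2.\<close>

lemma stab_ge:
  assumes T: "dtree_on n T" "depth T \<le> d" and \<delta>: "0 \<le> \<delta>" "\<delta> \<le> 1"
    and h: "\<And>z. z \<in> cube n \<Longrightarrow> h z = -1 \<or> h z = 1"
  shows "stab n \<delta> h \<ge> 1 - 4 * uavg n (\<lambda>z. of_bool (h z \<noteq> tval T z)) - 4 * real d * \<delta>"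
proof -
  define p where "p = uavg n (\<lambda>z. of_bool (h z \<noteq> tval T z))"
  define e where "e z K = (of_bool (h (twist n z K) \<noteq> tval T (twist n z K)) :: real)" for z K
  define t where "t z K = (of_bool (tree_eval T (twist n z K) \<noteq> tree_eval T z) :: real)" for z K
  have E: "uavg n (\<lambda>z. wavg n \<delta> (\<lambda>K. e z K)) = p"
  proof -
    have "uavg n (\<lambda>z. wavg n \<delta> (\<lambda>K. e z K)) = wavg n \<delta> (\<lambda>K. uavg n (\<lambda>z. e z K))" by (rule wavg_swap)
    also have "\<dots> = wavg n \<delta> (\<lambda>K. p)"
      unfolding e_def p_def by (rule wavg_cong, rule uavg_twist)
    finally show ?thesis by simp
  qed
  have Tn: "uavg n (\<lambda>z. wavg n \<delta> (\<lambda>K. t z K)) \<le> real d * \<delta>"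
  proof -
    have "uavg n (\<lambda>z. wavg n \<delta> (\<lambda>K. t z K)) \<le> uavg n (\<lambda>z. real d * \<delta>)"
      unfolding t_def
      by (rule uavg_mono, rule order_trans[OF tree_noise[OF T(1) \<delta>]])
         (use T(2) \<delta> in \<open>auto intro: mult_right_mono\<close>)
    then show ?thesis by simp
  qed
  have "uavg n (\<lambda>z. wavg n \<delta> (\<lambda>K. wavg n \<delta> (\<lambda>K'. 1 - 2 * (e z K + e z K' + t z K + t z K'))))
     \<le> uavg n (\<lambda>z. wavg n \<delta> (\<lambda>K. wavg n \<delta> (\<lambda>K'. h (twist n z K) * h (twist n z K'))))"
  proof (intro uavg_mono wavg_mono[OF \<delta>])
    fix z K K' assume zK: "z \<in> cube n" "K \<in> cube n" "K' \<in> cube n"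
    then have "h (twist n z K) = -1 \<or> h (twist n z K) = 1" "h (twist n z K') = -1 \<or> h (twist n z K') = 1"
      by (auto intro!: h)
    moreover have "tree_eval T w = -1 \<or> tree_eval T w = 1" for w using tree_eval_vals[OF T(1)] .
    ultimately show "1 - 2 * (e z K + e z K' + t z K + t z K') \<le> h (twist n z K) * h (twist n z K')"
      unfolding e_def t_def by (elim disjE) (auto simp: of_bool_def)
  qed
  also have "\<dots> = stab n \<delta> h"
    by (simp add: stab_def noise_def power2_eq_square wavg_cmult wavg_multc)
  finally have "1 - 2 * (2 * p + 2 * uavg n (\<lambda>z. wavg n \<delta> (t z))) \<le> stab n \<delta> h"
    by (simp add: wavg_diff wavg_cmult wavg_add E algebra_simps)
  with Tn show ?thesis unfolding p_def by simp
qed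

lemma stab_le_1:
  assumes \<delta>: "0 \<le> \<delta>" "\<delta> \<le> 1" and h: "\<And>z. z \<in> cube n \<Longrightarrow> h z = -1 \<or> h z = 1"
  shows "stab n \<delta> h \<le> 1"
proof -
  have "(noise n \<delta> h z)\<^sup>2 \<le> 1" if z: "z \<in> cube n" for z
  proof -
    have "\<bar>noise n \<delta> h z\<bar> \<le> wavg n \<delta> (\<lambda>K. \<bar>h (twist n z K)\<bar>)"
      unfolding noise_def by (rule wavg_abs[OF \<delta>])
    also have "\<dots> \<le> wavg n \<delta> (\<lambda>K. 1)"
      by (rule wavg_mono[OF \<delta>]) (use h z in \<open>metis abs_1 abs_minus_cancel order_refl twist_cube\<close>)
    finally show ?thesis by (simp add: abs_square_le_1)
  qed
  then have "stab n \<delta> h \<le> uavg n (\<lambda>_. 1)" unfolding stab_def by (rule uavg_mono)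
  then show ?thesis by simp
qed

section \<open>Greedy growth of a tree\<close>

definition restr :: "((nat \<Rightarrow> int) \<Rightarrow> int) \<Rightarrow> nat set \<Rightarrow> (nat \<Rightarrow> int) \<Rightarrow> (nat \<Rightarrow> int) \<Rightarrow> real" where
  "restr f S x z = real_of_int (f (mix S x z))"

text \<open>Refreshing the coordinates outside \<open>S\<close> and then querying \<open>i\<close>
  moves to a child chosen by the fresh bit \<open>z i\<close>. A repeated variable is harmless, both
  sides then ignoring \<open>z i\<close>.\<close>

lemma restr_insert_mix: "restr f (insert i S) (mix S x z) = fixv i (z i) (restr f S x)"
proof
  fix y
  have "mix (insert i S) (mix S x z) y = mix S x (y(i := z i))" by (auto simp: mix_def)
  then show "restr f (insert i S) (mix S x z) y = fixv i (z i) (restr f S x) y"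
    by (simp add: restr_def fixv_def)
qed

lemma fdist_uavg: "fdist n f g = uavg n (\<lambda>x. of_bool (f x \<noteq> g x))"
proof -
  have "(\<Sum>x\<in>cube n. of_bool (f x \<noteq> g x)) = real (card (cube n \<inter> {x. f x \<noteq> g x}))"
    by (simp add: of_bool_def sum.If_cases Int_def)
  then show ?thesis
    by (simp add: fdist_def measure_pmf_of_set uavg_eq card_cube)
qed

text \<open>The state of a path is a set because the answers on it are read off \<open>x\<close>;
  the level is an argument of \<open>sel\<close> because each level has its own samples.\<close>

primrec vars :: "(nat \<Rightarrow> nat set \<Rightarrow> (nat \<Rightarrow> int) \<Rightarrow> nat) \<Rightarrow> nat \<Rightarrow> (nat \<Rightarrow> int) \<Rightarrow> nat set" where
  "vars sel 0 x = {}"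
| "vars sel (Suc j) x = insert (sel j (vars sel j x) x) (vars sel j x)"

text \<open>\<open>sel_local\<close> says that a choice uses only answers already received, which is
  what makes the growth a decision tree.\<close>

locale growth =
  fixes n :: nat and f :: "(nat \<Rightarrow> int) \<Rightarrow> int" and sel :: "nat \<Rightarrow> nat set \<Rightarrow> (nat \<Rightarrow> int) \<Rightarrow> nat"
  assumes f: "f \<in> cube n \<rightarrow> {-1, 1}"
    and sel_less: "sel j S x < n"
    and sel_local: "(\<And>i. i \<in> S \<Longrightarrow> x i = y i) \<Longrightarrow> sel j S x = sel j S y"
begin

lemma vars_local: "(\<And>i. i \<in> vars sel j x \<Longrightarrow> x i = y i) \<Longrightarrow> vars sel j y = vars sel j x"
proof (induction j)
  case (Suc j)
  then have "vars sel j y = vars sel j x" "\<And>i. i \<in> vars sel j x \<Longrightarrow> x i = y i" by auto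
  with sel_local[of "vars sel j x" x y j] show ?case by simp
qed simp

text \<open>The stopping property required by \<open>uavg_mix_stopping\<close>: refreshing what was
  not read leaves the path unchanged.\<close>

lemma vars_mix: "vars sel j (mix (vars sel j x) x z) = vars sel j x"
  by (rule vars_local) (simp add: mix_def)

lemma vars_subset: "vars sel j x \<subseteq> {..<n}"
  by (induction j) (auto simp: sel_less)

text \<open>Nodes are indexed by points: an average over uniform \<open>x\<close> weights every node
  by the probability of reaching it.\<close>

definition node :: "nat \<Rightarrow> (nat \<Rightarrow> int) \<Rightarrow> (nat \<Rightarrow> int) \<Rightarrow> real" where
  "node j x = restr f (vars sel j x) x"

lemma node_vals: "x \<in> cube n \<Longrightarrow> z \<in> cube n \<Longrightarrow> node j x z = -1 \<or> node j x z = 1"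
  using f mix_cube[of x n z "vars sel j x"] by (auto simp: node_def restr_def Pi_def)

text \<open>Conditioned on the answers so far, the other coordinates are still uniform, so the next
  answer is a fair coin.\<close>

lemma node_step:
  "uavg n (\<lambda>x. \<Psi> (node (Suc j) x)) =
   uavg n (\<lambda>x. (\<Psi> (fixv (sel j (vars sel j x) x) (-1) (node j x))
               + \<Psi> (fixv (sel j (vars sel j x) x) 1 (node j x))) / 2)"
proof -
  let ?i = "\<lambda>x. sel j (vars sel j x) x"
  have "uavg n (\<lambda>x. \<Psi> (node (Suc j) x)) = uavg n (\<lambda>x. uavg n (\<lambda>z. \<Psi> (node (Suc j) (mix (vars sel j x) x z))))"
    by (rule uavg_mix_stopping[symmetric, of n "vars sel j"]) (simp add: vars_mix)
  also have "\<dots> = uavg n (\<lambda>x. uavg n (\<lambda>z. \<Psi> (fixv (?i x) (z (?i x)) (node j x))))"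
  proof (intro wavg_cong)
    fix x z
    have "?i (mix (vars sel j x) x z) = ?i x"
      unfolding vars_mix by (rule sel_local) (simp add: mix_def)
    then show "\<Psi> (node (Suc j) (mix (vars sel j x) x z)) = \<Psi> (fixv (?i x) (z (?i x)) (node j x))"
      by (simp add: node_def vars_mix restr_insert_mix)
  qed
  also have "\<dots> = uavg n (\<lambda>x. (\<Psi> (fixv (?i x) (-1) (node j x)) + \<Psi> (fixv (?i x) 1 (node j x))) / 2)"
  proof (rule wavg_cong)
    fix x
    show "uavg n (\<lambda>z. \<Psi> (fixv (?i x) (z (?i x)) (node j x)))
        = (\<Psi> (fixv (?i x) (-1) (node j x)) + \<Psi> (fixv (?i x) 1 (node j x))) / 2"
      by (subst uavg_resample[of "?i x"]) (simp_all add: sel_less)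
  qed
  finally show ?thesis .
qed

section \<open>Potential argument: variance at the nodes against noise stability\<close>

definition var :: "nat \<Rightarrow> real" where
  "var j = uavg n (\<lambda>x. 1 - (uavg n (node j x))\<^sup>2)"

definition pot :: "real \<Rightarrow> nat \<Rightarrow> real" where
  "pot \<delta> j = uavg n (\<lambda>x. stab n \<delta> (node j x))"

definition infl :: "real \<Rightarrow> nat \<Rightarrow> (nat \<Rightarrow> int) \<Rightarrow> real" where
  "infl \<delta> j x = Max ((\<lambda>i. uavg n (\<lambda>z. (diffv i (noise n \<delta> (node j x)) z)\<^sup>2)) ` {..<n})"

text \<open>A query splits the mean \<open>(a + b) / 2\<close> of a node into \<open>a\<close> and
  \<open>b\<close>; convexity of the square does the rest.\<close>

lemma var_Suc: "var (Suc j) \<le> var j"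
  unfolding var_def
proof (subst node_step, rule uavg_mono)
  fix x
  define i where "i = sel j (vars sel j x) x"
  define a b where "a = uavg n (fixv i (-1) (node j x))" and "b = uavg n (fixv i 1 (node j x))"
  have ab: "uavg n (node j x) = (a + b) / 2"
    unfolding a_def b_def fixv_def
    by (subst uavg_resample[of i]) (simp_all add: i_def sel_less wavg_add wavg_divide)
  have "((a + b) / 2)\<^sup>2 \<le> (a\<^sup>2 + b\<^sup>2) / 2"
    using sum_squares_ge_zero[of "a - b" 0] by (simp add: power2_eq_square field_simps)
  then have "(1 - a\<^sup>2 + (1 - b\<^sup>2)) / 2 \<le> 1 - (uavg n (node j x))\<^sup>2" unfolding ab by argo
  then show "(1 - (uavg n (fixv (sel j (vars sel j x) x) (-1) (node j x)))\<^sup>2 +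
      (1 - (uavg n (fixv (sel j (vars sel j x) x) 1 (node j x)))\<^sup>2)) / 2 \<le> 1 - (uavg n (node j x))\<^sup>2"
    by (simp add: a_def b_def i_def)
qed

lemma var_antimono: "j \<le> k \<Longrightarrow> var k \<le> var j"
  by (rule lift_Suc_antimono_le[of var]) (auto simp: var_Suc)

lemma n_pos: "0 < n" using sel_less[of 0 "{}" undefined] by auto

text \<open>The selected score is within \<open>2 * \<eta>\<close> of the best, and dividing by
  \<open>(1 - \<delta>)^2 \<ge> 1 / 4\<close> makes this \<open>8 * \<eta>\<close> in terms of
  stability. The gain \<open>4 * \<delta> * (1 - \<delta>)\<close> is at least
  \<open>2 * \<delta>\<close> for \<open>\<delta> \<le> 1 / 2\<close>.\<close>

lemma pot_Suc:
  assumes \<delta>: "0 \<le> \<delta>" "\<delta> \<le> 1/2"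
    and near: "\<And>x i. x \<in> cube n \<Longrightarrow> i < n \<Longrightarrow>
      score n \<delta> (node j x) i \<le> score n \<delta> (node j x) (sel j (vars sel j x) x) + 2 * \<eta>"
    and \<eta>: "0 \<le> \<eta>"
  shows "pot \<delta> (Suc j) \<ge> pot \<delta> j + 2 * \<delta> * uavg n (infl \<delta> j) - 8 * \<eta>"
proof -
  have "pot \<delta> j + 2 * \<delta> * uavg n (infl \<delta> j) - 8 * \<eta>
     = uavg n (\<lambda>x. stab n \<delta> (node j x) + 2 * \<delta> * infl \<delta> j x - 8 * \<eta>)"
    by (simp add: pot_def wavg_add wavg_diff wavg_cmult)
  also have "\<dots> \<le> pot \<delta> (Suc j)"
    unfolding pot_def node_step[of "stab n \<delta>"]
  proof (rule uavg_mono)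
    fix x assume x: "x \<in> cube n"
    let ?h = "node j x" and ?I = "\<lambda>i. uavg n (\<lambda>z. (diffv i (noise n \<delta> (node j x)) z)\<^sup>2)"
    define A where "A = (\<lambda>i. (stab n \<delta> (fixv i (-1) ?h) + stab n \<delta> (fixv i 1 ?h)) / 2)"
    define s where "s = sel j (vars sel j x) x"
    have "infl \<delta> j x \<in> ?I ` {..<n}" unfolding infl_def using n_pos by (intro Max_in) auto
    then obtain i where i: "i < n" "infl \<delta> j x = ?I i" by auto
    have I0: "0 \<le> infl \<delta> j x" unfolding i(2) using uavg_mono[of n "\<lambda>_. 0"] by simp
    have "stab n \<delta> ?h + 2 * \<delta> * infl \<delta> j x \<le> stab n \<delta> ?h + 4 * \<delta> * (1 - \<delta>) * infl \<delta> j x"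
    proof -
      have "2 * \<delta> * 1 \<le> 2 * \<delta> * (2 * (1 - \<delta>))" using \<delta> by (intro mult_left_mono) auto
      then have "2 * \<delta> \<le> 4 * \<delta> * (1 - \<delta>)" by argo
      from mult_right_mono[OF this I0] show ?thesis by simp
    qed
    also have "\<dots> \<le> A i"
      using stab_progress[OF i(1), of \<delta> ?h] \<delta> i(2) by (simp add: A_def)
    also have "A i \<le> A s + 8 * \<eta>"
    proof -
      have "(1 - \<delta>)\<^sup>2 * A i \<le> (1 - \<delta>)\<^sup>2 * A s + 2 * \<eta>"
        using near[OF x i(1)] score_eq[OF i(1), of \<delta> ?h] score_eq[OF sel_less, of \<delta> ?h j "vars sel j x" x]
        by (simp add: A_def s_def)
      moreover have q: "(1 - \<delta>)\<^sup>2 \<ge> (1/2)\<^sup>2" using \<delta> by (intro power_mono) auto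
      have "2 * \<eta> \<le> (1 - \<delta>)\<^sup>2 * (8 * \<eta>)"
        using mult_right_mono[OF q, of "8 * \<eta>"] \<eta> by (simp add: power2_eq_square)
      ultimately have "(1 - \<delta>)\<^sup>2 * A i \<le> (1 - \<delta>)\<^sup>2 * (A s + 8 * \<eta>)"
        by (simp add: algebra_simps)
      then show ?thesis using \<delta> by (subst (asm) mult_le_cancel_left_pos) auto
    qed
    finally show "stab n \<delta> ?h + 2 * \<delta> * infl \<delta> j x - 8 * \<eta>
       \<le> (stab n \<delta> (fixv (sel j (vars sel j x) x) (-1) ?h) + stab n \<delta> (fixv (sel j (vars sel j x) x) 1 ?h)) / 2"
      unfolding A_def s_def by linarith
  qed
  finally show ?thesis .
qed

text \<open>A single node may be far from its restricted tree; only the average over the nodes of a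
  level is controlled, and it equals the global distance.\<close>

lemma node_dist:
  "uavg n (\<lambda>x. uavg n (\<lambda>z. of_bool (node j x z \<noteq> tval (fixt (vars sel j x) x T) z))) = fdist n f (tree_eval T)"
  unfolding fdist_uavg node_def restr_def tree_eval_fixt of_int_eq_iff
  by (rule uavg_mix_stopping) (simp add: vars_mix)

text \<open>\<open>variance_le\<close> at each node, averaged. The term \<open>d * sqrt s\<close> is
  first replaced by \<open>e / 4 + d^2 * s / e\<close>, which is linear in \<open>s\<close> and
  therefore survives averaging; \<open>e\<close> is a free trade-off.\<close>

lemma var_le:
  assumes T: "dtree_on n T" "depth T \<le> d" and \<delta>: "0 \<le> \<delta>" "\<delta> \<le> 1" and e: "e > 0"
  shows "var j \<le> 4 * fdist n f (tree_eval T) + 2 * real d * \<delta> + e / 4 + (real d)\<^sup>2 / e * uavg n (infl \<delta> j)"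
proof -
  have "var j \<le> uavg n (\<lambda>x. 4 * uavg n (\<lambda>z. of_bool (node j x z \<noteq> tval (fixt (vars sel j x) x T) z))
      + 2 * real d * \<delta> + e / 4 + (real d)\<^sup>2 / e * infl \<delta> j x)"
    unfolding var_def
  proof (rule uavg_mono)
    fix x assume x: "x \<in> cube n"
    let ?T = "fixt (vars sel j x) x T" and ?M = "sqrt (infl \<delta> j x)"
    let ?I = "\<lambda>i. uavg n (\<lambda>z. (diffv i (noise n \<delta> (node j x)) z)\<^sup>2)"
    have I: "?I i \<le> infl \<delta> j x" if "i < n" for i
      unfolding infl_def using that by (intro Max_ge) auto
    have M: "uavg n (\<lambda>z. \<bar>diffv i (noise n \<delta> (node j x)) z\<bar>) \<le> ?M" if "i < n" for i
      using order_trans[OF uavg_abs_le_sqrt] I[OF that] real_sqrt_le_iff by blast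
    have I0: "0 \<le> infl \<delta> j x"
      using I[OF n_pos] uavg_mono[of n "\<lambda>_. 0" "\<lambda>z. (diffv 0 (noise n \<delta> (node j x)) z)\<^sup>2"] by simp
    have "real d * ?M \<le> e / 4 + (real d * ?M)\<^sup>2 / e"
    proof -
      have "0 \<le> (real d * ?M - e / 2)\<^sup>2" by simp
      then show ?thesis using e by (simp add: power2_eq_square field_simps)
    qed
    also have "\<dots> = e / 4 + (real d)\<^sup>2 / e * infl \<delta> j x"
      using I0 by (simp add: power_mult_distrib)
    finally have dM: "real d * ?M \<le> e / 4 + (real d)\<^sup>2 / e * infl \<delta> j x" .
    have "1 - (uavg n (node j x))\<^sup>2 \<le> 4 * uavg n (\<lambda>z. of_bool (node j x z \<noteq> tval ?T z)) + 2 * real d * \<delta> + real d * ?M"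
      by (rule variance_le) (use T \<delta> I0 M node_vals[OF x] depth_fixt[of "vars sel j x" x T] dtree_on_fixt in auto)
    with dM show "1 - (uavg n (node j x))\<^sup>2 \<le> 4 * uavg n (\<lambda>z. of_bool (node j x z \<noteq> tval ?T z))
      + 2 * real d * \<delta> + e / 4 + (real d)\<^sup>2 / e * infl \<delta> j x" by linarith
  qed
  also have "\<dots> = 4 * fdist n f (tree_eval T) + 2 * real d * \<delta> + e / 4 + (real d)\<^sup>2 / e * uavg n (infl \<delta> j)"
    by (simp add: wavg_add wavg_cmult wavg_divide node_dist)
  finally show ?thesis .
qed

lemma pot_0:
  assumes T: "dtree_on n T" "depth T \<le> d" and \<delta>: "0 \<le> \<delta>" "\<delta> \<le> 1"
  shows "pot \<delta> 0 \<ge> 1 - 4 * fdist n f (tree_eval T) - 4 * real d * \<delta>"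
proof -
  have h: "node 0 x = (\<lambda>z. real_of_int (f z))" for x
    by (simp add: node_def restr_def mix_def fun_eq_iff)
  have "1 - 4 * uavg n (\<lambda>z. of_bool (real_of_int (f z) \<noteq> tval T z)) - 4 * real d * \<delta>
      \<le> stab n \<delta> (\<lambda>z. real_of_int (f z))"
    by (rule stab_ge[OF T \<delta>]) (use f in \<open>auto simp: Pi_def\<close>)
  then show ?thesis by (simp add: pot_def h fdist_uavg)
qed

lemma pot_le_1: "0 \<le> \<delta> \<Longrightarrow> \<delta> \<le> 1 \<Longrightarrow> pot \<delta> j \<le> 1"
  using uavg_mono[of n "\<lambda>x. stab n \<delta> (node j x)" "\<lambda>_. 1"] stab_le_1[OF _ _ node_vals]
  by (simp add: pot_def)

text \<open>The potential starts near 1 and never exceeds 1, which bounds the sum of the largest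
  influences over all levels. As \<open>var\<close> decreases with the level, \<open>var D\<close>
  is at most the average of the \<open>D\<close> bounds from \<open>var_le\<close>.\<close>

lemma var_final:
  assumes T: "dtree_on n T" "depth T \<le> d" and \<delta>: "0 < \<delta>" "\<delta> \<le> 1/2" and e: "e > 0" and \<eta>: "0 \<le> \<eta>"
    and near: "\<And>j x i. j < D \<Longrightarrow> x \<in> cube n \<Longrightarrow> i < n \<Longrightarrow>
      score n \<delta> (node j x) i \<le> score n \<delta> (node j x) (sel j (vars sel j x) x) + 2 * \<eta>"
    and D: "D > 0"
  shows "var D \<le> 4 * fdist n f (tree_eval T) + 2 * real d * \<delta> + e / 4
      + (real d)\<^sup>2 / (e * 2 * \<delta> * real D) * (4 * fdist n f (tree_eval T) + 4 * real d * \<delta> + 8 * real D * \<eta>)"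
proof -
  define p where "p = fdist n f (tree_eval T)"
  define s where "s j = uavg n (infl \<delta> j)" for j
  have "pot \<delta> 0 + 2 * \<delta> * (\<Sum>j<k. s j) - 8 * real k * \<eta> \<le> pot \<delta> k" if "k \<le> D" for k
    using that
  proof (induction k)
    case (Suc k)
    have "pot \<delta> k + 2 * \<delta> * s k - 8 * \<eta> \<le> pot \<delta> (Suc k)"
      unfolding s_def by (rule pot_Suc) (use \<delta> near Suc.prems \<eta> in auto)
    with Suc show ?case by (simp add: algebra_simps)
  qed simp
  from this[of D] have "2 * \<delta> * (\<Sum>j<D. s j) \<le> 4 * p + 4 * real d * \<delta> + 8 * real D * \<eta>"
    using pot_0[OF T, of \<delta>] pot_le_1[of \<delta> D] \<delta> by (simp add: p_def)
  then have S: "(\<Sum>j<D. s j) \<le> (4 * p + 4 * real d * \<delta> + 8 * real D * \<eta>) / (2 * \<delta>)"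
    using \<delta> by (simp add: field_simps)
  have "D * var D = (\<Sum>j<D. var D)" by simp
  also have "\<dots> \<le> (\<Sum>j<D. 4 * p + 2 * real d * \<delta> + e / 4 + (real d)\<^sup>2 / e * s j)"
    unfolding p_def s_def
    by (rule sum_mono, rule order_trans[OF var_antimono var_le[OF T]]) (use \<delta> e in auto)
  also have "\<dots> = D * (4 * p + 2 * real d * \<delta> + e / 4) + (real d)\<^sup>2 / e * (\<Sum>j<D. s j)"
    by (simp add: sum.distrib sum_distrib_left)
  also have "\<dots> \<le> D * (4 * p + 2 * real d * \<delta> + e / 4)
      + (real d)\<^sup>2 / e * ((4 * p + 4 * real d * \<delta> + 8 * real D * \<eta>) / (2 * \<delta>))"
    by (intro add_left_mono mult_left_mono S) (use e in auto)
  also have "\<dots> = D * (4 * p + 2 * real d * \<delta> + e / 4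
      + (real d)\<^sup>2 / (e * 2 * \<delta> * real D) * (4 * p + 4 * real d * \<delta> + 8 * real D * \<eta>))"
    using D e \<delta> by (simp add: field_simps)
  finally show ?thesis using D unfolding p_def by (subst (asm) mult_le_cancel_left_pos) auto
qed

text \<open>A leaf of mean \<open>\<mu>\<close> has error \<open>(1 - lab * \<mu>) / 2\<close>, at
  most \<open>(1 - \<bar>\<mu>\<bar>) / 2 + \<eta>\<close>, and
  \<open>\<mu>^2 \<le> \<bar>\<mu>\<bar>\<close> because
  \<open>\<bar>\<mu>\<bar> \<le> 1\<close>.\<close>

lemma label_error:
  assumes lab: "\<And>x. lab x = -1 \<or> lab x = (1::int)" 
    and lab_local: "\<And>x z. lab (mix (vars sel D x) x z) = lab x"
    and good: "\<And>x. x \<in> cube n \<Longrightarrow> \<bar>uavg n (node D x)\<bar> \<le> lab x * uavg n (node D x) + 2 * \<eta>"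
  shows "fdist n lab f \<le> var D / 2 + \<eta>"
proof -
  have "fdist n lab f = uavg n (\<lambda>x. uavg n (\<lambda>z. of_bool (real_of_int (lab x) \<noteq> node D x z)))"
    unfolding fdist_uavg node_def restr_def
    by (subst uavg_mix_stopping[symmetric, of n "vars sel D"]) (simp_all add: vars_mix lab_local)
  also have "\<dots> \<le> uavg n (\<lambda>x. (1 - (uavg n (node D x))\<^sup>2) / 2 + \<eta>)"
  proof (rule uavg_mono)
    fix x assume x: "x \<in> cube n"
    let ?\<mu> = "uavg n (node D x)"
    have "of_bool (real_of_int (lab x) \<noteq> node D x z) = (1 - lab x * node D x z) / 2" if "z \<in> cube n" for z
      using lab[of x] node_vals[OF x that, of D] by (elim disjE) auto
    then have "uavg n (\<lambda>z. of_bool (real_of_int (lab x) \<noteq> node D x z)) = uavg n (\<lambda>z. (1 - lab x * node D x z) / 2)"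
      by (rule wavg_cong)
    also have "\<dots> = (1 - lab x * ?\<mu>) / 2" by (simp add: wavg_diff wavg_divide wavg_cmult)
    also have "\<dots> \<le> (1 - ?\<mu>\<^sup>2) / 2 + \<eta>"
    proof -
      have "\<bar>?\<mu>\<bar> \<le> uavg n (\<lambda>z. \<bar>node D x z\<bar>)" by (rule uavg_abs)
      also have "\<dots> \<le> uavg n (\<lambda>_. 1)"
        by (rule uavg_mono) (metis node_vals[OF x] abs_1 abs_minus_cancel order_refl)
      finally have "\<bar>?\<mu>\<bar> * \<bar>?\<mu>\<bar> \<le> \<bar>?\<mu>\<bar> * 1" by (intro mult_left_mono) auto
      then have "?\<mu>\<^sup>2 \<le> \<bar>?\<mu>\<bar>" by (simp add: power2_eq_square)
      then show ?thesis using good[OF x] by (simp add: field_simps)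
    qed
    finally show "uavg n (\<lambda>z. of_bool (real_of_int (lab x) \<noteq> node D x z)) \<le> (1 - ?\<mu>\<^sup>2) / 2 + \<eta>" .
  qed
  also have "\<dots> = var D / 2 + \<eta>" by (simp add: var_def wavg_add wavg_divide)
  finally show ?thesis .
qed

end

section \<open>Random coins\<close>

lemma prob_space_coins: "prob_space coins"
  unfolding coins_def by (intro prob_space_PiM prob_space_measure_pmf)

lemma space_coins [simp]: "space coins = UNIV"
  by (simp add: coins_def space_PiM)

interpretation coin: prob_space coins
  by (rule prob_space_coins)

abbreviation bit_space :: "bool measure" where
  "bit_space \<equiv> measure_pmf (bernoulli_pmf (1/2))"

text \<open>On finitely many coins every set of outcomes is measurable, so nothing has to be shown
  about the functions applied to them.\<close>

lemma sets_bit_PiM: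
  assumes "finite J"
  shows "sets (PiM J (\<lambda>_. bit_space)) = Pow (J \<rightarrow>\<^sub>E UNIV)"
proof -
  have "sets (PiM J (\<lambda>_. bit_space)) = sets (PiM J (\<lambda>_. count_space (UNIV :: bool set)))"
    by (intro sets_PiM_cong) auto
  also have "\<dots> = sets (count_space (J \<rightarrow>\<^sub>E UNIV))"
    by (subst count_space_PiM_finite) (use assms in auto)
  finally show ?thesis by simp
qed

lemma measurable_coin [measurable]: "(\<lambda>\<omega>. \<omega> p) \<in> measurable coins bit_space"
  unfolding coins_def by (rule measurable_component_singleton) simp

lemma indep_coins: "coin.indep_vars (\<lambda>_. bit_space) (\<lambda>p \<omega>. \<omega> p) UNIV"
proof -
  interpret P: product_prob_space "\<lambda>_. bit_space" UNIV
    by unfold_locales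
  have "distr coins bit_space (\<lambda>\<omega>. \<omega> p) = bit_space" for p
    unfolding coins_def using P.PiM_component[of p] by simp
  moreover have "distr coins (PiM UNIV (\<lambda>_. bit_space)) (\<lambda>\<omega>. \<omega>) = coins"
    unfolding coins_def by (rule distr_id)
  ultimately show ?thesis
    by (subst coin.indep_vars_iff_distr_eq_PiM') (auto simp: coins_def restrict_UNIV)
qed

text \<open>A purely combinatorial condition: with finite sets it yields measurability, with
  disjoint finite sets also independence.\<close>

definition depends_on :: "nat set \<Rightarrow> ((nat \<Rightarrow> bool) \<Rightarrow> 'b) \<Rightarrow> bool" where
  "depends_on J g \<longleftrightarrow> (\<forall>\<omega> \<omega>'. (\<forall>p\<in>J. \<omega> p = \<omega>' p) \<longrightarrow> g \<omega> = g \<omega>')"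

lemma depends_on_restrict: "depends_on J g \<Longrightarrow> g (restrict \<omega> J) = g \<omega>"
  unfolding depends_on_def by (metis restrict_apply')

lemma indep_blocks:
  assumes "disjoint_family_on J L" "\<And>l. l \<in> L \<Longrightarrow> finite (J l)" "\<And>l. l \<in> L \<Longrightarrow> depends_on (J l) (g l)"
    and "\<And>l. space (N l) = UNIV"
  shows "coin.indep_vars N g L"
proof -
  have "coin.indep_vars (\<lambda>l. PiM (J l) (\<lambda>_. bit_space)) (\<lambda>l \<omega>. restrict (\<lambda>p. \<omega> p) (J l)) L"
    by (rule coin.indep_vars_restrict[OF indep_coins]) (use assms in auto)
  then have "coin.indep_vars N (\<lambda>l \<omega>. g l (restrict (\<lambda>p. \<omega> p) (J l))) L"
  proof (rule coin.indep_vars_compose2)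
    fix l assume "l \<in> L"
    then show "g l \<in> measurable (PiM (J l) (\<lambda>_. bit_space)) (N l)"
      using assms(2,4) by (auto simp: measurable_def sets_bit_PiM space_PiM)
  qed
  then show ?thesis
    by (rule coin.indep_vars_cong[THEN iffD1, rotated -1]) (simp_all add: depends_on_restrict[OF assms(3)])
qed

text \<open>The one-block case of \<open>indep_blocks\<close>, since independence of a family
  includes measurability of its members.\<close>

lemma measurable_depends:
  assumes "depends_on J g" "finite J" "space N = UNIV"
  shows "g \<in> measurable coins N"
  using indep_blocks[of "\<lambda>_. J" "{()}" "\<lambda>_. g" "\<lambda>_. N"] assms
  by (simp add: coin.indep_vars_def disjoint_family_on_def)

lemma prob_blocks:
  assumes L: "finite L" and J: "disjoint_family_on J L" "\<And>l. l \<in> L \<Longrightarrow> finite (J l)"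
    and E: "\<And>l. l \<in> L \<Longrightarrow> depends_on (J l) (E l)"
  shows "coin.prob {\<omega>. \<forall>l\<in>L. E l \<omega>} = (\<Prod>l\<in>L. coin.prob {\<omega>. E l \<omega>})"
proof (cases "L = {}")
  case True
  then show ?thesis using coin.prob_space by simp
next
  case False
  have "coin.indep_vars (\<lambda>_. count_space UNIV) E L"
    by (rule indep_blocks[OF J E]) auto
  from coin.indep_varsD_finite[OF this False L, of "\<lambda>_. {True}"]
  have "coin.prob (\<Inter>l\<in>L. E l -` {True}) = (\<Prod>l\<in>L. coin.prob (E l -` {True}))" by simp
  moreover have "(\<Inter>l\<in>L. E l -` {True}) = {\<omega>. \<forall>l\<in>L. E l \<omega>}" by auto
  moreover have "E l -` {True} = {\<omega>. E l \<omega>}" for l by auto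
  ultimately show ?thesis by simp
qed

lemma prob_coin: "coin.prob {\<omega>. \<omega> p = b} = 1 / 2"
proof -
  interpret P: product_prob_space "\<lambda>_. bit_space" UNIV
    by unfold_locales
  have "coin.prob ((\<lambda>\<omega>. \<omega> p) -` {b} \<inter> space coins) = measure (distr coins bit_space (\<lambda>\<omega>. \<omega> p)) {b}"
    by (rule measure_distr[OF measurable_coin, symmetric]) simp
  also have "distr coins bit_space (\<lambda>\<omega>. \<omega> p) = bit_space"
    unfolding coins_def using P.PiM_component[of p] by simp
  also have "measure bit_space {b} = 1 / 2"
    by (cases b) (simp_all add: measure_pmf_single)
  finally show ?thesis by (simp add: vimage_def)
qed

lemma prob_coins_all: "coin.prob {\<omega>. \<forall>t<a. \<omega> (p + t)} = 1 / 2 ^ a"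
proof -
  have "coin.prob {\<omega>. \<forall>t\<in>{..<a}. \<omega> (p + t)} = (\<Prod>t\<in>{..<a}. coin.prob {\<omega>. \<omega> (p + t)})"
    by (rule prob_blocks[where J = "\<lambda>t. {p + t}"]) (auto simp: disjoint_family_on_def depends_on_def)
  also have "\<dots> = (\<Prod>t\<in>{..<a}. 1 / 2)"
    using prob_coin[of _ True] by (intro prod.cong) auto
  also have "\<dots> = 1 / 2 ^ a" by (simp add: power_one_over)
  finally show ?thesis by (simp add: Ball_def)
qed

lemma measurable_depends_set:
  assumes "depends_on J E" "finite J"
  shows "{\<omega>. E \<omega>} \<in> sets coins"
proof -
  have "E \<in> measurable coins (count_space UNIV)"
    by (rule measurable_depends[OF assms]) simp
  then have "E -` {True} \<inter> space coins \<in> sets coins" by (rule measurable_sets) simp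
  moreover have "E -` {True} = {\<omega>. E \<omega>}" by auto
  ultimately show ?thesis by simp
qed

section \<open>Samples\<close>

text \<open>Sample number \<open>q\<close> uses \<open>1 + 2 * a\<close> coins per coordinate: one for the uniform point, and \<open>a\<close> for
  each of the two noise vectors, which flip a coordinate if all \<open>a\<close> coins show heads.\<close>

definition base :: "nat \<Rightarrow> nat \<Rightarrow> nat \<Rightarrow> nat \<Rightarrow> nat" where
  "base n a q i = (q * n + i) * (1 + 2 * a)"

definition point :: "nat \<Rightarrow> nat \<Rightarrow> (nat \<Rightarrow> bool) \<Rightarrow> nat \<Rightarrow> nat \<Rightarrow> int" where
  "point n a \<omega> q = (\<lambda>i\<in>{..<n}. if \<omega> (base n a q i) then 1 else -1)"

text \<open>\<open>s\<close> is the offset inside the coins of a coordinate: \<open>1\<close> for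
  the first noise vector and \<open>1 + a\<close> for the second, offset 0 being the coin of the
  point.\<close>

definition flips :: "nat \<Rightarrow> nat \<Rightarrow> nat \<Rightarrow> (nat \<Rightarrow> bool) \<Rightarrow> nat \<Rightarrow> nat \<Rightarrow> int" where
  "flips n a s \<omega> q = (\<lambda>i\<in>{..<n}. if \<forall>t<a. \<omega> (base n a q i + s + t) then -1 else 1)"

lemma point_cube [simp]: "point n a \<omega> q \<in> cube n"
  by (auto simp: point_def cube_def)

lemma flips_cube [simp]: "flips n a s \<omega> q \<in> cube n"
  by (auto simp: flips_def cube_def)

definition sample :: "nat \<Rightarrow> nat \<Rightarrow> nat \<Rightarrow> (nat \<Rightarrow> bool) \<Rightarrow> (nat \<Rightarrow> int) \<times> (nat \<Rightarrow> int) \<times> (nat \<Rightarrow> int)" where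
  "sample n a q \<omega> = (point n a \<omega> q, flips n a 1 \<omega> q, flips n a (1 + a) \<omega> q)"

definition block :: "nat \<Rightarrow> nat \<Rightarrow> nat \<Rightarrow> nat set" where
  "block n a q = {base n a q 0..<base n a (Suc q) 0}"

lemma finite_block [simp]: "finite (block n a q)"
  by (simp add: block_def)

lemma base_Suc: "base n a q (Suc i) = base n a q i + (1 + 2 * a)"
  by (simp add: base_def)

lemma base_mono: "i \<le> j \<Longrightarrow> base n a q i \<le> base n a q j"
  unfolding base_def by (intro mult_right_mono add_left_mono) auto

lemma base_mono_q: "q \<le> r \<Longrightarrow> base n a q 0 \<le> base n a r 0"
  unfolding base_def by (intro mult_right_mono add_right_mono) auto

lemma base_n: "base n a q n = base n a (Suc q) 0"
  by (simp add: base_def algebra_simps)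

lemma depends_sample: "depends_on (block n a q) (sample n a q)"
proof -
  have "base n a q i + k \<in> block n a q" if "i < n" "k < 1 + 2 * a" for i k
  proof -
    have "base n a q i + k < base n a q (Suc i)" using that base_Suc[of n a q i] by simp
    also have "\<dots> \<le> base n a (Suc q) 0" using base_mono[of "Suc i" n n a q] that base_n[of n a q] by simp
    finally show ?thesis using base_mono[of 0 i n a q] by (simp add: block_def)
  qed
  from this[of _ 0] this[of _ "1 + t" for t] this[of _ "1 + a + t" for t]
  show ?thesis
    unfolding depends_on_def sample_def point_def flips_def
    by (auto simp: fun_eq_iff add.assoc)
qed

lemma disjoint_block: "disjoint_family (block n a)"
proof -
  have "block n a q \<inter> block n a r = {}" if "q < r" for q r
    using base_mono_q[of "Suc q" r n a] that by (auto simp: block_def)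
  then show ?thesis
    unfolding disjoint_family_on_def by (metis inf_commute nat_neq_iff)
qed

lemma prob_sample:
  assumes "z \<in> cube n" "k \<in> cube n" "k' \<in> cube n"
  shows "coin.prob {\<omega>. sample n a q \<omega> = (z, k, k')} =
    (\<Prod>i<n. bias (1/2) (z i)) * (\<Prod>i<n. bias (1 / 2 ^ a) (k i)) * (\<Prod>i<n. bias (1 / 2 ^ a) (k' i))"
proof -
  \<comment> \<open>\<open>r\<close> selects the bit of the point, of the first or of the second
    noise vector at coordinate \<open>i\<close>; \<open>J (i, r)\<close> are the coins deciding it,
    pairwise disjoint, so the probability factors.\<close>
  define E where "E = (\<lambda>(i, r) \<omega>. if r = (0::nat) then \<omega> (base n a q i) = (z i = 1)
     else if r = 1 then (\<forall>t<a. \<omega> (base n a q i + 1 + t)) = (k i = -1)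
     else (\<forall>t<a. \<omega> (base n a q i + (1 + a) + t)) = (k' i = -1))"
  define J where "J = (\<lambda>(i, r). if r = (0::nat) then {base n a q i}
     else if r = 1 then {base n a q i + 1..<base n a q i + 1 + a}
     else {base n a q i + (1 + a)..<base n a q i + (1 + a) + a})"
  have ev: "sample n a q \<omega> = (z, k, k') \<longleftrightarrow> (\<forall>l\<in>{..<n} \<times> {0, 1, 2}. E l \<omega>)" for \<omega>
  proof -
    have "(point n a \<omega> q = z) \<longleftrightarrow> (\<forall>i<n. E (i, 0) \<omega>)"
    proof -
      have each: "(point n a \<omega> q i = z i) = E (i, 0) \<omega>" if "i < n" for i
        using cube_vals[OF assms(1) that] that by (elim disjE) (auto simp: point_def E_def)
      have "(point n a \<omega> q = z) \<longleftrightarrow> (\<forall>i<n. point n a \<omega> q i = z i)"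
        using point_cube[of n a \<omega> q] assms(1) by (auto simp: cube_def intro: PiE_ext)
      also have "(\<forall>i<n. point n a \<omega> q i = z i) \<longleftrightarrow> (\<forall>i<n. E (i, 0) \<omega>)" using each by blast
      finally show ?thesis .
    qed
    moreover have "(flips n a 1 \<omega> q = k) \<longleftrightarrow> (\<forall>i<n. E (i, 1) \<omega>)"
    proof -
      have each: "(flips n a 1 \<omega> q i = k i) = E (i, 1) \<omega>" if "i < n" for i
        using cube_vals[OF assms(2) that] that by (elim disjE) (auto simp: flips_def E_def)
      have "(flips n a 1 \<omega> q = k) \<longleftrightarrow> (\<forall>i<n. flips n a 1 \<omega> q i = k i)"
        using flips_cube[of n a 1 \<omega> q] assms(2) by (auto simp: cube_def intro: PiE_ext)
      also have "(\<forall>i<n. flips n a 1 \<omega> q i = k i) \<longleftrightarrow> (\<forall>i<n. E (i, 1) \<omega>)" using each by blast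
      finally show ?thesis .
    qed
    moreover have "(flips n a (1 + a) \<omega> q = k') \<longleftrightarrow> (\<forall>i<n. E (i, 2) \<omega>)"
    proof -
      have each: "(flips n a (1 + a) \<omega> q i = k' i) = E (i, 2) \<omega>" if "i < n" for i
        using cube_vals[OF assms(3) that] that by (elim disjE) (auto simp: flips_def E_def)
      have "(flips n a (1 + a) \<omega> q = k') \<longleftrightarrow> (\<forall>i<n. flips n a (1 + a) \<omega> q i = k' i)"
        using flips_cube[of n a "1 + a" \<omega> q] assms(3) by (auto simp: cube_def intro: PiE_ext)
      also have "(\<forall>i<n. flips n a (1 + a) \<omega> q i = k' i) \<longleftrightarrow> (\<forall>i<n. E (i, 2) \<omega>)" using each by blast
      finally show ?thesis .
    qed
    ultimately show ?thesis by (auto simp: sample_def)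
  qed
  have sub: "J (i, r) \<subseteq> {base n a q i..<base n a q (Suc i)}" if "r \<in> {0, 1, 2}" for i r
    using that base_Suc[of n a q i] by (auto simp: J_def)
  have dis: "disjoint_family_on J ({..<n} \<times> {0, 1, 2})"
  proof -
    have lt: "J (i, r) \<inter> J (i', r') = {}" if "i < i'" "r \<in> {0, 1, 2}" "r' \<in> {0, 1, 2}" for i i' r r'
      using sub[OF that(2), of i] sub[OF that(3), of i'] base_mono[of "Suc i" i' n a q] that(1)
      by (auto simp: disjoint_iff dest!: subsetD)
    have eq: "J (i, r) \<inter> J (i, r') = {}" if "r \<noteq> r'" "r \<in> {0, 1, 2}" "r' \<in> {0, 1, 2}" for i r r'
      using that by (auto simp: J_def)
    show ?thesis
      unfolding disjoint_family_on_def
    proof (intro ballI impI)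
      fix l l' :: "nat \<times> nat" assume l: "l \<in> {..<n} \<times> {0, 1, 2}" "l' \<in> {..<n} \<times> {0, 1, 2}" "l \<noteq> l'"
      obtain i r i' r' where ir: "l = (i, r)" "l' = (i', r')" by (cases l, cases l')
      have r: "r \<in> {0, 1, 2}" "r' \<in> {0, 1, 2}" using l(1,2) by (simp_all add: ir)
      consider "i < i'" | "i' < i" | "i = i'" "r \<noteq> r'" using l(3) unfolding ir by (metis nat_neq_iff)
      then show "J l \<inter> J l' = {}"
      proof cases
        case 1
        then show ?thesis unfolding ir by (rule lt) (fact r)+
      next
        case 2
        from lt[OF 2 r(2,1)] show ?thesis unfolding ir by (simp only: Int_commute)
      next
        case 3
        then show ?thesis unfolding ir using eq[OF 3(2) r] by simp
      qed
    qed
  qed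
  have "coin.prob {\<omega>. \<forall>l\<in>{..<n} \<times> {0, 1, 2}. E l \<omega>} = (\<Prod>l\<in>{..<n} \<times> {0, 1, 2}. coin.prob {\<omega>. E l \<omega>})"
    by (rule prob_blocks[OF _ dis]) (auto simp: J_def E_def depends_on_def)
  also have "\<dots> = (\<Prod>i<n. \<Prod>r\<in>{0, 1, 2}. coin.prob {\<omega>. E (i, r) \<omega>})"
    by (simp only: prod.cartesian_product case_prod_unfold prod.collapse)
  also have "\<dots> = (\<Prod>i<n. bias (1/2) (z i) * bias (1 / 2 ^ a) (k i) * bias (1 / 2 ^ a) (k' i))"
  proof (rule prod.cong[OF refl])
    fix i
    have all: "coin.prob {\<omega>. (\<forall>t<a. \<omega> (p + t)) = b} = bias (1 / 2 ^ a) (if b then -1 else 1)" for p b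
    proof (cases b)
      case True
      then show ?thesis using prob_coins_all[of a p] by (simp add: bias_def)
    next
      case False
      have "{\<omega>. \<forall>t<a. \<omega> (p + t)} \<in> sets coins"
        by (rule measurable_depends_set[of "{p..<p + a}"]) (auto simp: depends_on_def)
      from coin.prob_compl[OF this] False show ?thesis
        using prob_coins_all[of a p] by (simp add: bias_def Collect_neg_eq[symmetric] Compl_eq_Diff_UNIV[symmetric])
    qed
    have "coin.prob {\<omega>. E (i, 0) \<omega>} = bias (1/2) (z i)"
      using prob_coin[of "base n a q i"] by (simp add: E_def bias_half)
    moreover assume "i \<in> {..<n}"
    then have "coin.prob {\<omega>. E (i, 1) \<omega>} = bias (1 / 2 ^ a) (k i)"
      using all[of "base n a q i + 1" "k i = -1"] cube_vals[OF assms(2), of i] by (auto simp: E_def)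
    moreover have "coin.prob {\<omega>. E (i, 2) \<omega>} = bias (1 / 2 ^ a) (k' i)"
      using all[of "base n a q i + (1 + a)" "k' i = -1"] cube_vals[OF assms(3), of i] \<open>i \<in> _\<close> by (auto simp: E_def)
    ultimately show "(\<Prod>r\<in>{0, 1, 2}. coin.prob {\<omega>. E (i, r) \<omega>})
        = bias (1/2) (z i) * bias (1 / 2 ^ a) (k i) * bias (1 / 2 ^ a) (k' i)"
      by simp
  qed
  finally show ?thesis by (simp add: ev prod.distrib)
qed

lemma expectation_sample:
  "coin.expectation (\<lambda>\<omega>. \<psi> (sample n a q \<omega>)) =
   uavg n (\<lambda>z. wavg n (1 / 2 ^ a) (\<lambda>k. wavg n (1 / 2 ^ a) (\<lambda>k'. \<psi> (z, k, k'))))"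
proof -
  let ?W = "cube n \<times> cube n \<times> cube n"
  have meas: "{\<omega>. sample n a q \<omega> = w} \<in> sets coins" for w
    by (rule measurable_depends_set[of "block n a q"])
       (use depends_sample[of n a q] in \<open>auto simp: depends_on_def block_def\<close>)
  \<comment> \<open>A sample takes finitely many values, which reduces the integral to a finite sum
    over point probabilities.\<close>
  have "\<psi> (sample n a q \<omega>) = (\<Sum>w\<in>?W. indicator {\<omega>. sample n a q \<omega> = w} \<omega> * \<psi> w)" for \<omega>
  proof -
    have "sample n a q \<omega> \<in> ?W" by (simp add: sample_def)
    then show ?thesis
      by (subst sum.remove[of _ "sample n a q \<omega>"]) (auto simp: indicator_def intro!: sum.neutral)
  qed
  then have "coin.expectation (\<lambda>\<omega>. \<psi> (sample n a q \<omega>))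
      = coin.expectation (\<lambda>\<omega>. \<Sum>w\<in>?W. indicator {\<omega>. sample n a q \<omega> = w} \<omega> * \<psi> w)"
    by (rule Bochner_Integration.integral_cong[OF refl])
  also have "\<dots> = (\<Sum>w\<in>?W. coin.expectation (\<lambda>\<omega>. indicator {\<omega>. sample n a q \<omega> = w} \<omega> * \<psi> w))"
  proof (rule Bochner_Integration.integral_sum)
    fix w
    have "integrable coins (indicator {\<omega>. sample n a q \<omega> = w} :: _ \<Rightarrow> real)"
      using meas[of w] by (simp add: coin.emeasure_eq_measure)
    then show "integrable coins (\<lambda>\<omega>. indicator {\<omega>. sample n a q \<omega> = w} \<omega> * \<psi> w)"
      by (rule integrable_mult_left)
  qed
  also have "\<dots> = (\<Sum>w\<in>?W. coin.prob {\<omega>. sample n a q \<omega> = w} * \<psi> w)"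
    using meas by simp
  also have "\<dots> = uavg n (\<lambda>z. wavg n (1 / 2 ^ a) (\<lambda>k. wavg n (1 / 2 ^ a) (\<lambda>k'. \<psi> (z, k, k'))))"
    unfolding wavg_def sum_distrib_left sum.cartesian_product
    by (intro sum.cong) (auto simp: prob_sample mult_ac)
  finally show ?thesis .
qed

text \<open>Hoeffding for \<open>m\<close> independent terms in an interval of length 2: the
  exponent \<open>2 * (m * \<eta>)^2 / (4 * m)\<close> is \<open>m * \<eta>^2 / 2\<close>.\<close>

lemma sample_concentration:
  assumes "m > 0" "\<eta> \<ge> 0"
    and "\<And>z k k'. z \<in> cube n \<Longrightarrow> k \<in> cube n \<Longrightarrow> k' \<in> cube n \<Longrightarrow> \<bar>\<psi> (z, k, k')\<bar> \<le> 1"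
  shows "coin.prob {\<omega>. \<bar>(\<Sum>k<m. \<psi> (sample n a (q + k) \<omega>)) -
      m * uavg n (\<lambda>z. wavg n (1 / 2 ^ a) (\<lambda>k. wavg n (1 / 2 ^ a) (\<lambda>k'. \<psi> (z, k, k'))))\<bar> \<ge> m * \<eta>}
    \<le> 2 * exp (- (m * \<eta>\<^sup>2 / 2))"
proof -
  let ?X = "\<lambda>k \<omega>. \<psi> (sample n a (q + k) \<omega>)"
  interpret Hoeffding_ineq coins "{..<m}" ?X "\<lambda>_. -1" "\<lambda>_. 1" "\<Sum>k<m. coin.expectation (?X k)"
  proof unfold_locales
    have "depends_on (block n a (q + k)) (?X k)" for k
      using depends_sample[of n a "q + k"] unfolding depends_on_def by metis
    then show "coin.indep_vars (\<lambda>_. borel) ?X {..<m}"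
      using disjoint_block[of n a]
      by (intro indep_blocks[of "\<lambda>k. block n a (q + k)"] finite_block)
         (auto simp: disjoint_family_on_def)
    show "AE \<omega> in coins. ?X k \<omega> \<in> {-1..1}" for k
      using assms(3) by (auto simp: sample_def abs_le_iff minus_le_iff)
  qed auto
  have eq: "-2 * (m * \<eta>)\<^sup>2 / (\<Sum>k<m. (1 - (-1))\<^sup>2) = - (m * \<eta>\<^sup>2 / 2)"
    using assms(1) by (simp add: power2_eq_square)
  have "coin.prob {\<omega> \<in> space coins. m * \<eta> \<le> \<bar>(\<Sum>k<m. ?X k \<omega>) - (\<Sum>k<m. coin.expectation (?X k))\<bar>}
      \<le> 2 * exp (- (m * \<eta>\<^sup>2 / 2))"
    unfolding eq[symmetric] by (rule Hoeffding_ineq_abs_ge) (use assms in auto)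
  then show ?thesis by (simp add: expectation_sample)
qed

section \<open>The reconstructed tree\<close>

text \<open>Ranges over \<open>0\<close>, ..., \<open>k\<close> inclusive and gives ties to the
  smaller index, like the strict comparison in \<open>max_loop\<close>.\<close>

primrec argmax :: "(nat \<Rightarrow> nat) \<Rightarrow> nat \<Rightarrow> nat" where
  "argmax c 0 = 0"
| "argmax c (Suc k) = (if c (argmax c k) < c (Suc k) then Suc k else argmax c k)"

lemma argmax_le: "argmax c k \<le> k"
  by (induction k) auto

lemma argmax_ge: "i \<le> k \<Longrightarrow> c i \<le> c (argmax c k)"
proof (induction k)
  case (Suc k)
  then show ?case by (cases "i = Suc k") auto
qed simp

text \<open>\<open>y\<close> carries the answers received on \<open>S\<close>, standing in for the
  point that is not yet known; \<open>tree_eval_grow\<close> replaces it by \<open>x\<close> through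
  locality.\<close>

primrec grow :: "(nat \<Rightarrow> nat set \<Rightarrow> (nat \<Rightarrow> int) \<Rightarrow> nat) \<Rightarrow> (nat set \<Rightarrow> (nat \<Rightarrow> int) \<Rightarrow> int) \<Rightarrow>
    nat \<Rightarrow> nat \<Rightarrow> nat set \<Rightarrow> (nat \<Rightarrow> int) \<Rightarrow> dtree" where
  "grow sel lab 0 j S y = Leaf (lab S y)"
| "grow sel lab (Suc k) j S y = (let i = sel j S y in
     Node i (grow sel lab k (Suc j) (insert i S) (y(i := -1))) (grow sel lab k (Suc j) (insert i S) (y(i := 1))))"

lemma depth_grow: "depth (grow sel lab k j S y) = k"
  by (induction k arbitrary: j S y) (simp_all add: Let_def)

lemma dtree_on_grow:
  assumes "\<And>j S y. sel j S y < n" "\<And>S y. lab S y = -1 \<or> lab S y = (1::int)"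
  shows "dtree_on n (grow sel lab k j S y)"
  using assms by (induction k arbitrary: j S y) (auto simp: Let_def)

lemma tree_eval_grow:
  assumes sel: "\<And>j S x y. (\<And>i. i \<in> S \<Longrightarrow> x i = y i) \<Longrightarrow> sel j S x = sel j S y"
    and lab: "\<And>S x y. (\<And>i. i \<in> S \<Longrightarrow> x i = y i) \<Longrightarrow> lab S x = lab S y"
    and sel_less: "\<And>j S y. sel j S y < n" and x: "x \<in> cube n"
    and y: "\<And>i. i \<in> vars sel j x \<Longrightarrow> y i = x i"
  shows "tree_eval (grow sel lab k j (vars sel j x) y) x = lab (vars sel (j + k) x) x"
  using y
proof (induction k arbitrary: j y)
  case 0
  then show ?case using lab[of "vars sel j x" y x] by simp
next
  case (Suc k)
  have i: "sel j (vars sel j x) y = sel j (vars sel j x) x" (is "_ = ?i")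
    by (rule sel) (use Suc.prems in auto)
  have "tree_eval (grow sel lab (Suc k) j (vars sel j x) y) x =
      tree_eval (grow sel lab k (Suc j) (vars sel (Suc j) x) (y(?i := x ?i))) x"
    using cube_vals[OF x sel_less[of j "vars sel j x" x]] by (auto simp: Let_def i)
  also have "\<dots> = lab (vars sel (Suc j + k) x) x"
    by (rule Suc.IH) (use Suc.prems in auto)
  finally show ?case by simp
qed

locale sampling =
  fixes n a m :: nat and f :: "(nat \<Rightarrow> int) \<Rightarrow> int"
  assumes n: "1 \<le> n" and f: "f \<in> cube n \<rightarrow> {-1, 1}"
begin

definition query1 :: "(nat \<Rightarrow> bool) \<Rightarrow> nat \<Rightarrow> nat set \<Rightarrow> (nat \<Rightarrow> int) \<Rightarrow> nat \<Rightarrow> int" where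
  "query1 \<omega> q S x = mix S x (twist n (point n a \<omega> q) (flips n a 1 \<omega> q))"

definition query2 :: "(nat \<Rightarrow> bool) \<Rightarrow> nat \<Rightarrow> nat set \<Rightarrow> (nat \<Rightarrow> int) \<Rightarrow> nat \<Rightarrow> int" where
  "query2 \<omega> q S x = mix S x (twist n (point n a \<omega> q) (flips n a (1 + a) \<omega> q))"

text \<open>One plus the sampled product, or one plus 0 if the noise flips \<open>i\<close>: the
  shift keeps votes nonnegative on a machine without signed numbers and is common to all
  variables.\<close>

definition vote :: "(nat \<Rightarrow> bool) \<Rightarrow> nat \<Rightarrow> nat set \<Rightarrow> (nat \<Rightarrow> int) \<Rightarrow> nat \<Rightarrow> nat" where
  "vote \<omega> q S x i = (if flips n a 1 \<omega> q i = 1 \<and> flips n a (1 + a) \<omega> q i = 1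
     then (if bit_of (f (query1 \<omega> q S x)) = bit_of (f (query2 \<omega> q S x)) then 2 else 0) else 1)"

text \<open>The index \<open>j * m + k\<close> reserves a separate range of samples for each level,
  common to all nodes of that level.\<close>

definition count :: "(nat \<Rightarrow> bool) \<Rightarrow> nat \<Rightarrow> nat set \<Rightarrow> (nat \<Rightarrow> int) \<Rightarrow> nat \<Rightarrow> nat" where
  "count \<omega> j S x i = (\<Sum>k<m. vote \<omega> (j * m + k) S x i)"

text \<open>The first noisy copy is itself a uniform point, so its answers also estimate the mean of
  the restriction.\<close>

definition ones :: "(nat \<Rightarrow> bool) \<Rightarrow> nat \<Rightarrow> nat set \<Rightarrow> (nat \<Rightarrow> int) \<Rightarrow> nat" where
  "ones \<omega> j S x = (\<Sum>k<m. bit_of (f (query1 \<omega> (j * m + k) S x)))"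

definition pick :: "(nat \<Rightarrow> bool) \<Rightarrow> nat \<Rightarrow> nat set \<Rightarrow> (nat \<Rightarrow> int) \<Rightarrow> nat" where
  "pick \<omega> j S x = argmax (count \<omega> j S x) (n - 1)"

text \<open>Majority with ties to 1; the condition means \<open>m \<le> 2 * ones\<close>, phrased
  with the strict comparison of the machine.\<close>

definition label :: "(nat \<Rightarrow> bool) \<Rightarrow> nat \<Rightarrow> nat set \<Rightarrow> (nat \<Rightarrow> int) \<Rightarrow> int" where
  "label \<omega> j S x = (if m < 2 * ones \<omega> j S x + 1 then 1 else -1)"

definition rtree :: "nat \<Rightarrow> (nat \<Rightarrow> bool) \<Rightarrow> dtree" where
  "rtree D \<omega> = grow (pick \<omega>) (label \<omega> D) D 0 {} (\<lambda>_. 1)"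

lemma mix_local: "(\<And>i. i \<in> S \<Longrightarrow> x i = y i) \<Longrightarrow> mix S x = mix S y"
  by (auto simp: mix_def fun_eq_iff)

lemma pick_local:
  assumes "\<And>i. i \<in> S \<Longrightarrow> x i = y i"
  shows "pick \<omega> j S x = pick \<omega> j S y"
proof -
  have eq: "mix S x = mix S y" by (rule mix_local) (rule assms)
  show ?thesis unfolding pick_def count_def[abs_def] vote_def query1_def query2_def eq ..
qed

lemma label_local:
  assumes "\<And>i. i \<in> S \<Longrightarrow> x i = y i"
  shows "label \<omega> j S x = label \<omega> j S y"
proof -
  have eq: "mix S x = mix S y" by (rule mix_local) (rule assms)
  show ?thesis unfolding label_def ones_def query1_def eq ..
qed

lemma pick_less: "pick \<omega> j S x < n"
  using argmax_le[of "count \<omega> j S x" "n - 1"] n by (simp add: pick_def)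

lemma label_vals: "label \<omega> j S x = -1 \<or> label \<omega> j S x = 1"
  by (simp add: label_def)

lemma rtree_on: "dtree_on n (rtree D \<omega>)"
  unfolding rtree_def by (rule dtree_on_grow) (simp_all add: pick_less label_def)

lemma depth_rtree: "depth (rtree D \<omega>) = D"
  by (simp add: rtree_def depth_grow)

lemma eval_rtree:
  assumes "x \<in> cube n"
  shows "tree_eval (rtree D \<omega>) x = label \<omega> D (vars (pick \<omega>) D x) x"
  using tree_eval_grow[where j = 0 and k = D and n = n and y = "\<lambda>_. 1", OF pick_local label_local pick_less assms]
  by (simp add: rtree_def)

lemma growth: "growth n f (pick \<omega>)"
  by (intro growth.intro f pick_less pick_local)

text \<open>Needed for measurability of the success event. The \<open>D + 1\<close> counts the leaf
  level, whose samples decide the labels.\<close>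

lemma rtree_depends: "depends_on (\<Union>q<(D + 1) * m. block n a q) (rtree D)"
  unfolding depends_on_def
proof (intro allI impI)
  fix \<omega> \<omega>' :: "nat \<Rightarrow> bool" assume eq: "\<forall>p\<in>\<Union>q<(D + 1) * m. block n a q. \<omega> p = \<omega>' p"
  have "sample n a q \<omega> = sample n a q \<omega>'" if "q < (D + 1) * m" for q
    using depends_sample[of n a q] eq that unfolding depends_on_def by blast
  then have c: "point n a \<omega> q = point n a \<omega>' q" "flips n a 1 \<omega> q = flips n a 1 \<omega>' q"
    "flips n a (1 + a) \<omega> q = flips n a (1 + a) \<omega>' q" if "q < (D + 1) * m" for q
    using that by (simp_all add: sample_def)
  have q: "query1 \<omega> q = query1 \<omega>' q" "query2 \<omega> q = query2 \<omega>' q" if "q < (D + 1) * m" for q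
    by (intro ext; unfold query1_def query2_def c[OF that]; rule refl)+
  have v: "vote \<omega> q = vote \<omega>' q" if "q < (D + 1) * m" for q
    by (intro ext, unfold vote_def c[OF that] q[OF that], rule refl)
  have lt: "j * m + k < (D + 1) * m" if "j \<le> D" "k < m" for j k
  proof -
    have "j * m + k < (j + 1) * m" using that by simp
    also have "\<dots> \<le> (D + 1) * m" using that by (intro mult_right_mono) auto
    finally show ?thesis .
  qed
  have pick: "pick \<omega> j = pick \<omega>' j" and label: "label \<omega> j = label \<omega>' j" if "j \<le> D" for j
  proof -
    have "count \<omega> j = count \<omega>' j"
      unfolding count_def[abs_def] using v[OF lt[OF that]] by (intro ext sum.cong) auto
    then show "pick \<omega> j = pick \<omega>' j" by (simp add: pick_def[abs_def])
    have "ones \<omega> j = ones \<omega>' j"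
      unfolding ones_def[abs_def] using q[OF lt[OF that]] by (intro ext sum.cong) auto
    then show "label \<omega> j = label \<omega>' j" by (simp add: label_def[abs_def])
  qed
  have "grow (pick \<omega>) lab k j S y = grow (pick \<omega>') lab k j S y" if "j + k \<le> D" for lab k j S y
    using that by (induction k arbitrary: j S y) (simp_all add: pick Let_def)
  then show "rtree D \<omega> = rtree D \<omega>'" by (simp add: rtree_def label)
qed

section \<open>Accuracy of the estimates\<close>

abbreviation \<delta> :: real where "\<delta> \<equiv> 1 / 2 ^ a"

text \<open>The value \<open>i = n\<close> stands for the mean of \<open>h\<close>, so that one
  union bound over \<open>i \<le> n\<close> covers the choices of variables and the labels.\<close>

definition stat :: "((nat \<Rightarrow> int) \<Rightarrow> real) \<Rightarrow> nat \<Rightarrow> (nat \<Rightarrow> int) \<times> (nat \<Rightarrow> int) \<times> (nat \<Rightarrow> int) \<Rightarrow> real" where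
  "stat h i = (\<lambda>(z, K, K'). if i < n then h (twist n z K) * h (twist n z K') * of_bool (K i = 1 \<and> K' i = 1)
     else h (twist n z K))"

definition mean :: "((nat \<Rightarrow> int) \<Rightarrow> real) \<Rightarrow> nat \<Rightarrow> real" where
  "mean h i = (if i < n then score n \<delta> h i else uavg n h)"

lemma mean_stat: "uavg n (\<lambda>z. wavg n \<delta> (\<lambda>k. wavg n \<delta> (\<lambda>k'. stat h i (z, k, k')))) = mean h i"
  using uavg_noise[of n \<delta> h] by (simp add: stat_def mean_def score_def noise_def[abs_def])

definition off :: "(nat \<Rightarrow> bool) \<Rightarrow> real \<Rightarrow> nat \<Rightarrow> ((nat \<Rightarrow> int) \<Rightarrow> real) \<Rightarrow> nat \<Rightarrow> bool" where
  "off \<omega> \<eta> j h i \<longleftrightarrow> \<bar>(\<Sum>k<m. stat h i (sample n a (j * m + k) \<omega>)) - real m * mean h i\<bar> \<ge> real m * \<eta>"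

lemma restr_vals:
  assumes "\<And>i. i \<in> S \<Longrightarrow> i < n \<and> (y i = -1 \<or> y i = 1)" "z \<in> cube n"
  shows "restr f S y z = -1 \<or> restr f S y z = 1"
proof -
  have "mix S y z \<in> cube n" using assms by (auto simp: mix_def cube_def PiE_def Pi_def extensional_def)
  then have "f (mix S y z) \<in> {-1, 1}" using f by (rule funcset_mem[rotated])
  then show ?thesis by (auto simp: restr_def)
qed

lemma prob_off:
  fixes \<eta> :: real
  assumes "m > 0" "\<eta> \<ge> 0" and h: "\<And>z. z \<in> cube n \<Longrightarrow> h z = -1 \<or> h z = 1"
  shows "coin.prob {\<omega>. off \<omega> \<eta> j h i} \<le> 2 * exp (- (m * \<eta>\<^sup>2 / 2))"
  unfolding off_def mean_stat[symmetric]
proof (rule sample_concentration[OF assms(1,2)])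
  fix z k k' assume "z \<in> cube n" "k \<in> cube n" "k' \<in> cube n"
  then have "h (twist n z k) = -1 \<or> h (twist n z k) = 1" "h (twist n z k') = -1 \<or> h (twist n z k') = 1"
    by (auto intro!: h)
  then show "\<bar>stat h i (z, k, k')\<bar> \<le> 1" by (elim disjE) (auto simp: stat_def)
qed

lemma off_depends: "depends_on (\<Union>k<m. block n a (j * m + k)) (\<lambda>\<omega>. off \<omega> \<eta> j h i)"
  unfolding depends_on_def
proof (intro allI impI)
  fix \<omega> \<omega>' :: "nat \<Rightarrow> bool" assume eq: "\<forall>p\<in>\<Union>k<m. block n a (j * m + k). \<omega> p = \<omega>' p"
  have "sample n a (j * m + k) \<omega> = sample n a (j * m + k) \<omega>'" if "k < m" for k
    using depends_sample[of n a "j * m + k"] eq that unfolding depends_on_def by blast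
  then show "off \<omega> \<eta> j h i = off \<omega>' \<eta> j h i" by (simp add: off_def)
qed

lemma off_sets: "{\<omega>. off \<omega> \<eta> j h i} \<in> sets coins"
  by (rule measurable_depends_set[OF off_depends]) simp

text \<open>The restriction at a node of level \<open>j\<close> is given by a list of \<open>j\<close> pairs (variable, value); the
  union bound ranges over all such lists, reached or not.\<close>

definition paths :: "nat \<Rightarrow> (nat \<times> int) list set" where
  "paths j = {l. set l \<subseteq> {..<n} \<times> {-1, 1} \<and> length l = j}"

text \<open>A list may name a variable with both values; then 1 wins. The result is still a
  restriction of \<open>f\<close>, so the concentration bound applies to every list.\<close>

definition lrestr :: "(nat \<times> int) list \<Rightarrow> (nat \<Rightarrow> int) \<Rightarrow> real" where
  "lrestr l = restr f (fst ` set l) (\<lambda>i. if (i, 1) \<in> set l then 1 else -1)"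

definition good :: "real \<Rightarrow> nat \<Rightarrow> (nat \<Rightarrow> bool) set" where
  "good \<eta> D = {\<omega>. \<forall>j\<le>D. \<forall>l\<in>paths j. \<forall>i\<le>n. \<not> off \<omega> \<eta> j (lrestr l) i}"

lemma finite_paths: "finite (paths j)"
  unfolding paths_def by (rule finite_lists_length_eq) simp

lemma card_paths: "card (paths j) = (2 * n) ^ j"
proof -
  have "card ({..<n} \<times> {-1, 1::int}) = 2 * n" by (simp add: card_cartesian_product)
  then show ?thesis unfolding paths_def by (subst card_lists_length_eq) (simp, simp only:)
qed

lemma lrestr_vals: "l \<in> paths j \<Longrightarrow> z \<in> cube n \<Longrightarrow> lrestr l z = -1 \<or> lrestr l z = 1"
  unfolding lrestr_def by (rule restr_vals) (auto simp: paths_def)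

lemma good_compl: "- good \<eta> D = (\<Union>(j, l, i)\<in>(SIGMA j:{..D}. paths j \<times> {..n}). {\<omega>. off \<omega> \<eta> j (lrestr l) i})"
  by (simp add: good_def set_eq_iff) blast

text \<open>Each \<open>lrestr l\<close> is fixed independently of the tape, as concentration
  requires, whereas the node reached is random. The price is the number of triples of level, list
  and index.\<close>

lemma prob_good:
  fixes \<eta> :: real
  assumes "m > 0" "\<eta> \<ge> 0"
  shows "good \<eta> D \<in> sets coins"
    and "coin.prob (good \<eta> D) \<ge> 1 - (D + 1) * (2 * n) ^ D * (n + 1) * (2 * exp (- (m * \<eta>\<^sup>2 / 2)))"
proof -
  let ?I = "SIGMA j:{..D}. paths j \<times> {..n}"
  let ?B = "\<lambda>(j, l, i). {\<omega>. off \<omega> \<eta> j (lrestr l) i}"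
  have fin: "finite ?I" by (simp add: finite_paths)
  have sets: "- good \<eta> D \<in> sets coins"
    unfolding good_compl using off_sets by (intro sets.finite_UN fin) auto
  then show good: "good \<eta> D \<in> sets coins"
    using sets.compl_sets[OF sets] by (simp add: Compl_eq_Diff_UNIV[symmetric])
  have "coin.prob (- good \<eta> D) \<le> (\<Sum>w\<in>?I. coin.prob (?B w))"
    unfolding good_compl
    by (rule coin.finite_measure_subadditive_finite[OF fin]) (use off_sets in auto)
  also have "\<dots> \<le> (\<Sum>w\<in>?I. 2 * exp (- (m * \<eta>\<^sup>2 / 2)))"
    using prob_off[OF assms lrestr_vals] by (intro sum_mono) auto
  also have "\<dots> = real (card ?I) * (2 * exp (- (m * \<eta>\<^sup>2 / 2)))" by simp
  also have "card ?I = (\<Sum>j\<le>D. (2 * n) ^ j * (n + 1))"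
    by (simp add: card_SigmaI finite_paths card_cartesian_product card_paths)
  also have "\<dots> \<le> (\<Sum>j\<le>D. (2 * n) ^ D * (n + 1))"
    using n by (intro sum_mono mult_right_mono power_increasing) auto
  also have "\<dots> = (D + 1) * (2 * n) ^ D * (n + 1)"
    by (simp only: sum_constant card_atMost of_nat_id Suc_eq_plus1 mult.assoc)
  finally have "coin.prob (- good \<eta> D) \<le> real ((D + 1) * (2 * n) ^ D * (n + 1)) * (2 * exp (- (m * \<eta>\<^sup>2 / 2)))"
    by (simp add: mult_right_mono)
  moreover have "coin.prob (- good \<eta> D) = 1 - coin.prob (good \<eta> D)"
    using coin.prob_compl[OF good] by (simp add: Compl_eq_Diff_UNIV[symmetric])
  ultimately show "coin.prob (good \<eta> D) \<ge> 1 - (D + 1) * (2 * n) ^ D * (n + 1) * (2 * exp (- (m * \<eta>\<^sup>2 / 2)))"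
    by simp
qed

text \<open>Whatever the tape, the node reached is one of the restrictions in the union bound: list
  the variables on the path with the values of \<open>x\<close>, which are consistent even when a
  variable repeats.\<close>

lemma node_path:
  assumes x: "x \<in> cube n"
  shows "\<exists>l\<in>paths j. growth.node f (pick \<omega>) j x = lrestr l"
proof -
  interpret growth n f "pick \<omega>" by (rule growth)
  let ?p = "\<lambda>i. pick \<omega> i (vars (pick \<omega>) i x) x"
  let ?l = "map (\<lambda>i. (?p i, x (?p i))) [0..<j]"
  have v: "vars (pick \<omega>) j x = ?p ` {..<j}" for j
  proof (induction j)
    case (Suc j)
    show ?case unfolding lessThan_Suc image_insert Suc.IH[symmetric] by simp
  qed simp
  have fs: "fst ` set ?l = vars (pick \<omega>) j x"
    unfolding v[of j] by (simp add: image_image atLeast0LessThan)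
  have "x i = (if (i, 1) \<in> set ?l then 1 else -1)" if i: "i \<in> vars (pick \<omega>) j x" for i
  proof -
    obtain k where "k \<in> {..<j}" "i = ?p k" using i unfolding v[of j] by (rule imageE)
    then have mem: "(i, x i) \<in> set ?l" by auto
    have pm: "x i = -1 \<or> x i = 1" using cube_vals[OF x, of i] vars_subset[of j x] i by blast
    show ?thesis
    proof (cases "(i, 1) \<in> set ?l")
      case True
      then have "x i = 1" by auto
      with True show ?thesis by (simp only: if_True)
    next
      case False
      with mem have "x i \<noteq> 1" by (intro notI) (simp only:)
      with pm False show ?thesis by (simp only: if_False simp_thms)
    qed
  qed
  then have "mix (vars (pick \<omega>) j x) x = mix (fst ` set ?l) (\<lambda>i. if (i, 1) \<in> set ?l then 1 else -1)"
    unfolding fs by (intro mix_local)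
  then have eq: "mix (vars (pick \<omega>) j x) x z = mix (fst ` set ?l) (\<lambda>i. if (i, 1) \<in> set ?l then 1 else -1) z"
    for z by (rule fun_cong)
  have "node j x = lrestr ?l"
    by (rule ext) (unfold node_def lrestr_def restr_def eq, rule refl)
  moreover have "(?p i, x (?p i)) \<in> {..<n} \<times> {-1, 1}" for i
    using cube_vals[OF x pick_less[of \<omega> i "vars (pick \<omega>) i x" x]] by (simp add: pick_less)
  then have "?l \<in> paths j" by (auto simp only: paths_def set_map length_map length_upt mem_Collect_eq diff_zero)
  ultimately show ?thesis by (intro bexI[of _ ?l])
qed

lemma vote_stat:
  assumes "\<And>z. z \<in> cube n \<Longrightarrow> restr f S x z = -1 \<or> restr f S x z = 1" "i < n"
  shows "real (vote \<omega> q S x i) = 1 + stat (restr f S x) i (sample n a q \<omega>)"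
proof -
  let ?h = "restr f S x"
  let ?u = "twist n (point n a \<omega> q) (flips n a 1 \<omega> q)" and ?v = "twist n (point n a \<omega> q) (flips n a (1 + a) \<omega> q)"
  have "?h ?u = -1 \<or> ?h ?u = 1" "?h ?v = -1 \<or> ?h ?v = 1" by (auto intro!: assms(1))
  moreover have "f (query1 \<omega> q S x) = ?h ?u" "f (query2 \<omega> q S x) = ?h ?v"
    by (simp_all add: query1_def query2_def restr_def)
  ultimately have "(f (query1 \<omega> q S x) = -1 \<and> ?h ?u = -1) \<or> (f (query1 \<omega> q S x) = 1 \<and> ?h ?u = 1)"
    "(f (query2 \<omega> q S x) = -1 \<and> ?h ?v = -1) \<or> (f (query2 \<omega> q S x) = 1 \<and> ?h ?v = 1)" by auto
  then show ?thesis
    using assms(2) by (elim disjE conjE) (auto simp: vote_def stat_def sample_def bit_of_def)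
qed

lemma ones_stat:
  assumes "\<And>z. z \<in> cube n \<Longrightarrow> restr f S x z = -1 \<or> restr f S x z = 1"
  shows "2 * real (bit_of (f (query1 \<omega> q S x))) = 1 + stat (restr f S x) n (sample n a q \<omega>)"
proof -
  let ?h = "restr f S x"
  let ?u = "twist n (point n a \<omega> q) (flips n a 1 \<omega> q)"
  have "?h ?u = -1 \<or> ?h ?u = 1" by (auto intro!: assms(1))
  moreover have "f (query1 \<omega> q S x) = ?h ?u"
    by (simp add: query1_def restr_def)
  ultimately have "(f (query1 \<omega> q S x) = -1 \<and> ?h ?u = -1) \<or> (f (query1 \<omega> q S x) = 1 \<and> ?h ?u = 1)" by auto
  then show ?thesis by (elim disjE conjE) (auto simp: stat_def sample_def bit_of_def)
qed

text \<open>An empirical maximiser loses at most the errors of the two estimates compared. A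
  majority with the wrong sign forces the mean to lie within \<open>\<eta>\<close> of 0.\<close>

lemma good_estimates:
  fixes \<eta> :: real
  assumes g: "\<omega> \<in> good \<eta> D" and x: "x \<in> cube n" and j: "j \<le> D" and m: "m > 0"
  defines "h \<equiv> growth.node f (pick \<omega>) j x" and "S \<equiv> vars (pick \<omega>) j x"
  shows "i < n \<Longrightarrow> score n \<delta> h i \<le> score n \<delta> h (pick \<omega> j S x) + 2 * \<eta>"
    and "\<bar>uavg n h\<bar> \<le> label \<omega> j S x * uavg n h + 2 * \<eta>"
proof -
  interpret growth n f "pick \<omega>" by (rule growth)
  have hS: "h = restr f S x" by (simp add: h_def S_def node_def)
  have hv: "restr f S x z = -1 \<or> restr f S x z = 1" if "z \<in> cube n" for z
    using node_vals[OF x that, of j] by (simp add: hS[symmetric] h_def)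
  obtain l where "l \<in> paths j" "h = lrestr l" using node_path[OF x] unfolding h_def by blast
  then have no: "\<not> off \<omega> \<eta> j h i" if "i \<le> n" for i
    using g j that by (auto simp: good_def)
  have est: "\<bar>(\<Sum>k<m. stat h i (sample n a (j * m + k) \<omega>)) - m * mean h i\<bar> \<le> m * \<eta>" if "i \<le> n" for i
    using no[OF that] by (simp add: off_def)
  have cnt: "real (count \<omega> j S x i) = m + (\<Sum>k<m. stat h i (sample n a (j * m + k) \<omega>))" if "i < n" for i
    by (simp add: count_def vote_stat[OF hv that] hS sum.distrib)
  show "score n \<delta> h i \<le> score n \<delta> h (pick \<omega> j S x) + 2 * \<eta>" if i: "i < n"
  proof -
    have "count \<omega> j S x i \<le> count \<omega> j S x (pick \<omega> j S x)"
      unfolding pick_def by (rule argmax_ge) (use i in auto)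
    then have "real (count \<omega> j S x i) \<le> real (count \<omega> j S x (pick \<omega> j S x))" by (rule of_nat_mono)
    then have "m * score n \<delta> h i - m * \<eta> \<le> m * score n \<delta> h (pick \<omega> j S x) + m * \<eta>"
    proof -
      have "mean h i = score n \<delta> h i" "mean h (pick \<omega> j S x) = score n \<delta> h (pick \<omega> j S x)"
        using i pick_less[of \<omega> j S x] by (simp_all add: mean_def)
      with est[of i] est[of "pick \<omega> j S x"] i pick_less[of \<omega> j S x]
      have "m * score n \<delta> h i - m * \<eta> \<le> (\<Sum>k<m. stat h i (sample n a (j * m + k) \<omega>))"
        "(\<Sum>k<m. stat h (pick \<omega> j S x) (sample n a (j * m + k) \<omega>)) \<le> m * score n \<delta> h (pick \<omega> j S x) + m * \<eta>"
        by (auto simp: abs_le_iff)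
      with \<open>real _ \<le> real _\<close> show ?thesis unfolding cnt[OF i] cnt[OF pick_less] by linarith
    qed
    then have "m * score n \<delta> h i \<le> m * (score n \<delta> h (pick \<omega> j S x) + 2 * \<eta>)" by (simp add: algebra_simps)
    then show ?thesis using m by (subst (asm) mult_le_cancel_left_pos) auto
  qed
  have on: "2 * real (ones \<omega> j S x) - m = (\<Sum>k<m. stat h n (sample n a (j * m + k) \<omega>))"
    by (simp add: ones_def sum_distrib_left ones_stat[OF hv] hS sum.distrib)
  have e: "\<bar>2 * real (ones \<omega> j S x) - m - m * uavg n h\<bar> \<le> m * \<eta>"
    using est[of n] by (simp add: on mean_def)
  let ?s = "2 * real (ones \<omega> j S x) - m" and ?\<mu> = "m * uavg n h"
  have "m * \<bar>uavg n h\<bar> \<le> label \<omega> j S x * (m * uavg n h) + 2 * (m * \<eta>)"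
  proof (cases "m < 2 * ones \<omega> j S x + 1")
    case True
    then have "m \<le> 2 * ones \<omega> j S x" by simp
    then have "0 \<le> ?s" by linarith
    then have "\<bar>?\<mu>\<bar> \<le> ?\<mu> + 2 * (m * \<eta>)" using e unfolding abs_le_iff by linarith
    then show ?thesis using True by (simp add: label_def abs_mult)
  next
    case False
    then have "2 * ones \<omega> j S x \<le> m" by simp
    then have "?s \<le> 0" by linarith
    then have "\<bar>?\<mu>\<bar> \<le> - ?\<mu> + 2 * (m * \<eta>)" using e unfolding abs_le_iff by linarith
    then show ?thesis using False by (simp add: label_def abs_mult)
  qed
  then have "m * \<bar>uavg n h\<bar> \<le> m * (label \<omega> j S x * uavg n h + 2 * \<eta>)" by (simp add: algebra_simps)
  then show "\<bar>uavg n h\<bar> \<le> label \<omega> j S x * uavg n h + 2 * \<eta>"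
    using m by (subst (asm) mult_le_cancel_left_pos) auto
qed

text \<open>Here \<open>e = 1 / E\<close>, and with \<open>R = (d + 1) * E\<close> the noise rate
  lies between \<open>1 / (2 * R)\<close> and \<open>1 / R\<close>, so that
  \<open>d * \<delta> \<le> 1 / E\<close>. The constant 4 is half of the \<open>8 * p\<close> in the
  variance bound.\<close>

lemma good_error:
  fixes \<eta> :: real
  assumes g: "\<omega> \<in> good \<eta> D" and m: "m > 0" and T: "dtree_on n T" "depth T \<le> d"
    and E: "E \<ge> (1::nat)" and R: "(d + 1) * E \<le> 2 ^ a" "2 ^ a \<le> 2 * ((d + 1) * E)" and a: "a \<ge> 1"
    and D: "D = 2 * d ^ 3 * E\<^sup>2" and \<eta>: "\<eta> = 1 / (16 * real ((d + 1) * E) ^ 3)"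
  shows "fdist n (tree_eval (rtree D \<omega>)) f \<le> 4 * fdist n f (tree_eval T) + 4 / E"
proof -
  interpret growth n f "pick \<omega>" by (rule growth)
  define p where "p = fdist n f (tree_eval T)"
  define RR where "RR = real ((d + 1) * E)"
  have p0: "p \<ge> 0" by (simp add: p_def fdist_def)
  have RE: "RR = (real d + 1) * real E" by (simp add: RR_def algebra_simps)
  have "1 \<le> (d + 1) * E" using E by simp
  then have R1: "RR \<ge> 1" unfolding RR_def by linarith
  have d1: "\<delta> \<le> 1 / RR" "1 / \<delta> \<le> 2 * RR"
  proof -
    have "RR \<le> 2 ^ a" using R(1) unfolding RR_def by (metis of_nat_le_iff of_nat_numeral of_nat_power)
    then show "\<delta> \<le> 1 / RR" using R1 by (simp add: frac_le)
    have "real (2 ^ a) \<le> real (2 * ((d + 1) * E))" using R(2) by (rule of_nat_mono)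
    then show "1 / \<delta> \<le> 2 * RR" by (simp add: RR_def)
  qed
  have dhalf: "\<delta> \<le> 1 / 2" using a self_le_power[of "2::real" a] by (simp add: field_simps)
  have \<eta>0: "0 \<le> \<eta>" by (simp add: \<eta>)
  have \<eta>E: "\<eta> \<le> 1 / (16 * real E)"
  proof -
    have "real E \<le> RR" using E by (simp add: RE algebra_simps)
    also have "RR \<le> RR ^ 3" using R1 by (rule self_le_power) simp
    finally have "16 * real E \<le> 16 * RR ^ 3" by simp
    then show ?thesis unfolding \<eta> RR_def[symmetric] using E R1 by (intro divide_left_mono) auto
  qed
  have dd: "real d * \<delta> \<le> 1 / E"
  proof -
    have "real d * \<delta> \<le> real d * (1 / RR)" using d1(1) by (intro mult_left_mono) auto
    also have "\<dots> = (real d / (real d + 1)) * (1 / E)" by (simp add: RE)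
    also have "\<dots> \<le> 1 * (1 / E)" by (intro mult_right_mono) auto
    finally show ?thesis by simp
  qed
  \<comment> \<open>In units of \<open>1 / E\<close>: 2 from the noise on the tree, 1/4 from
    \<open>e / 4\<close>, and 4 + 1 from the starting potential and the estimation errors. Half of
    29/4 plus 1/16 for the label stays below 4.\<close>
  have var: "var D \<le> 8 * p + 29 / 4 / E"
  proof (cases "d = 0")
    \<comment> \<open>There are no levels to average over, but the coefficient \<open>d^2\<close> of
      the influence vanishes.\<close>
    case True
    then have "D = 0" by (simp add: D)
    have "var 0 \<le> 4 * p + 2 * real d * \<delta> + (1 / E) / 4 + (real d)\<^sup>2 / (1 / E) * uavg n (infl \<delta> 0)"
      unfolding p_def by (rule var_le[OF T]) (use E dhalf in auto)
    also have "\<dots> = 4 * p + 1 / 4 / E" using True by simp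
    also have "\<dots> \<le> 8 * p + 29 / 4 / E" using p0 by (intro add_mono divide_right_mono) auto
    finally show ?thesis by (simp add: \<open>D = 0\<close>)
  next
    case False
    then have dpos: "real d \<ge> 1" by simp
    have Dr: "real D = 2 * real d ^ 3 * (real E)\<^sup>2" by (simp add: D)
    have Dpos: "D > 0" using False E by (simp add: D)
    have v1: "var D \<le> 4 * p + 2 * real d * \<delta> + (1 / E) / 4
      + (real d)\<^sup>2 / (1 / E * 2 * \<delta> * real D) * (4 * p + 4 * real d * \<delta> + 8 * real D * \<eta>)"
      unfolding p_def
      by (rule var_final[OF T]) (use E dhalf \<eta>0 Dpos good_estimates(1)[OF g _ _ m] in auto)
    \<comment> \<open>The depth is chosen for this factor:
      \<open>1 / \<delta> \<le> 2 * R \<le> 4 * d * E\<close>, and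
      \<open>d^2 * E * (4 * d * E) = 2 * D\<close>.\<close>
    have v2: "(real d)\<^sup>2 / (1 / E * 2 * \<delta> * real D) * (4 * p + 4 * real d * \<delta> + 8 * real D * \<eta>)
        \<le> 1 * (4 * p + 4 / E + 1 / E)"
    proof (rule mult_mono)
      have "(real d)\<^sup>2 / (1 / E * 2 * \<delta> * real D) = (real d)\<^sup>2 * E * (1 / \<delta>) / (2 * real D)"
        by (simp add: field_simps)
      also have "\<dots> \<le> (real d)\<^sup>2 * E * (4 * real d * E) / (2 * real D)"
      proof (intro divide_right_mono mult_left_mono)
        have "2 * RR \<le> 4 * real d * E" unfolding RE using dpos E mult_right_mono[OF dpos, of "real E"]
          by (simp add: algebra_simps)
        then show "1 / \<delta> \<le> 4 * real d * E" using d1(2) by linarith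
      qed auto
      also have "(real d)\<^sup>2 * E * (4 * real d * E) = 2 * real D"
        unfolding Dr by (simp add: power2_eq_square power3_eq_cube)
      also have "2 * real D / (2 * real D) = 1" using Dpos by simp
      finally show "(real d)\<^sup>2 / (1 / E * 2 * \<delta> * real D) \<le> 1" .
      \<comment> \<open>\<open>\<eta>\<close> is chosen so that the estimation errors of all
        \<open>D\<close> levels together are at most \<open>1 / E\<close>.\<close>
      have "8 * real D * \<eta> = real d ^ 3 * (real E)\<^sup>2 / RR ^ 3" by (simp add: Dr \<eta> RR_def)
      also have "\<dots> = (real d / (real d + 1)) ^ 3 * (1 / E)"
        using E by (simp add: RE power_mult_distrib power_divide power2_eq_square power3_eq_cube mult.assoc)
      also have "\<dots> \<le> 1 ^ 3 * (1 / E)" by (intro mult_right_mono power_mono) auto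
      finally have "8 * real D * \<eta> \<le> 1 / E" by simp
      then show "4 * p + 4 * real d * \<delta> + 8 * real D * \<eta> \<le> 4 * p + 4 / E + 1 / E" using dd by linarith
    qed (use p0 \<eta>0 in auto)
    have "var D \<le> 4 * p + 2 * real d * \<delta> + (1 / E) / 4 + 1 * (4 * p + 4 / E + 1 / E)"
      by (rule order_trans[OF v1 add_left_mono[OF v2]])
    also have "\<dots> \<le> 4 * p + 2 * (1 / E) + (1 / E) / 4 + 1 * (4 * p + 4 / E + 1 / E)"
      using dd by (intro add_mono order_refl) (simp add: mult.assoc)
    also have "\<dots> = 8 * p + 29 / 4 / E" by simp
    finally show ?thesis .
  qed
  have "fdist n (tree_eval (rtree D \<omega>)) f = fdist n (\<lambda>x. label \<omega> D (vars (pick \<omega>) D x) x) f"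
    unfolding fdist_uavg by (rule wavg_cong) (simp add: eval_rtree)
  also have "\<dots> \<le> var D / 2 + \<eta>"
  proof (rule label_error)
    show "label \<omega> D (vars (pick \<omega>) D (mix (vars (pick \<omega>) D x) x z)) (mix (vars (pick \<omega>) D x) x z)
        = label \<omega> D (vars (pick \<omega>) D x) x" for x z
      unfolding vars_mix by (rule label_local) (simp add: mix_def)
  qed (use label_vals good_estimates(2)[OF g _ _ m] in auto)
  also have "\<dots> \<le> 4 * p + 4 / E"
  proof -
    have "29 / 4 / real E = 29 / 4 * (1 / real E)" "1 / (16 * real E) = (1 / real E) / 16"
      "4 / real E = 4 * (1 / real E)" "0 \<le> 1 / real E" by simp_all
    with var \<eta>E show ?thesis by linarith
  qed
  finally show ?thesis unfolding p_def .
qed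

end

section \<open>Weakest preconditions\<close>

text \<open>Time and queries are arguments of the postcondition, so cost and correctness are proved
  in one pass. Determinism of \<open>exec\<close> turns the rules below into equivalences usable by
  the simplifier.\<close>

definition wp :: "nat \<Rightarrow> nat \<Rightarrow> ((nat \<Rightarrow> int) \<Rightarrow> int) \<Rightarrow> (nat \<Rightarrow> bool) \<Rightarrow> com \<Rightarrow> state \<Rightarrow>
    (nat \<Rightarrow> nat \<Rightarrow> state \<Rightarrow> bool) \<Rightarrow> bool" where
  "wp w n f \<omega> c s Q \<longleftrightarrow> (\<exists>t q s'. exec w n f \<omega> c s t q s' \<and> Q t q s')"

lemma wp_eq: "exec w n f \<omega> c s t q s' \<Longrightarrow> wp w n f \<omega> c s Q \<longleftrightarrow> Q t q s'"
  unfolding wp_def using exec_deterministic by blast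

lemma wp_Skip [simp]: "wp w n f \<omega> Skip s Q \<longleftrightarrow> Q 1 0 s"
  by (rule wp_eq[OF exec.Skip])

lemma wp_Assign [simp]:
  "wp w n f \<omega> (Assign v e) s Q \<longleftrightarrow> Q (expr_cost e + 1) 0 (s\<lparr>regs := (regs s)(v := eval_expr w s e)\<rparr>)"
  by (rule wp_eq[OF exec.Assign])

lemma wp_Store [simp]:
  "wp w n f \<omega> (Store b e e') s Q \<longleftrightarrow> Q (expr_cost e + expr_cost e' + 1) 0
    (s\<lparr>arrs := (arrs s)(b := (arrs s b)(eval_expr w s e := eval_expr w s e'))\<rparr>)"
  by (rule wp_eq[OF exec.Store])

lemma wp_Flip [simp]:
  "wp w n f \<omega> (Flip v) s Q \<longleftrightarrow> Q 1 0
    (s\<lparr>regs := (regs s)(v := of_bool (\<omega> (tape_pos s))), tape_pos := Suc (tape_pos s)\<rparr>)"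
  by (rule wp_eq[OF exec.Flip])

lemma wp_Query [simp]:
  "wp w n f \<omega> (Query v b) s Q \<longleftrightarrow> Q 1 1
    (s\<lparr>regs := (regs s)(v := bit_of (f (\<lambda>i\<in>{..<n}. sign_of (arrs s b i))))\<rparr>)"
  by (rule wp_eq[OF exec.Query])

lemma wp_Seq [simp]:
  "wp w n f \<omega> (Seq c1 c2) s Q \<longleftrightarrow>
   wp w n f \<omega> c1 s (\<lambda>t q s'. wp w n f \<omega> c2 s' (\<lambda>t' q' s''. Q (t + t') (q + q') s''))"
proof
  assume "wp w n f \<omega> (Seq c1 c2) s Q"
  then show "wp w n f \<omega> c1 s (\<lambda>t q s'. wp w n f \<omega> c2 s' (\<lambda>t' q' s''. Q (t + t') (q + q') s''))"
    unfolding wp_def by (elim exE conjE SeqE) blast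
qed (unfold wp_def, blast intro: exec.Seq)

lemma wp_Cond [simp]:
  "wp w n f \<omega> (Cond e c1 c2) s Q \<longleftrightarrow>
   (if eval_expr w s e \<noteq> 0 then wp w n f \<omega> c1 s (\<lambda>t. Q (expr_cost e + 1 + t))
    else wp w n f \<omega> c2 s (\<lambda>t. Q (expr_cost e + 1 + t)))"
proof (cases "eval_expr w s e = 0")
  case True
  show ?thesis
  proof
    assume "wp w n f \<omega> (Cond e c1 c2) s Q"
    then show "if eval_expr w s e \<noteq> 0 then wp w n f \<omega> c1 s (\<lambda>t. Q (expr_cost e + 1 + t))
        else wp w n f \<omega> c2 s (\<lambda>t. Q (expr_cost e + 1 + t))"
      using True unfolding wp_def by (auto elim!: CondE)
  qed (use True in \<open>unfold wp_def, auto intro: exec.CondFalse[simplified]\<close>)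
next
  case False
  show ?thesis
  proof
    assume "wp w n f \<omega> (Cond e c1 c2) s Q"
    then show "if eval_expr w s e \<noteq> 0 then wp w n f \<omega> c1 s (\<lambda>t. Q (expr_cost e + 1 + t))
        else wp w n f \<omega> c2 s (\<lambda>t. Q (expr_cost e + 1 + t))"
      using False unfolding wp_def by (auto elim!: CondE)
  qed (use False in \<open>unfold wp_def, auto intro: exec.CondTrue[simplified]\<close>)
qed

lemma wp_mono:
  "wp w n f \<omega> c s Q \<Longrightarrow> (\<And>t q s'. Q t q s' \<Longrightarrow> Q' t q s') \<Longrightarrow> wp w n f \<omega> c s Q'"
  unfolding wp_def by blast

text \<open>Every loop of the program has a number of rounds fixed in advance, so an invariant
  indexed by the round replaces a termination measure. The last summand of the time pays for the
  failing test.\<close>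

lemma wp_for:
  assumes "I 0 s"
    and step: "\<And>k s. k < N \<Longrightarrow> I k s \<Longrightarrow> eval_expr w s e \<noteq> 0 \<and>
      wp w n f \<omega> c s (\<lambda>t q s'. t \<le> T \<and> q \<le> U \<and> I (Suc k) s')"
    and stop: "\<And>s. I N s \<Longrightarrow> eval_expr w s e = 0"
    and post: "\<And>t q s'. t \<le> N * (T + expr_cost e + 1) + expr_cost e + 1 \<Longrightarrow> q \<le> N * U \<Longrightarrow> I N s' \<Longrightarrow> Q t q s'"
  shows "wp w n f \<omega> (While e c) s Q"
proof -
  \<comment> \<open>Induction on the number of rounds still to come.\<close>
  have "wp w n f \<omega> (While e c) s (\<lambda>t q s'. t \<le> k * (T + expr_cost e + 1) + expr_cost e + 1 \<and> q \<le> k * U \<and> I N s')"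
    if "k \<le> N" "I (N - k) s" for k s
    using that
  proof (induction k arbitrary: s)
    case 0
    then have "I N s" by simp
    from exec.WhileFalse[OF stop[OF this], of n f \<omega> c] this show ?case
      unfolding wp_def by fastforce
  next
    case (Suc k)
    then have "N - Suc k < N" "Suc (N - Suc k) = N - k" by auto
    with step[OF _ Suc.prems(2)] obtain t q s' where
      ne: "eval_expr w s e \<noteq> 0" and 1: "exec w n f \<omega> c s t q s'" "t \<le> T" "q \<le> U" "I (N - k) s'"
      unfolding wp_def by auto
    with Suc obtain t' q' s'' where
      2: "exec w n f \<omega> (While e c) s' t' q' s''" "t' \<le> k * (T + expr_cost e + 1) + expr_cost e + 1"
        "q' \<le> k * U" "I N s''"
      unfolding wp_def by (metis Suc_leD)
    from exec.WhileTrue[OF ne 1(1) 2(1)] 1 2 show ?case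
      unfolding wp_def by (intro exI conjI) (assumption, auto)
  qed
  from this[of N s] assms(1) post show ?thesis by (auto elim: wp_mono)
qed

section \<open>The program\<close>

text \<open>
  Registers: 2 the scale \<open>E\<close>, 4 the product \<open>R = (d + 1) * E\<close>, 5 the number \<open>a\<close> of coins per noise
  bit, 7 the logarithm of \<open>n + 1\<close>, 8 the depth, 9 the number of samples per level, 10 the level,
  11 the variable, 12 the number of positive answers, 13 the sample, 19 the best variable; the others
  are temporary. Arrays: 2 the votes, 3 and 4 the two queried points, 5 the number of noise vectors
  that flip a variable, 6 the indicator of the variables queried so far.
\<close>

definition flip_loop :: "nat \<Rightarrow> com" where
  "flip_loop v = Seq (Assign v (Const 1)) (Seq (Assign 16 (Const 0))
     (While (Bin Less (Reg 16) (Reg 5))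
       (Seq (Flip 17) (Seq (Assign v (Bin Mul (Reg v) (Reg 17))) (Assign 16 (Bin Add (Reg 16) (Const 1)))))))"

text \<open>Coins are flipped also for variables already fixed, so that the tape advances equally on
  every path.\<close>

definition point_loop :: com where
  "point_loop = While (Bin Less (Reg 11) (Reg 0))
     (Seq (Flip 14) (Seq (flip_loop 15) (Seq (flip_loop 18)
       (Seq (Cond (Arr 6 (Reg 11))
          (Seq (Store 3 (Reg 11) (Arr 0 (Reg 11))) (Store 4 (Reg 11) (Arr 0 (Reg 11))))
          (Seq (Store 3 (Reg 11) (Bin Mod (Bin Add (Reg 14) (Reg 15)) (Const 2)))
               (Store 4 (Reg 11) (Bin Mod (Bin Add (Reg 14) (Reg 18)) (Const 2)))))
       (Seq (Store 5 (Reg 11) (Bin Add (Reg 15) (Reg 18)))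
       (Assign 11 (Bin Add (Reg 11) (Const 1))))))))"

text \<open>No query occurs here: the two answers in registers 14 and 15 serve all variables, which
  keeps the number of queries free of a factor \<open>n\<close>.\<close>

definition vote_loop :: com where
  "vote_loop = While (Bin Less (Reg 11) (Reg 0))
     (Seq (Cond (Arr 5 (Reg 11)) (Store 2 (Reg 11) (Bin Add (Arr 2 (Reg 11)) (Const 1)))
        (Cond (Bin Equal (Reg 14) (Reg 15)) (Store 2 (Reg 11) (Bin Add (Arr 2 (Reg 11)) (Const 2))) Skip))
      (Assign 11 (Bin Add (Reg 11) (Const 1))))"

definition sample_loop :: com where
  "sample_loop = While (Bin Less (Reg 13) (Reg 9))
     (Seq (Assign 11 (Const 0)) (Seq point_loop
     (Seq (Query 14 3) (Seq (Query 15 4) (Seq (Assign 12 (Bin Add (Reg 12) (Reg 14)))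
     (Seq (Assign 11 (Const 0)) (Seq vote_loop (Assign 13 (Bin Add (Reg 13) (Const 1))))))))))"

definition clear_loop :: com where
  "clear_loop = While (Bin Less (Reg 11) (Reg 0))
     (Seq (Store 2 (Reg 11) (Const 0)) (Assign 11 (Bin Add (Reg 11) (Const 1))))"

definition max_loop :: com where
  "max_loop = While (Bin Less (Reg 11) (Reg 0))
     (Seq (Cond (Bin Less (Arr 2 (Reg 19)) (Arr 2 (Reg 11))) (Assign 19 (Reg 11)) Skip)
      (Assign 11 (Bin Add (Reg 11) (Const 1))))"

text \<open>The \<open>+ 1\<close> in the guard adds level \<open>D\<close>, whose positive answers
  in register 12 decide the label of the leaf.\<close>

definition level_loop :: com where
  "level_loop = While (Bin Less (Reg 10) (Bin Add (Reg 8) (Const 1)))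
     (Seq (Assign 11 (Const 0)) (Seq clear_loop (Seq (Assign 12 (Const 0)) (Seq (Assign 13 (Const 0))
     (Seq sample_loop (Seq (Assign 19 (Const 0)) (Seq (Assign 11 (Const 1)) (Seq max_loop
     (Seq (Store 6 (Reg 19) (Const 1)) (Assign 10 (Bin Add (Reg 10) (Const 1))))))))))))"

definition keep :: "nat set \<Rightarrow> nat set \<Rightarrow> state \<Rightarrow> state \<Rightarrow> bool" where
  "keep X Y s s' \<longleftrightarrow> (\<forall>v. v \<notin> X \<longrightarrow> regs s' v = regs s v) \<and> (\<forall>b. b \<notin> Y \<longrightarrow> arrs s' b = arrs s b)"

section \<open>Correctness and cost of the loops that follow a path\<close>

locale machine = sampling +
  fixes w W D :: nat and \<omega> :: "nat \<Rightarrow> bool" and x :: "nat \<Rightarrow> int"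
  assumes W: "2 ^ w = W" and x: "x \<in> cube n"
    \<comment> \<open>These rule out overflow: loop counters reach \<open>n\<close>,
      \<open>a\<close>, \<open>m\<close> and \<open>D + 1\<close>, votes reach \<open>2 * m\<close>,
      and the final comparison reaches \<open>2 * m + 1\<close>.\<close>
    and bounds: "4 < W" "n + 1 < W" "a + 1 < W" "2 * m + 2 < W" "D + 2 < W"
begin

abbreviation wpx :: "com \<Rightarrow> state \<Rightarrow> (nat \<Rightarrow> nat \<Rightarrow> state \<Rightarrow> bool) \<Rightarrow> bool" where
  "wpx \<equiv> wp w n f \<omega>"

lemma word_consts [simp]: "0 < W" "Suc 0 < W" "1 < W" "2 < W" "W \<noteq> Suc 0" "0 < w"
  using bounds W by (auto intro: gr0I)

text \<open>The running product of the bits stays 1 exactly while all coins are heads, so the result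
  1 stands for a flip.\<close>

lemma flip_loop:
  assumes s: "regs s 5 = a" and v: "v = 15 \<or> v = 18"
  shows "wpx (flip_loop v) s (\<lambda>t q s'. t \<le> 8 + 13 * a \<and> q = 0 \<and> keep {v, 16, 17} {} s s' \<and>
    regs s' v = of_bool (\<forall>t<a. \<omega> (tape_pos s + t)) \<and> tape_pos s' = tape_pos s + a)"
  unfolding flip_loop_def
  apply (simp only: wp_Seq wp_Assign)
  apply (rule wp_for[where N = a and T = 9 and U = 0 and
      I = "\<lambda>k s'. keep {v, 16, 17} {} s s' \<and> regs s' v = of_bool (\<forall>t<k. \<omega> (tape_pos s + t)) \<and>
        regs s' 16 = k \<and> tape_pos s' = tape_pos s + k"])
  subgoal using v by (auto simp: keep_def)
  subgoal for k s' using v bounds s by (auto simp: keep_def W less_Suc_eq)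
  subgoal for s' using v bounds s by (auto simp: keep_def W)
  subgoal using v by (auto simp: keep_def)
  done

definition input :: "state \<Rightarrow> bool" where
  "input s \<longleftrightarrow> regs s 0 = n \<and> regs s 5 = a \<and> regs s 8 = D \<and> regs s 9 = m \<and> (\<forall>i<n. arrs s 0 i = bit_of (x i))"

lemma input_keep: "input s \<Longrightarrow> keep X Y s s' \<Longrightarrow> {0, 5, 8, 9} \<inter> X = {} \<Longrightarrow> 0 \<notin> Y \<Longrightarrow> input s'"
  by (auto simp: input_def keep_def)

definition fixed :: "nat set \<Rightarrow> state \<Rightarrow> bool" where
  "fixed S s \<longleftrightarrow> S \<subseteq> {..<n} \<and> (\<forall>i<n. arrs s 6 i = of_bool (i \<in> S))"

lemma fixed_keep: "fixed S s \<Longrightarrow> keep X Y s s' \<Longrightarrow> 6 \<notin> Y \<Longrightarrow> fixed S s'"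
  by (auto simp: fixed_def keep_def)

lemma keep_trans: "keep X Y s s' \<Longrightarrow> keep X' Y' s' s'' \<Longrightarrow> keep (X \<union> X') (Y \<union> Y') s s''"
  by (auto simp: keep_def)

lemma keep_weaken: "keep X Y s s' \<Longrightarrow> X \<subseteq> X' \<Longrightarrow> Y \<subseteq> Y' \<Longrightarrow> keep X' Y' s s'"
  by (auto simp: keep_def)

definition masked :: "nat \<Rightarrow> nat \<Rightarrow> nat" where
  "masked q i = of_bool (flips n a 1 \<omega> q i = -1) + of_bool (flips n a (1 + a) \<omega> q i = -1)"

definition written :: "nat \<Rightarrow> nat set \<Rightarrow> nat \<Rightarrow> state \<Rightarrow> bool" where
  "written q S k s \<longleftrightarrow> (\<forall>i<k. arrs s 3 i = bit_of (query1 \<omega> q S x i) \<and>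
     arrs s 4 i = bit_of (query2 \<omega> q S x i) \<and> arrs s 5 i = masked q i)"

lemma bit_of_less: "bit_of y < 2"
  by (simp add: bit_of_def)

lemma bit_of_mod [simp]: "bit_of y mod W = bit_of y"
  using bit_of_less[of y] word_consts(4) by (intro mod_less) linarith

text \<open>A flip bit 1 stands for the sign -1, so multiplying signs means adding bits modulo 2.
  The offsets \<open>Suc p\<close> and \<open>Suc p + a\<close> are those of the two noise vectors
  in \<open>sample\<close>.\<close>

lemma query_bits:
  assumes "i < n" "p = base n a q i"
  shows "bit_of (query1 \<omega> q S x i) = (if i \<in> S then bit_of (x i)
      else (of_bool (\<omega> p) + of_bool (\<forall>t<a. \<omega> (Suc p + t))) mod 2)"
    and "bit_of (query2 \<omega> q S x i) = (if i \<in> S then bit_of (x i)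
      else (of_bool (\<omega> p) + of_bool (\<forall>t<a. \<omega> (Suc p + a + t))) mod 2)"
    and "masked q i = of_bool (\<forall>t<a. \<omega> (Suc p + t)) + of_bool (\<forall>t<a. \<omega> (Suc p + a + t))"
  using assms by (auto simp: query1_def query2_def mix_def twist_def point_def flips_def masked_def bit_of_def)

lemma point_loop:
  assumes s: "input s" "fixed S s" "regs s 11 = 0" "tape_pos s = base n a q 0"
  shows "wpx point_loop s (\<lambda>t r s'. t \<le> n * (50 + 26 * a) + 4 \<and> r = 0 \<and>
    keep {11, 14, 15, 16, 17, 18} {3, 4, 5} s s' \<and> tape_pos s' = base n a (Suc q) 0 \<and> written q S n s')"
  unfolding point_loop_def
proof (rule wp_for[where N = n and T = "46 + 26 * a" and U = 0 and
      I = "\<lambda>k s'. keep {11, 14, 15, 16, 17, 18} {3, 4, 5} s s' \<and> regs s' 11 = k \<and>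
        tape_pos s' = base n a q k \<and> written q S k s'"], goal_cases)
  case 1
  then show ?case using s by (auto simp: keep_def written_def)
next
  case (2 k s1)
  then have K: "keep {11, 14, 15, 16, 17, 18} {3, 4, 5} s s1" and k: "regs s1 11 = k" "k < n"
    and tp: "tape_pos s1 = base n a q k" and wr: "written q S k s1" by auto
  have in1: "input s1" by (rule input_keep[OF s(1) K]) auto
  have fx1: "fixed S s1" by (rule fixed_keep[OF s(2) K]) auto
  let ?p = "base n a q k"
  have guard: "eval_expr w s1 (Bin Less (Reg 11) (Reg 0)) \<noteq> 0"
    using k in1 bounds by (simp add: W input_def)
  show ?case
    apply (rule conjI[OF guard])
    apply (simp only: wp_Seq wp_Flip)
    apply (rule wp_mono[OF flip_loop])
    subgoal using in1 by (simp add: input_def)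
    subgoal by simp
    subgoal for t2 q2 s2
      apply (rule wp_mono[OF flip_loop])
      subgoal using in1 by (auto simp: input_def keep_def)
      subgoal by simp
      subgoal premises prems for t3 q3 s3
      proof -
        have K3: "keep {14, 15, 16, 17, 18} {} s1 s3" using prems by (auto simp: keep_def)
        have r14: "regs s3 14 = of_bool (\<omega> ?p)" using prems tp by (auto simp: keep_def)
        have r15: "regs s3 15 = of_bool (\<forall>t<a. \<omega> (Suc ?p + t))" using prems tp by (auto simp: keep_def)
        have r18: "regs s3 18 = of_bool (\<forall>t<a. \<omega> (Suc ?p + a + t))" using prems tp by (auto simp: keep_def)
        have tp3: "tape_pos s3 = base n a q (Suc k)" using prems tp by (simp add: base_Suc)
        have r11: "regs s3 11 = k" using K3 k by (auto simp: keep_def)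
        have a6: "arrs s3 6 k = of_bool (k \<in> S)" using K3 fx1 k by (auto simp: keep_def fixed_def)
        have a0: "arrs s3 0 k = bit_of (x k)" using K3 in1 k by (auto simp: keep_def input_def)
        have wr3: "written q S k s3" using K3 wr by (auto simp: keep_def written_def)
        have Kt: "keep {11, 14, 15, 16, 17, 18} {3, 4, 5} s s3"
          by (rule keep_weaken[OF keep_trans[OF K K3]]) auto
        have kW: "k < W" "k + 1 < W" using k bounds by auto
        have mods: "(of_bool b + of_bool c) mod W = (of_bool b + of_bool c :: nat)"
          "((of_bool b + of_bool c) mod 2) mod W = (of_bool b + of_bool c :: nat) mod 2" for b c
          using bounds by (cases b; cases c; simp)+
        define z where "z = \<omega> ?p"
        define c where "c \<longleftrightarrow> (\<forall>t<a. \<omega> (Suc ?p + t))"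
        define c' where "c' \<longleftrightarrow> (\<forall>t<a. \<omega> (Suc ?p + a + t))"
        note qb = query_bits[where q = q, OF k(2) refl, folded z_def c_def c'_def]
        note rr = r14[folded z_def] r15[folded c_def] r18[folded c'_def]
        have tq: "t2 \<le> 8 + 13 * a" "t3 \<le> 8 + 13 * a" "q2 = 0" "q3 = 0" using prems by auto
        let ?s4 = "\<lambda>u v c. s3\<lparr>arrs := (arrs s3)(3 := (arrs s3 3)(k := u), 4 := (arrs s3 4)(k := v),
          5 := (arrs s3 5)(k := c)), regs := (regs s3)(11 := Suc k)\<rparr>"
        have K4: "keep {11, 14, 15, 16, 17, 18} {3, 4, 5} s (?s4 u v c)" for u v c
          using Kt by (auto simp: keep_def)
        have wr4: "written q S (Suc k) (?s4 u v c)"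
          if "u = bit_of (query1 \<omega> q S x k)" "v = bit_of (query2 \<omega> q S x k)" "c = masked q k" for u v c
          using wr3 that by (auto simp: written_def less_Suc_eq)
        show ?thesis
          using tq kW
          by (simp add: W r11 a6 a0 rr mods) (auto intro!: K4 wr4 simp: qb tp3)
      qed
      done
    done
next
  case (3 s1)
  then have "input s1" using input_keep[OF s(1), of _ _ s1] by auto
  with 3 show ?case using bounds by (simp add: W input_def)
next
  case (4 t r s1)
  then show ?case by (auto simp: base_n algebra_simps)
qed

lemma vote_masked:
  "i < n \<Longrightarrow> vote \<omega> q S x i = (if masked q i = 0
     then (if bit_of (f (query1 \<omega> q S x)) = bit_of (f (query2 \<omega> q S x)) then 2 else 0) else 1)"
  using cube_vals[OF flips_cube, of i n a 1 \<omega> q] cube_vals[OF flips_cube, of i n a "1 + a" \<omega> q]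
  by (auto simp: vote_def masked_def)

lemma masked_mod [simp]: "masked q i mod W = masked q i"
  using bounds by (simp add: masked_def of_bool_def)

lemma vote_le: "vote \<omega> q S x i \<le> 2"
  by (simp add: vote_def)

lemma vote_loop:
  assumes s: "input s" "regs s 11 = 0" "regs s 14 = bit_of (f (query1 \<omega> q S x))"
      "regs s 15 = bit_of (f (query2 \<omega> q S x))" "\<And>i. i < n \<Longrightarrow> arrs s 5 i = masked q i"
    and c: "\<And>i. i < n \<Longrightarrow> arrs s 2 i + 2 < W"
  shows "wpx vote_loop s (\<lambda>t r s'. t \<le> n * 25 + 4 \<and> r = 0 \<and> keep {11} {2} s s' \<and>
    tape_pos s' = tape_pos s \<and>
    (\<forall>i<n. arrs s' 2 i = arrs s 2 i + vote \<omega> q S x i))"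
  unfolding vote_loop_def
proof (rule wp_for[where N = n and T = 21 and U = 0 and
      I = "\<lambda>k s'. keep {11} {2} s s' \<and> regs s' 11 = k \<and> tape_pos s' = tape_pos s \<and>
        (\<forall>i<n. arrs s' 2 i = arrs s 2 i + (if i < k then vote \<omega> q S x i else 0))"], goal_cases)
  case 1
  then show ?case using s by (auto simp: keep_def)
next
  case (2 k s1)
  then have K: "keep {11} {2} s s1" and k: "regs s1 11 = k" "k < n"
    and tp: "tape_pos s1 = tape_pos s"
    and a2: "\<And>i. i < n \<Longrightarrow> arrs s1 2 i = arrs s 2 i + (if i < k then vote \<omega> q S x i else 0)" by auto
  have in1: "input s1" by (rule input_keep[OF s(1) K]) auto
  have r: "regs s1 14 = bit_of (f (query1 \<omega> q S x))" "regs s1 15 = bit_of (f (query2 \<omega> q S x))"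
    "arrs s1 5 k = masked q k" "regs s1 0 = n" "arrs s1 2 k = arrs s 2 k"
    using K s k in1 a2[OF k(2)] by (auto simp: keep_def input_def)
  have ck: "arrs s 2 k + 2 < W" by (rule c[OF k(2)])
  have kW: "k + 1 < W" using k bounds by auto
  let ?s2 = "\<lambda>u. s1\<lparr>arrs := (arrs s1)(2 := (arrs s1 2)(k := u)), regs := (regs s1)(11 := Suc k)\<rparr>"
  have K2: "keep {11} {2} s (?s2 u)" "keep {11} {2} s (s1\<lparr>regs := (regs s1)(11 := Suc k)\<rparr>)" for u
    using K by (auto simp: keep_def)
  show ?case
    using ck kW bounds k vote_masked[OF k(2), of q S] K2
    by (auto simp: W r k(1) a2 tp less_Suc_eq)
next
  case (3 s1)
  then have "input s1" using input_keep[OF s(1), of _ _ s1] by auto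
  with 3 show ?case using bounds by (simp add: W input_def)
next
  case (4 t r s1)
  then show ?case by (auto simp: algebra_simps)
qed

text \<open>Points of the cube are extensional, so the restricted array equals the intended point as
  a function and \<open>f\<close> gives the same value.\<close>

lemma queried:
  assumes "written q S n s" "S \<subseteq> {..<n}"
  shows "(\<lambda>i\<in>{..<n}. sign_of (arrs s 3 i)) = query1 \<omega> q S x"
    and "(\<lambda>i\<in>{..<n}. sign_of (arrs s 4 i)) = query2 \<omega> q S x"
proof -
  have c: "query1 \<omega> q S x \<in> cube n" "query2 \<omega> q S x \<in> cube n"
    using x by (auto simp: query1_def query2_def intro!: mix_cube)
  have sb: "sign_of (bit_of v) = v" if "v = -1 \<or> v = 1" for v
    using that by (auto simp: sign_of_def bit_of_def)
  have "query1 \<omega> q S x i = undefined" "query2 \<omega> q S x i = undefined" if "\<not> i < n" for i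
    using that c by (auto simp: cube_def PiE_def extensional_def)
  then show "(\<lambda>i\<in>{..<n}. sign_of (arrs s 3 i)) = query1 \<omega> q S x"
    "(\<lambda>i\<in>{..<n}. sign_of (arrs s 4 i)) = query2 \<omega> q S x"
    using assms(1) c sb[OF cube_vals] by (auto simp: written_def fun_eq_iff)
qed

text \<open>The invariant fixes the tape position to the start of sample \<open>j * m + k\<close>,
  whatever \<open>x\<close> is; this ties the run to the samples of the analysis.\<close>

lemma sample_loop:
  assumes s: "input s" "fixed S s" "regs s 12 = 0" "regs s 13 = 0" "tape_pos s = base n a (j * m) 0"
    "\<And>i. i < n \<Longrightarrow> arrs s 2 i = 0"
  shows "wpx sample_loop s (\<lambda>t r s'. t \<le> m * (n * (75 + 26 * a) + 30) + 4 \<and> r \<le> m * 2 \<and>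
    keep {11, 12, 13, 14, 15, 16, 17, 18} {2, 3, 4, 5} s s' \<and> regs s' 12 = ones \<omega> j S x \<and>
    tape_pos s' = base n a (j * m + m) 0 \<and> (\<forall>i<n. arrs s' 2 i = count \<omega> j S x i))"
  unfolding sample_loop_def
proof (rule wp_for[where N = m and T = "n * (75 + 26 * a) + 26" and U = 2 and
      I = "\<lambda>k s'. keep {11, 12, 13, 14, 15, 16, 17, 18} {2, 3, 4, 5} s s' \<and> regs s' 13 = k \<and>
        regs s' 12 = (\<Sum>l<k. bit_of (f (query1 \<omega> (j * m + l) S x))) \<and>
        tape_pos s' = base n a (j * m + k) 0 \<and>
        (\<forall>i<n. arrs s' 2 i = (\<Sum>l<k. vote \<omega> (j * m + l) S x i))"], goal_cases)
  case 1
  then show ?case using s by (auto simp: keep_def)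
next
  case (2 k s1)
  let ?q = "j * m + k" and ?X = "{11, 12, 13, 14, 15, 16, 17, 18} :: nat set" and ?Y = "{2, 3, 4, 5} :: nat set"
  from 2 have K: "keep ?X ?Y s s1" and k: "regs s1 13 = k" "k < m"
    and r12: "regs s1 12 = (\<Sum>l<k. bit_of (f (query1 \<omega> (j * m + l) S x)))"
    and tp: "tape_pos s1 = base n a ?q 0"
    and a2: "\<And>i. i < n \<Longrightarrow> arrs s1 2 i = (\<Sum>l<k. vote \<omega> (j * m + l) S x i)" by auto
  have in1: "input s1" by (rule input_keep[OF s(1) K]) auto
  have fx1: "fixed S s1" by (rule fixed_keep[OF s(2) K]) auto
  have guard: "eval_expr w s1 (Bin Less (Reg 13) (Reg 9)) \<noteq> 0"
    using k in1 bounds by (simp add: W input_def)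
  have sum_le: "(\<Sum>l<k. bit_of (f (query1 \<omega> (j * m + l) S x))) \<le> k"
    using sum_mono[of "{..<k}" "\<lambda>l. bit_of (f (query1 \<omega> (j * m + l) S x))" "\<lambda>_. 1"]
    by (simp add: bit_of_def)
  have vote_sum: "(\<Sum>l<k. vote \<omega> (j * m + l) S x i) \<le> 2 * k" for i
    using sum_mono[of "{..<k}" "\<lambda>l. vote \<omega> (j * m + l) S x i" "\<lambda>_. 2"] vote_le by simp
  show ?case
    apply (rule conjI[OF guard])
    apply (simp only: wp_Seq wp_Assign)
    apply (rule wp_mono[OF point_loop[where q = ?q and S = S]])
    subgoal using in1 by (simp add: input_def)
    subgoal using fx1 by (simp add: fixed_def)
    subgoal by simp
    subgoal by (simp add: tp)
    subgoal premises p2 for t2 q2 s2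
    proof -
      have K2: "keep ?X ?Y s1 s2" using p2 by (auto simp: keep_def)
      have w2: "written ?q S n s2" using p2 by simp
      have S: "S \<subseteq> {..<n}" using fx1 by (simp add: fixed_def)
      have in2: "input s2" by (rule input_keep[OF in1 K2]) auto
      have r2: "regs s2 12 = regs s1 12" "arrs s2 2 = arrs s1 2" "regs s2 13 = k"
        using p2 k by (auto simp: keep_def)
      have tq2: "t2 \<le> n * (50 + 26 * a) + 4" "q2 = 0" "tape_pos s2 = base n a (Suc ?q) 0" using p2 by auto
      have sums: "regs s1 12 mod W = regs s1 12" "(regs s1 12 + bit_of y) mod W = regs s1 12 + bit_of y" for y
        using r12 sum_le k bounds bit_of_less[of y] by auto
      show ?thesis
        apply (simp only: wp_Query wp_Assign)
        apply (rule wp_mono[OF vote_loop[where q = ?q and S = S]])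
        subgoal using in2 by (simp add: input_def)
        subgoal by simp
        subgoal by (simp add: queried[OF w2 S])
        subgoal by (simp add: queried[OF w2 S])
        subgoal using w2 by (simp add: written_def)
        subgoal for i using vote_sum[of i] k bounds by (simp add: r2 a2)
        subgoal premises p3 for t3 q3 s3
        proof -
          have K3: "keep ?X ?Y s1 s3" using p3 K2 by (auto simp: keep_def)
          have K3': "keep ?X ?Y s s3" using keep_trans[OF K K3] by simp
          have r3: "regs s3 13 = k" "regs s3 12 = regs s1 12 + bit_of (f (query1 \<omega> ?q S x))"
            "tape_pos s3 = base n a (Suc ?q) 0"
            using p3 r2 tq2 sums by (auto simp: keep_def W queried[OF w2 S])
          have a3: "arrs s3 2 i = (\<Sum>l<Suc k. vote \<omega> (j * m + l) S x i)" if "i < n" for i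
            using p3 that by (simp add: r2 a2)
          have tq3: "t3 \<le> n * 25 + 4" "q3 = 0" using p3 by auto
          have kW: "k + 1 < W" using k bounds by auto
          show ?thesis
            using tq2 tq3 kW K3' a3 by (auto simp: W r3 r12 keep_def algebra_simps)
        qed
        done
    qed
    done
next
  case (3 s1)
  then have "input s1" using input_keep[OF s(1), of _ _ s1] by auto
  with 3 show ?case using bounds by (simp add: W input_def)
next
  case (4 t r s1)
  then show ?case by (auto simp: ones_def count_def algebra_simps)
qed

lemma clear_loop:
  assumes s: "input s" "regs s 11 = 0"
  shows "wpx clear_loop s (\<lambda>t r s'. t \<le> n * 11 + 4 \<and> r = 0 \<and> keep {11} {2} s s' \<and>
    tape_pos s' = tape_pos s \<and> (\<forall>i<n. arrs s' 2 i = 0))"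
  unfolding clear_loop_def
proof (rule wp_for[where N = n and T = 7 and U = 0 and
      I = "\<lambda>k s'. keep {11} {2} s s' \<and> regs s' 11 = k \<and> tape_pos s' = tape_pos s \<and> (\<forall>i<k. arrs s' 2 i = 0)"], goal_cases)
  case 1
  then show ?case using s by (auto simp: keep_def)
next
  case (2 k s1)
  then have "input s1" using input_keep[OF s(1), of _ _ s1] by auto
  with 2 bounds show ?case by (auto simp: W input_def keep_def less_Suc_eq)
next
  case (3 s1)
  then have "input s1" using input_keep[OF s(1), of _ _ s1] by auto
  with 3 show ?case using bounds by (simp add: W input_def)
next
  case (4 t r s1)
  then show ?case by auto
qed

lemma max_loop:
  assumes s: "input s" "regs s 11 = 1" "regs s 19 = 0" and c: "\<And>i. i < n \<Longrightarrow> arrs s 2 i < W"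
  shows "wpx max_loop s (\<lambda>t r s'. t \<le> n * 16 + 4 \<and> r = 0 \<and> keep {11, 19} {} s s' \<and>
    tape_pos s' = tape_pos s \<and> regs s' 19 = argmax (arrs s 2) (n - 1))"
  unfolding max_loop_def
proof (rule wp_for[where N = "n - 1" and T = 12 and U = 0 and
      I = "\<lambda>k s'. keep {11, 19} {} s s' \<and> regs s' 11 = k + 1 \<and> tape_pos s' = tape_pos s \<and>
        regs s' 19 = argmax (arrs s 2) k"], goal_cases)
  case 1
  then show ?case using s by (auto simp: keep_def)
next
  case (2 k s1)
  then have in1: "input s1" using input_keep[OF s(1), of _ _ s1] by auto
  have lt: "argmax (arrs s 2) k < n" "argmax (arrs s 2) k < W" "k + 1 < n" "k + 2 < W"
    using argmax_le[of "arrs s 2" k] 2(1) bounds by auto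
  have ar: "arrs s1 2 = arrs s 2" using 2 by (auto simp: keep_def)
  have "arrs s 2 (argmax (arrs s 2) k) mod W = arrs s 2 (argmax (arrs s 2) k)"
    "arrs s 2 (Suc k) mod W = arrs s 2 (Suc k)"
    using c lt by auto
  with 2 in1 lt bounds show ?case by (auto simp: W input_def keep_def ar)
next
  case (3 s1)
  then have "input s1" using input_keep[OF s(1), of _ _ s1] by auto
  with 3 show ?case using bounds n by (simp add: W input_def)
next
  case (4 t r s1)
  have "(n - 1) * 16 \<le> n * 16" by simp
  with 4 show ?case by auto
qed

lemma count_le: "count \<omega> j S x i \<le> 2 * m"
  using sum_mono[of "{..<m}" "\<lambda>l. vote \<omega> (j * m + l) S x i" "\<lambda>_. 2"] vote_le by (simp add: count_def)

lemma ones_le: "ones \<omega> j S x \<le> m"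
  using sum_mono[of "{..<m}" "\<lambda>l. bit_of (f (query1 \<omega> (j * m + l) S x))" "\<lambda>_. 1"]
  by (simp add: ones_def bit_of_def)

lemma argmax_cong: "(\<And>i. i \<le> k \<Longrightarrow> c i = c' i) \<Longrightarrow> argmax c k = argmax c' k"
proof (induction k)
  case (Suc k)
  then have "argmax c k = argmax c' k" by simp
  moreover have "argmax c' k \<le> Suc k" using argmax_le[of c' k] by simp
  ultimately show ?case using Suc.prems by simp
qed simp

lemma level_loop:
  assumes s: "input s" "fixed {} s" "regs s 10 = 0" "tape_pos s = 0"
  shows "wpx level_loop s (\<lambda>t r s'. t \<le> (D + 1) * (m * (n * (75 + 26 * a) + 30) + n * 27 + 50) + 6 \<and>
    r \<le> (D + 1) * (m * 2) \<and> regs s' 9 = m \<and> regs s' 12 = ones \<omega> D (vars (pick \<omega>) D x) x)"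
  unfolding level_loop_def
\<comment> \<open>Register 12 refers to the level just completed, hence \<open>j - 1\<close> in the
  invariant; at exit this is level \<open>D\<close>.\<close>
proof (rule wp_for[where N = "D + 1" and T = "m * (n * (75 + 26 * a) + 30) + n * 27 + 44" and U = "m * 2" and
      I = "\<lambda>j s'. keep {10..19} {2, 3, 4, 5, 6} s s' \<and> regs s' 10 = j \<and>
        tape_pos s' = base n a (j * m) 0 \<and> fixed (vars (pick \<omega>) j x) s' \<and>
        (j > 0 \<longrightarrow> regs s' 12 = ones \<omega> (j - 1) (vars (pick \<omega>) (j - 1) x) x)"], goal_cases)
  case 1
  then show ?case using s by (auto simp: keep_def base_def)
next
  case (2 j s1)
  let ?X = "{10..19} :: nat set" and ?Y = "{2, 3, 4, 5, 6} :: nat set"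
  let ?S = "vars (pick \<omega>) j x"
  from 2 have K: "keep ?X ?Y s s1" and j: "regs s1 10 = j" "j \<le> D"
    and tp: "tape_pos s1 = base n a (j * m) 0" and fx1: "fixed ?S s1" by auto
  have in1: "input s1" by (rule input_keep[OF s(1) K]) auto
  have guard: "eval_expr w s1 (Bin Less (Reg 10) (Bin Add (Reg 8) (Const 1))) \<noteq> 0"
    using j in1 bounds by (simp add: W input_def)
  show ?case
    apply (rule conjI[OF guard])
    apply (simp only: wp_Seq wp_Assign)
    apply (rule wp_mono[OF clear_loop])
    subgoal using in1 by (simp add: input_def)
    subgoal by simp
    subgoal premises p2 for t2 q2 s2
      apply (rule wp_mono[OF sample_loop[where S = ?S and j = j]])
      subgoal using in1 p2 by (auto simp: input_def keep_def)
      subgoal using fx1 p2 by (auto simp: fixed_def keep_def)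
      subgoal by simp
      subgoal by simp
      subgoal using p2 tp by simp
      subgoal using p2 by simp
      subgoal premises p3 for t3 q3 s3
        apply (rule wp_mono[OF max_loop])
        subgoal using in1 p2 p3 by (auto simp: input_def keep_def)
        subgoal by simp
        subgoal by simp
        subgoal for i using p3 count_le[of j ?S i] bounds by simp
        subgoal premises p4 for t4 q4 s4
        proof -
          have K4: "keep ?X {2, 3, 4, 5} s1 s4" using p2 p3 p4 by (auto simp: keep_def)
          have t: "t2 \<le> n * 11 + 4" "t3 \<le> m * (n * (75 + 26 * a) + 30) + 4" "t4 \<le> n * 16 + 4"
            "q2 = 0" "q3 \<le> m * 2" "q4 = 0" using p2 p3 p4 by auto
          have r10: "regs s4 10 = j" using p2 p3 p4 j by (auto simp: keep_def)
          have r12: "regs s4 12 = ones \<omega> j ?S x" using p3 p4 by (auto simp: keep_def)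
          have tp4: "tape_pos s4 = base n a (j * m + m) 0" using p3 p4 by auto
          have "regs s4 19 = argmax (arrs s3 2) (n - 1)" using p4 by auto
          also have "\<dots> = pick \<omega> j ?S x"
            unfolding pick_def[of \<omega> j ?S x] by (rule argmax_cong) (use p3 n in auto)
          finally have r19: "regs s4 19 = pick \<omega> j ?S x" .
          have pW: "pick \<omega> j ?S x < n" "pick \<omega> j ?S x < W" using pick_less[of \<omega> j ?S x] bounds by auto
          have fx4: "fixed ?S s4" by (rule fixed_keep[OF fx1 K4]) auto
          have K': "keep ?X ?Y s (s4\<lparr>arrs := (arrs s4)(6 := u), regs := (regs s4)(10 := Suc j)\<rparr>)" for u
            using keep_trans[OF K K4] by (auto simp: keep_def)
          have jW: "j + 1 < W" using j bounds by auto
          show ?thesis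
            using t K' pW fx4 jW
            by (auto simp: W r10 r12 r19 tp4 fixed_def algebra_simps)
        qed
        done
      done
    done
next
  case (3 s1)
  then have "input s1" using input_keep[OF s(1), of _ _ s1] by auto
  with 3 show ?case using bounds by (simp add: W input_def)
next
  case (4 t r s1)
  then have "input s1" using input_keep[OF s(1), of _ _ s1] by auto
  with 4 show ?case by (simp add: input_def algebra_simps)
qed

end

section \<open>Rounded logarithms and the leading binary digit\<close>

definition clog :: "nat \<Rightarrow> nat" where
  "clog v = (LEAST k. v \<le> 2 ^ k)"

lemma le_clog: "v \<le> 2 ^ clog v"
  unfolding clog_def by (rule LeastI[of _ v]) (simp add: less_imp_le)

lemma less_clog: "k < clog v \<Longrightarrow> 2 ^ k < v"
  unfolding clog_def using not_less_Least[of k "\<lambda>k. v \<le> 2 ^ k"] by simp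

lemma clog_le: "clog v \<le> v"
  unfolding clog_def by (rule Least_le) (simp add: less_imp_le)

lemma clog_upper: "1 \<le> v \<Longrightarrow> 2 ^ clog v \<le> 2 * v"
  using less_clog[of "clog v - 1" v] by (cases "clog v") auto

text \<open>The position of the first nonzero binary digit: for \<open>\<epsilon>\<close> in (0,1),
  \<open>1 \<le> \<epsilon> * 2 ^ (lead + 1)\<close> and
  \<open>\<epsilon> * 2 ^ lead < 1\<close>.\<close>

definition lead :: "real \<Rightarrow> nat" where
  "lead \<epsilon> = (LEAST j. 1 \<le> \<epsilon> * 2 ^ (j + 1))"

context
  fixes \<epsilon> :: real
  assumes \<epsilon>: "0 < \<epsilon>" "\<epsilon> < 1"
begin

lemma lead_ge: "1 \<le> \<epsilon> * 2 ^ (lead \<epsilon> + 1)"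
proof -
  obtain j where "1 / \<epsilon> < 2 ^ j" using real_arch_pow[of 2 "1 / \<epsilon>"] by auto
  then have "1 \<le> \<epsilon> * 2 ^ (j + 1)" using \<epsilon> by (simp add: field_simps)
  then show ?thesis unfolding lead_def by (rule LeastI)
qed

lemma lead_minimal: "j < lead \<epsilon> \<Longrightarrow> \<epsilon> * 2 ^ (j + 1) < 1"
  unfolding lead_def using not_less_Least[of j "\<lambda>j. 1 \<le> \<epsilon> * 2 ^ (j + 1)"] by simp

lemma lead_less: "\<epsilon> * 2 ^ lead \<epsilon> < 1"
  using lead_minimal[of "lead \<epsilon> - 1"] \<epsilon> by (cases "lead \<epsilon>") auto

lemma digit_before: "j < lead \<epsilon> \<Longrightarrow> binary_digit \<epsilon> j = 0"
proof -
  assume "j < lead \<epsilon>"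
  then have "\<epsilon> * 2 ^ (j + 1) < 1" by (rule lead_minimal)
  then have "\<lfloor>\<epsilon> * 2 ^ (j + 1)\<rfloor> = 0" using \<epsilon> by (intro floor_unique) auto
  then show ?thesis by (simp add: binary_digit_def)
qed

lemma digit_lead: "binary_digit \<epsilon> (lead \<epsilon>) = 1"
proof -
  have "\<lfloor>\<epsilon> * 2 ^ (lead \<epsilon> + 1)\<rfloor> = 1"
    using lead_ge lead_less by (intro floor_unique) auto
  then show ?thesis by (simp add: binary_digit_def)
qed

end

text \<open>The depth and the sample size depend on \<open>\<epsilon>\<close> only through a power of two of order
  \<open>1 / \<epsilon>\<close>, which is read off the first nonzero binary digit.\<close>

definition scale :: "real \<Rightarrow> nat" where
  "scale \<epsilon> = 16 * 2 ^ lead \<epsilon>"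

text \<open>Reciprocal of the noise rate up to a factor two; the \<open>+ 1\<close> keeps it
  positive for \<open>d = 0\<close>.\<close>

definition rad :: "nat \<Rightarrow> real \<Rightarrow> nat" where
  "rad d \<epsilon> = (d + 1) * scale \<epsilon>"

definition tdepth :: "nat \<Rightarrow> real \<Rightarrow> nat" where
  "tdepth d \<epsilon> = 2 * d ^ 3 * (scale \<epsilon>)\<^sup>2"

text \<open>With \<open>\<eta> = 1 / (16 * rad ^ 3)\<close> the Hoeffding exponent
  \<open>m * \<eta>^2 / 2\<close> carries the constant \<open>1 / 512\<close>, so it becomes exactly
  \<open>(2 * D + c + 2) * clog (n + 1)\<close>, as \<open>failure_bound\<close> requires.\<close>

definition samples :: "nat \<Rightarrow> nat \<Rightarrow> nat \<Rightarrow> real \<Rightarrow> nat" where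
  "samples c n d \<epsilon> = 512 * ((2 * tdepth d \<epsilon> + (c + 2)) * (clog (n + 1) * rad d \<epsilon> ^ 6))"

section \<open>The program computes its parameters\<close>

definition digit_loop :: com where
  "digit_loop = While (Bin Equal (Arr 1 (Reg 3)) (Const 0))
     (Seq (Assign 3 (Bin Add (Reg 3) (Const 1))) (Assign 2 (Bin Mul (Const 2) (Reg 2))))"

definition pow_loop :: "nat \<Rightarrow> expr \<Rightarrow> com" where
  "pow_loop v e = Seq (Assign 6 (Const 1)) (While (Bin Less (Reg 6) e)
     (Seq (Assign 6 (Bin Mul (Const 2) (Reg 6))) (Assign v (Bin Add (Reg v) (Const 1)))))"

definition depth_expr :: expr where
  "depth_expr = Bin Mul (Const 2) (Bin Mul (Reg 1) (Bin Mul (Reg 1) (Bin Mul (Reg 1) (Bin Mul (Reg 2) (Reg 2)))))"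

definition samples_expr :: "nat \<Rightarrow> expr" where
  "samples_expr c = Bin Mul (Const 512) (Bin Mul (Bin Add (Bin Mul (Const 2) (Reg 8)) (Const (c + 2)))
     (Bin Mul (Reg 7) (Bin Mul (Reg 4) (Bin Mul (Reg 4) (Bin Mul (Reg 4) (Bin Mul (Reg 4) (Bin Mul (Reg 4) (Reg 4))))))))"

definition prelude :: "nat \<Rightarrow> com" where
  "prelude c = Seq (Assign 2 (Const 16)) (Seq digit_loop
     (Seq (Assign 4 (Bin Mul (Bin Add (Reg 1) (Const 1)) (Reg 2)))
     (Seq (pow_loop 5 (Reg 4)) (Seq (pow_loop 7 (Bin Add (Reg 0) (Const 1)))
     (Seq (Assign 8 depth_expr) (Assign 9 (samples_expr c)))))))"

definition program :: "nat \<Rightarrow> com" where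
  "program c = Seq (prelude c) (Seq level_loop
     (Assign 0 (Bin Less (Reg 9) (Bin Add (Bin Mul (Const 2) (Reg 12)) (Const 1)))))"

lemma digit_loop:
  assumes \<epsilon>: "0 < \<epsilon>" "\<epsilon> < 1" and W: "2 ^ w = (W::nat)" "2 < W" "scale \<epsilon> < W"
    and s: "regs s 3 = 0" "regs s 2 = 16" "arrs s 1 = binary_digit \<epsilon>"
  shows "wp w n f \<omega> digit_loop s (\<lambda>t q s'. t \<le> 13 * scale \<epsilon> + 5 \<and> q = 0 \<and> keep {2, 3} {} s s' \<and>
    tape_pos s' = tape_pos s \<and> regs s' 2 = scale \<epsilon>)"
  unfolding digit_loop_def
proof (rule wp_for[where N = "lead \<epsilon>" and T = 8 and U = 0 and
      I = "\<lambda>k s'. keep {2, 3} {} s s' \<and> regs s' 3 = k \<and> regs s' 2 = 16 * 2 ^ k \<and> tape_pos s' = tape_pos s"], goal_cases)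
  case 1
  then show ?case using s by (auto simp: keep_def)
next
  case (2 k s1)
  have "k + 1 \<le> 2 ^ lead \<epsilon>" using 2(1) less_exp[of "lead \<epsilon>"] by linarith
  then have k: "k + 1 < W" using W(3) unfolding scale_def by linarith
  have "(2::nat) ^ Suc k \<le> 2 ^ lead \<epsilon>" using 2(1) by (intro power_increasing) auto
  then have p: "16 * 2 ^ Suc k < W" using W(3) unfolding scale_def by linarith
  have "arrs s1 1 = binary_digit \<epsilon>" using 2 s by (auto simp: keep_def)
  with 2 k p W digit_before[OF \<epsilon> 2(1)] show ?case by (auto simp: keep_def)
next
  case (3 s1)
  have "lead \<epsilon> < 2 ^ lead \<epsilon>" by (rule less_exp)
  then have k: "lead \<epsilon> < W" using W(3) unfolding scale_def by linarith
  have "arrs s1 1 = binary_digit \<epsilon>" using 3 s by (auto simp: keep_def)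
  with 3 k W digit_lead[OF \<epsilon>] show ?case by auto
next
  case (4 t q s1)
  have "lead \<epsilon> < 2 ^ lead \<epsilon>" by (rule less_exp)
  moreover have "t \<le> 13 * lead \<epsilon> + 5" using 4 by simp
  ultimately have "t \<le> 13 * scale \<epsilon> + 5" unfolding scale_def by linarith
  with 4 show ?case by (simp add: scale_def)
qed

text \<open>The bound \<open>e\<close> is re-evaluated in each round, so its value is assumed under
  the frame of the loop. Register 6 may overshoot \<open>v\<close>, but stays at most
  \<open>2 * v\<close>.\<close>

lemma pow_loop:
  assumes W: "2 ^ w = (W::nat)" "2 * v + 2 < W" and v: "1 \<le> v" "r \<noteq> 6" and s: "regs s r = 0"
    and e: "\<And>s'. keep {r, 6} {} s s' \<Longrightarrow> eval_expr w s' e = v" "expr_cost e \<le> 3"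
  shows "wp w n f \<omega> (pow_loop r e) s (\<lambda>t q s'. t \<le> 14 * v + 8 \<and> q = 0 \<and> keep {r, 6} {} s s' \<and>
    tape_pos s' = tape_pos s \<and> regs s' r = clog v)"
  unfolding pow_loop_def
  apply (simp only: wp_Seq wp_Assign)
proof (rule wp_for[where N = "clog v" and T = 8 and U = 0 and
      I = "\<lambda>k s'. keep {r, 6} {} s s' \<and> regs s' r = k \<and> regs s' 6 = 2 ^ k \<and> tape_pos s' = tape_pos s"], goal_cases)
  case 1
  then show ?case using s v W by (auto simp: keep_def)
next
  case (2 k s1)
  then have "2 ^ k < v" by (intro less_clog) auto
  moreover have "k < 2 ^ k" by (rule less_exp)
  ultimately have "k + 1 < W" "2 * 2 ^ k < W" "2 ^ k < W" using W(2) by linarith+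
  moreover have "eval_expr w s1 e = v" using e(1) 2 by blast
  ultimately show ?case using 2 \<open>2 ^ k < v\<close> W v by (auto simp: keep_def)
next
  case (3 s1)
  have "2 ^ clog v < W" using clog_upper[OF v(1)] W by linarith
  moreover have "eval_expr w s1 e = v" using e(1) 3 by blast
  ultimately show ?case using 3 le_clog[of v] W by auto
next
  case (4 t q s1)
  have "clog v * (8 + expr_cost (Bin Less (Reg 6) e) + 1) \<le> v * 14"
    using clog_le e(2) by (intro mult_mono) auto
  with 4 e(2) show ?case by auto
qed

lemma scale_ge: "16 \<le> scale \<epsilon>"
  by (simp add: scale_def)

lemma scale_le_rad: "scale \<epsilon> \<le> rad d \<epsilon>"
  by (simp add: rad_def)

lemma rad_ge: "16 \<le> rad d \<epsilon>" "d + 1 \<le> rad d \<epsilon>"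
proof -
  show "16 \<le> rad d \<epsilon>" using scale_ge scale_le_rad order_trans by blast
  have "(d + 1) * 1 \<le> (d + 1) * scale \<epsilon>" using scale_ge[of \<epsilon>] by (intro mult_left_mono) auto
  then show "d + 1 \<le> rad d \<epsilon>" by (simp add: rad_def)
qed

lemma clog_pos: "1 \<le> n \<Longrightarrow> 1 \<le> clog (n + 1)"
  using le_clog[of "n + 1"] by (cases "clog (n + 1)") auto

text \<open>The other parameters are dominated by the sample size, so one condition on the word size
  covers them.\<close>

lemma samples_ge:
  assumes "1 \<le> n"
  shows "rad d \<epsilon> \<le> samples c n d \<epsilon>" "tdepth d \<epsilon> \<le> samples c n d \<epsilon>"
proof -
  have L: "1 \<le> clog (n + 1)" using assms by (rule clog_pos)
  have r: "1 \<le> rad d \<epsilon>" using rad_ge(1)[of d \<epsilon>] by simp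
  have r6: "rad d \<epsilon> \<le> rad d \<epsilon> ^ 6" using r by (intro self_le_power) auto
  have "1 * (1 * (1 * rad d \<epsilon>)) \<le> samples c n d \<epsilon>"
    unfolding samples_def using L r6 by (intro mult_mono) auto
  then show "rad d \<epsilon> \<le> samples c n d \<epsilon>" by simp
  have "1 * (tdepth d \<epsilon> * (1 * 1)) \<le> samples c n d \<epsilon>"
    unfolding samples_def using L r r6 by (intro mult_mono) auto
  then show "tdepth d \<epsilon> \<le> samples c n d \<epsilon>" by simp
qed

lemma prelude:
  assumes \<epsilon>: "0 < \<epsilon>" "\<epsilon> < 1" and n: "1 \<le> n"
    and W: "2 ^ w = (W::nat)" "2 * samples c n d \<epsilon> + 2 < W" "2 * n + 4 < W"
  shows "wp w n f \<omega> (prelude c) (init_state n d \<epsilon> x) (\<lambda>t q s'.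
    t \<le> 13 * scale \<epsilon> + 14 * rad d \<epsilon> + 14 * n + 100 \<and> q = 0 \<and> keep {2, 3, 4, 5, 6, 7, 8, 9} {} (init_state n d \<epsilon> x) s' \<and>
    tape_pos s' = 0 \<and> regs s' 5 = clog (rad d \<epsilon>) \<and> regs s' 8 = tdepth d \<epsilon> \<and> regs s' 9 = samples c n d \<epsilon>)"
proof -
  let ?s = "init_state n d \<epsilon> x"
  note rg = rad_ge[of d \<epsilon>] scale_ge[of \<epsilon>] scale_le_rad[of \<epsilon> d] samples_ge[OF n, of d \<epsilon> c]
  have small: "16 < W" "1 < W" "2 < W" "2 * rad d \<epsilon> + 2 < W" "scale \<epsilon> < W" "rad d \<epsilon> < W" "d < W" "d + 1 < W" "n < W"
      "tdepth d \<epsilon> < W" "samples c n d \<epsilon> < W" "2 * (n + 1) + 2 < W" "n + 1 < W"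
    using rg W by auto
  show ?thesis
    unfolding prelude_def
    apply (simp only: wp_Seq wp_Assign)
    apply (rule wp_mono[OF digit_loop[OF \<epsilon> W(1)]])
    subgoal using small by simp
    subgoal using small by simp
    subgoal by (simp add: init_state_def)
    subgoal using small W by simp
    subgoal by (simp add: init_state_def fun_eq_iff)
    subgoal premises p1 for t1 q1 s1
    proof -
      have r1: "regs s1 1 = d" "regs s1 2 = scale \<epsilon>" "regs s1 0 = n" "regs s1 5 = 0" "regs s1 7 = 0" "tape_pos s1 = 0"
        "\<And>b. arrs s1 b = arrs ?s b"
        using p1 by (auto simp: keep_def init_state_def)
      have rad: "(Suc d * scale \<epsilon>) mod W = rad d \<epsilon>"
        using small by (simp add: rad_def)
      show ?thesis
        apply (rule wp_mono[OF pow_loop[OF W(1), where v = "rad d \<epsilon>"]])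
        subgoal using small by simp
        subgoal using rg by simp
        subgoal by simp
        subgoal by (simp add: r1)
        subgoal for s' using r1 rad small W by (auto simp: keep_def mod_simps)
        subgoal by simp
        subgoal premises p2 for t2 q2 s2
          apply (rule wp_mono[OF pow_loop[OF W(1), where v = "n + 1"]])
          subgoal using small by simp
          subgoal using n by simp
          subgoal by simp
          subgoal using p2 r1 by (auto simp: keep_def)
          subgoal for s' using p2 r1 small W by (auto simp: keep_def)
          subgoal by simp
          subgoal premises p3 for t3 q3 s3
          proof -
            have r3: "regs s3 1 = d" "regs s3 2 = scale \<epsilon>" "regs s3 4 = rad d \<epsilon>" "regs s3 5 = clog (rad d \<epsilon>)"
              "regs s3 7 = clog (n + 1)" "tape_pos s3 = 0"
              using p2 p3 r1 rad small W by (auto simp: keep_def mod_simps)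
            have K: "keep {2, 3, 4, 5, 6, 7, 8, 9} {} ?s s3" using p1 p2 p3 by (auto simp: keep_def)
            \<comment> \<open>Intermediate results are reduced modulo \<open>W\<close>, but sums and
              products commute with reduction, so only the final value has to fit into a
              word.\<close>
            have ed: "eval_expr w s3 depth_expr = tdepth d \<epsilon>"
            proof -
              have "eval_expr w s3 depth_expr = (2 * (d * (d * (d * (scale \<epsilon> * scale \<epsilon>))))) mod W"
                unfolding depth_expr_def by (simp add: W(1) r3 r3(1)[unfolded One_nat_def] mod_simps)
              also have "2 * (d * (d * (d * (scale \<epsilon> * scale \<epsilon>)))) = tdepth d \<epsilon>"
                by (simp add: tdepth_def power2_eq_square power3_eq_cube)
              finally show ?thesis using small by simp
            qed
            let ?s4 = "s3\<lparr>regs := (regs s3)(8 := tdepth d \<epsilon>)\<rparr>"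
            have em: "eval_expr w ?s4 (samples_expr c) = samples c n d \<epsilon>"
            proof -
              have "eval_expr w ?s4 (samples_expr c) = (512 * ((2 * tdepth d \<epsilon> + (c + 2)) * (clog (n + 1) *
                  (rad d \<epsilon> * (rad d \<epsilon> * (rad d \<epsilon> * (rad d \<epsilon> * (rad d \<epsilon> * rad d \<epsilon>)))))))) mod W"
                unfolding samples_expr_def eval_expr.simps apply_binop.simps
                by (simp only: W(1) r3 mod_simps state.select_convs state.update_convs fun_upd_same fun_upd_other
                    state.simps) (simp add: r3 mod_simps)
              also have "512 * ((2 * tdepth d \<epsilon> + (c + 2)) * (clog (n + 1) *
                  (rad d \<epsilon> * (rad d \<epsilon> * (rad d \<epsilon> * (rad d \<epsilon> * (rad d \<epsilon> * rad d \<epsilon>))))))) = samples c n d \<epsilon>"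
              proof -
                have "rad d \<epsilon> ^ 6 = rad d \<epsilon> * (rad d \<epsilon> * (rad d \<epsilon> * (rad d \<epsilon> * (rad d \<epsilon> * rad d \<epsilon>))))"
                  by (simp add: eval_nat_numeral)
                then show ?thesis by (simp only: samples_def)
              qed
              finally show ?thesis by (simp only: mod_less[OF small(11)])
            qed
            have t: "t1 \<le> 13 * scale \<epsilon> + 5" "t2 \<le> 14 * rad d \<epsilon> + 8" "t3 \<le> 14 * (n + 1) + 8" "q1 = 0" "q2 = 0" "q3 = 0"
              using p1 p2 p3 by auto
            show ?thesis
              unfolding ed em using t K r3
              by (auto simp: keep_def depth_expr_def samples_expr_def)
          qed
          done
        done
    qed
    done
qed

lemma program_correct:
  assumes \<epsilon>: "0 < \<epsilon>" "\<epsilon> < 1" and n: "1 \<le> n" and f: "f \<in> cube n \<rightarrow> {-1, 1}" and x: "x \<in> cube n"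
    and word: "2 ^ w = (W::nat)" "2 * samples c n d \<epsilon> + 2 < W" "2 * n + 4 < W"
  defines "a \<equiv> clog (rad d \<epsilon>)" and "D \<equiv> tdepth d \<epsilon>" and "m \<equiv> samples c n d \<epsilon>" and "R \<equiv> rad d \<epsilon>"
  shows "\<exists>t q s. exec w n f \<omega> (program c) (init_state n d \<epsilon> x) t q s \<and>
    answer_of s = tree_eval (sampling.rtree n a m f D \<omega>) x \<and>
    t \<le> 54 * ((D + 1) * (m * (n * R))) \<and> q \<le> (D + 1) * (m * 2)"
proof -
  note rg = rad_ge[of d \<epsilon>] scale_ge[of \<epsilon>] scale_le_rad[of \<epsilon> d] samples_ge[OF n, of d \<epsilon> c]
  have aR: "a \<le> R" unfolding a_def R_def by (rule clog_le)
  interpret machine n a m f w W D \<omega> x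
    by unfold_locales (use n f x word rg aR in \<open>auto simp: m_def D_def R_def\<close>)
  \<comment> \<open>The summand 20 covers the 6 extra steps of the level loop and the 9 of the final
    assignment.\<close>
  have time: "13 * scale \<epsilon> + 14 * R + 14 * n + 100 + (D + 1) * (m * (n * (75 + 26 * a) + 30) + n * 27 + 50) + 20
      \<le> 54 * ((D + 1) * (m * (n * R)))"
  proof -
    have R: "16 \<le> R" and mR: "R \<le> m" using rg by (auto simp: R_def m_def)
    \<comment> \<open>Every cost is a multiple of \<open>Z\<close> or \<open>Z * R\<close>, and
      \<open>R \<ge> 16\<close> absorbs the first kind into the second.\<close>
    define Z where "Z = (D + 1) * (m * n)"
    have mn: "m * n \<le> Z" by (simp add: Z_def)
    have "R * 1 \<le> m * n" using mR n by (intro mult_mono) auto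
    then have RZ: "R \<le> Z" using mn by simp
    have mnn: "1 * n \<le> m * n" using mR R by (intro mult_right_mono) auto
    from order_trans[OF this mn] have nZ: "n \<le> Z" by simp
    have "m * (n * (75 + 26 * a) + 30) + n * 27 + 50 \<le> m * n * (182 + 26 * R)"
    proof -
      have "m * (n * (75 + 26 * a) + 30) \<le> m * (n * (75 + 26 * R) + n * 30)"
        using aR n by (intro mult_left_mono add_mono) auto
      also have "\<dots> = 105 * (m * n) + 26 * (m * n * R)" by (simp add: algebra_simps)
      finally have "m * (n * (75 + 26 * a) + 30) + n * 27 + 50 \<le> 182 * (m * n) + 26 * (m * n * R)"
        using n mnn by linarith
      also have "\<dots> = m * n * (182 + 26 * R)" by (simp add: algebra_simps)
      finally show ?thesis .
    qed
    then have "(D + 1) * (m * (n * (75 + 26 * a) + 30) + n * 27 + 50) \<le> (D + 1) * (m * n * (182 + 26 * R))"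
      by (rule mult_left_mono) simp
    also have "\<dots> = Z * (182 + 26 * R)" unfolding Z_def by (simp only: mult.assoc)
    finally have main: "(D + 1) * (m * (n * (75 + 26 * a) + 30) + n * 27 + 50) \<le> 182 * Z + 26 * (Z * R)"
      by (simp add: algebra_simps)
    have "scale \<epsilon> \<le> R" using rg by (simp add: R_def)
    then have "13 * scale \<epsilon> + 14 * R + 14 * n + 100 + 20 \<le> 27 * R + 14 * n + 120" by simp
    also have "\<dots> \<le> 27 * Z + 14 * Z + 120 * Z" using RZ nZ n by simp
    finally have "13 * scale \<epsilon> + 14 * R + 14 * n + 100 + (D + 1) * (m * (n * (75 + 26 * a) + 30) + n * 27 + 50) + 20
        \<le> 343 * Z + 26 * (Z * R)"
      using main by linarith
    also have "16 * Z \<le> Z * R" using R by simp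
    then have "343 * Z + 26 * (Z * R) \<le> 54 * (Z * R)" by linarith
    also have "\<dots> = 54 * ((D + 1) * (m * (n * R)))" unfolding Z_def by (simp only: mult.assoc)
    finally show ?thesis .
  qed
  have "wpx (program c) (init_state n d \<epsilon> x) (\<lambda>t q s. answer_of s = tree_eval (rtree D \<omega>) x \<and>
      t \<le> 54 * ((D + 1) * (m * (n * R))) \<and> q \<le> (D + 1) * (m * 2))"
    unfolding program_def
    apply (simp only: wp_Seq wp_Assign)
    apply (rule wp_mono[OF prelude[OF \<epsilon> n word]])
    subgoal premises p1 for t1 q1 s1
    proof -
      have i: "input s1"
        unfolding input_def using p1 by (auto simp: keep_def init_state_def a_def D_def m_def)
      have fx: "fixed {} s1" using p1 by (auto simp: fixed_def keep_def init_state_def)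
      have r: "regs s1 10 = 0" "tape_pos s1 = 0" using p1 by (auto simp: keep_def init_state_def)
      show ?thesis
        apply (rule wp_mono[OF level_loop[OF i fx r]])
        subgoal premises p2 for t2 q2 s2
        proof -
          have o: "ones \<omega> D (vars (pick \<omega>) D x) x \<le> m" by (rule ones_le)
          have r2: "regs s2 9 = m" "regs s2 12 = ones \<omega> D (vars (pick \<omega>) D x) x" using p2 by auto
          have ev: "eval_expr w s2 (Bin Less (Reg 9) (Bin Add (Bin Mul (Const 2) (Reg 12)) (Const 1))) =
              of_bool (m < 2 * ones \<omega> D (vars (pick \<omega>) D x) x + 1)"
            using o bounds by (auto simp: Defs.eval_expr.simps r2 \<open>2 ^ w = W\<close>)
          have "t1 \<le> 13 * scale \<epsilon> + 14 * R + 14 * n + 100"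
            "t2 \<le> (D + 1) * (m * (n * (75 + 26 * a) + 30) + n * 27 + 50) + 6"
            "q1 = 0" "q2 \<le> (D + 1) * (m * 2)" using p1 p2 by (auto simp: R_def)
          moreover from this have "t1 + (t2 + 9) \<le> 54 * ((D + 1) * (m * (n * R)))"
            using time by linarith
          ultimately show ?thesis
            unfolding ev by (simp add: answer_of_def sign_of_def eval_rtree[OF x] label_def)
        qed
        done
    qed
    done
  then show ?thesis unfolding wp_def by blast
qed

section \<open>Bounds on the parameters\<close>

text \<open>Everything becomes a power of \<open>n + 1\<close>: \<open>(D + 1) * (2 * n) ^ D\<close>
  is at most \<open>(4 * n) ^ D\<close>, hence at most \<open>(n + 1) ^ (2 * D)\<close>; the
  remaining factors cost \<open>(n + 1)^2\<close>; and \<open>exp (- L) \<le> 1 / (n + 1)\<close>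
  since \<open>2 \<le> exp 1\<close>. The exponent \<open>c\<close> is left over.\<close>

lemma failure_bound:
  fixes n D c L :: nat
  assumes n: "1 \<le> n" and L: "n + 1 \<le> 2 ^ L"
  shows "real ((D + 1) * (2 * n) ^ D * (n + 1)) * (2 * exp (- (real (2 * D + (c + 2)) * real L))) \<le> 1 / (real n + 1) ^ c"
proof -
  let ?K = "2 * D + (c + 2)" and ?N = "real n + 1"
  have "(2::real) \<le> exp 1" using exp_ge_add_one_self[of 1] by simp
  then have "2 ^ L \<le> (exp 1 :: real) ^ L" by (rule power_mono) simp
  also have "\<dots> = exp (real L)" by (simp add: exp_of_nat_mult[symmetric])
  finally have "2 ^ L \<le> exp (real L)" .
  moreover have "real (n + 1) \<le> real (2 ^ L)" using L by (rule of_nat_mono)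
  ultimately have "?N \<le> exp (real L)" by simp
  then have "?N ^ ?K \<le> exp (real L) ^ ?K" by (intro power_mono) auto
  also have "\<dots> = exp (real ?K * real L)" by (rule exp_of_nat_mult[symmetric])
  finally have "1 / exp (real ?K * real L) \<le> 1 / ?N ^ ?K" by (intro divide_left_mono) auto
  then have e: "exp (- (real ?K * real L)) \<le> 1 / ?N ^ ?K" by (simp add: exp_minus inverse_eq_divide)
  have "(D + 1) * (2 * n) ^ D * (n + 1) * 2 \<le> (n + 1) ^ (2 * D + 2)"
  proof -
    have "4 * n \<le> (n + 1)\<^sup>2" using n by (cases n) (auto simp: power2_eq_square)
    then have n4: "(4 * n) ^ D \<le> ((n + 1)\<^sup>2) ^ D" by (rule power_mono) simp
    have "D + 1 \<le> 2 ^ D" by (simp only: Suc_eq_plus1[symmetric] Suc_le_eq less_exp)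
    then have "(D + 1) * (2 * n) ^ D \<le> 2 ^ D * (2 * n) ^ D" by (rule mult_right_mono) simp
    also have "\<dots> = (2 * (2 * n)) ^ D" by (rule power_mult_distrib[symmetric])
    also have "2 * (2 * n) = 4 * n" by simp
    also note n4
    finally have "(D + 1) * (2 * n) ^ D \<le> (n + 1) ^ (2 * D)" by (simp add: power_mult)
    moreover have "(n + 1) * 2 \<le> (n + 1) ^ 2" using n by (simp add: power2_eq_square)
    ultimately have "((D + 1) * (2 * n) ^ D) * ((n + 1) * 2) \<le> (n + 1) ^ (2 * D) * (n + 1) ^ 2"
      by (rule mult_mono) auto
    then show ?thesis by (simp only: power_add mult.assoc)
  qed
  then have "real ((D + 1) * (2 * n) ^ D * (n + 1) * 2) \<le> real ((n + 1) ^ (2 * D + 2))" by (rule of_nat_mono)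
  also have "\<dots> = ?N ^ (2 * D + 2)" by (simp only: of_nat_power of_nat_add of_nat_1)
  finally have p: "real ((D + 1) * (2 * n) ^ D * (n + 1)) * 2 \<le> ?N ^ (2 * D + 2)" by simp
  have "real ((D + 1) * (2 * n) ^ D * (n + 1)) * 2 * exp (- (real ?K * real L)) \<le> ?N ^ (2 * D + 2) * (1 / ?N ^ ?K)"
    by (rule mult_mono[OF p e]) auto
  also have "\<dots> = 1 / ?N ^ c"
  proof -
    have "?N ^ ?K = ?N ^ (2 * D + 2) * ?N ^ c" by (simp add: power_add[symmetric] add_ac)
    then show ?thesis by simp
  qed
  finally show ?thesis by (simp only: mult.assoc)
qed

context
  fixes \<epsilon> :: real
  assumes \<epsilon>: "0 < \<epsilon>" "\<epsilon> < 1"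
begin

text \<open>The factor 16 in \<open>scale\<close> serves this bound: the additive error
  \<open>4 / scale\<close> of \<open>good_error\<close> becomes at most
  \<open>\<epsilon> / 2\<close>.\<close>

lemma scale_lower: "8 / \<epsilon> \<le> scale \<epsilon>"
  using lead_ge[OF \<epsilon>] \<epsilon> by (simp add: scale_def field_simps)

lemma scale_upper: "scale \<epsilon> \<le> 16 / \<epsilon>"
  using lead_less[OF \<epsilon>] \<epsilon> by (simp add: scale_def field_simps)

text \<open>The depth constant 512 is \<open>2 * 16^2\<close>.\<close>

lemma tdepth_le: "tdepth d \<epsilon> \<le> 512 * real d ^ 3 / \<epsilon>\<^sup>2"
proof -
  have "real (scale \<epsilon>) ^ 2 \<le> (16 / \<epsilon>) ^ 2" using scale_upper by (rule power_mono) simp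
  then have "2 * real d ^ 3 * real (scale \<epsilon>) ^ 2 \<le> 2 * real d ^ 3 * (16 / \<epsilon>) ^ 2" by (intro mult_left_mono) auto
  then show ?thesis by (simp add: tdepth_def power_divide)
qed

lemma rad_le: "real (rad d \<epsilon>) \<le> 16 * (real d + 1 / \<epsilon>)\<^sup>2"
proof -
  have "1 \<le> 1 / \<epsilon>" using \<epsilon> by simp
  have "real (rad d \<epsilon>) = (real d + 1) * real (scale \<epsilon>)" by (simp add: rad_def algebra_simps)
  also have "\<dots> \<le> (real d + 1 / \<epsilon>) * (16 * (real d + 1 / \<epsilon>))"
    using scale_upper \<open>1 \<le> 1 / \<epsilon>\<close> by (intro mult_mono) auto
  also have "\<dots> = 16 * (real d + 1 / \<epsilon>)\<^sup>2" by (simp only: power2_eq_square mult.left_commute)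
  finally show ?thesis .
qed

lemma tdepth_rad: "tdepth d \<epsilon> + 1 \<le> 3 * rad d \<epsilon> ^ 3"
proof -
  have "d ^ 3 * (scale \<epsilon>)\<^sup>2 \<le> (d + 1) ^ 3 * (scale \<epsilon>) ^ 3"
    using scale_ge[of \<epsilon>] by (intro mult_mono power_mono power_increasing) auto
  moreover have "1 \<le> rad d \<epsilon> ^ 3" using rad_ge(1)[of d \<epsilon>] by simp
  moreover have "rad d \<epsilon> ^ 3 = (d + 1) ^ 3 * scale \<epsilon> ^ 3" by (simp only: rad_def power_mult_distrib)
  ultimately show ?thesis unfolding tdepth_def mult.assoc by linarith
qed

text \<open>The exponent 9 is 6 from \<open>\<eta>\<close> plus 3 from the depth, the latter through
  the union bound.\<close>

lemma samples_le: "samples c n d \<epsilon> \<le> 512 * (c + 6) * clog (n + 1) * rad d \<epsilon> ^ 9"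
proof -
  have r: "1 \<le> rad d \<epsilon> ^ 3" using rad_ge(1)[of d \<epsilon>] by simp
  have "c * 1 \<le> c * rad d \<epsilon> ^ 3" using r by (rule mult_left_mono) simp
  then have "2 * tdepth d \<epsilon> + (c + 2) \<le> 6 * rad d \<epsilon> ^ 3 + c * rad d \<epsilon> ^ 3"
    using tdepth_rad[of d] by linarith
  then have "(2 * tdepth d \<epsilon> + (c + 2)) * (clog (n + 1) * rad d \<epsilon> ^ 6)
      \<le> (6 * rad d \<epsilon> ^ 3 + c * rad d \<epsilon> ^ 3) * (clog (n + 1) * rad d \<epsilon> ^ 6)"
    by (rule mult_right_mono) simp
  also have "\<dots> = (c + 6) * clog (n + 1) * rad d \<epsilon> ^ 9"
  proof -
    have "rad d \<epsilon> ^ 9 = rad d \<epsilon> ^ 3 * rad d \<epsilon> ^ 6" by (simp only: power_add[symmetric]) simp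
    moreover have "6 * rad d \<epsilon> ^ 3 + c * rad d \<epsilon> ^ 3 = (c + 6) * rad d \<epsilon> ^ 3" by (simp add: distrib_right)
    ultimately show ?thesis by (simp only: mult_ac)
  qed
  finally show ?thesis unfolding samples_def mult.assoc by (rule mult_left_mono) simp
qed

text \<open>Rounding up adds at most 1, which is at most \<open>log 2 (n + 1)\<close> for
  \<open>n \<ge> 1\<close>.\<close>

lemma clog_log:
  assumes "1 \<le> n"
  shows "real (clog (n + 1)) \<le> 2 * log 2 (real n + 1)"
proof -
  have log2: "1 \<le> log 2 (real n + 1)" using assms by (subst le_log_iff) auto
  have "2 ^ clog (n + 1) \<le> 2 * (n + 1)" by (rule clog_upper) simp
  then have "real (2 ^ clog (n + 1)) \<le> real (2 * (n + 1))" by (rule of_nat_mono)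
  then have "2 powr real (clog (n + 1)) \<le> 2 * (real n + 1)" by (simp add: powr_realpow add.commute)
  then have "real (clog (n + 1)) \<le> log 2 (2 * (real n + 1))" by (subst le_log_iff) auto
  also have "\<dots> = 1 + log 2 (real n + 1)" by (subst log_mult) auto
  finally show ?thesis using log2 by linarith
qed

lemma rad_pow_le: "k \<le> 13 \<Longrightarrow> real (rad d \<epsilon> ^ k) \<le> 16 ^ 13 * (real d + 1 / \<epsilon>) ^ 26"
proof -
  assume "k \<le> 13"
  have "1 \<le> real (rad d \<epsilon>)" using rad_ge(1)[of d \<epsilon>] by simp
  then have "real (rad d \<epsilon>) ^ k \<le> real (rad d \<epsilon>) ^ 13" using \<open>k \<le> 13\<close> by (intro power_increasing)
  also have "\<dots> \<le> (16 * (real d + 1 / \<epsilon>)\<^sup>2) ^ 13" using rad_le by (rule power_mono) simp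
  also have "\<dots> = 16 ^ 13 * (real d + 1 / \<epsilon>) ^ 26" by (simp only: power_mult_distrib power_mult[symmetric]) simp
  finally show ?thesis by simp
qed

text \<open>Depth, samples and coins per noise bit contribute \<open>rad\<close> to the powers 3, 9
  and 1; since \<open>rad\<close> is quadratic in \<open>d + 1 / \<epsilon>\<close>, the exponent 13
  becomes 26.\<close>

lemma time_bounds:
  fixes c n d :: nat
  assumes n: "1 \<le> n"
  defines "B \<equiv> 54 * (3 * (512 * (real c + 6))) * 16 ^ 13 * (real d + 1 / \<epsilon>) ^ 26"
  shows "real (54 * ((tdepth d \<epsilon> + 1) * (samples c n d \<epsilon> * (n * rad d \<epsilon>)))) \<le> 2 * B * (real n * log 2 (real n + 1))"
    and "real ((tdepth d \<epsilon> + 1) * (samples c n d \<epsilon> * 2)) \<le> 2 * B * log 2 (real n + 1)"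
proof -
  let ?R = "rad d \<epsilon>" and ?L = "clog (n + 1)"
  have "(tdepth d \<epsilon> + 1) * samples c n d \<epsilon> \<le> (3 * ?R ^ 3) * (512 * (c + 6) * ?L * ?R ^ 9)"
    by (rule mult_mono[OF tdepth_rad samples_le]) auto
  also have "\<dots> = 3 * (512 * (c + 6)) * ?L * ?R ^ 12"
  proof -
    have "?R ^ 12 = ?R ^ 3 * ?R ^ 9" by (simp only: power_add[symmetric]) simp
    then show ?thesis by (simp only: mult_ac)
  qed
  finally have DM: "(tdepth d \<epsilon> + 1) * samples c n d \<epsilon> \<le> 3 * (512 * (c + 6)) * ?L * ?R ^ 12" .
  have B0: "0 \<le> B" using \<epsilon> by (simp add: B_def)
  have L: "real ?L \<le> 2 * log 2 (real n + 1)" using n by (rule clog_log)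
  have "54 * ((tdepth d \<epsilon> + 1) * (samples c n d \<epsilon> * (n * ?R))) = 54 * (n * ?R) * ((tdepth d \<epsilon> + 1) * samples c n d \<epsilon>)"
    by (simp only: mult_ac)
  also have "\<dots> \<le> 54 * (n * ?R) * (3 * (512 * (c + 6)) * ?L * ?R ^ 12)"
    using DM by (rule mult_left_mono) simp
  also have "\<dots> = 54 * (3 * (512 * (c + 6))) * (?R * ?R ^ 12) * (n * ?L)" by (simp only: mult_ac)
  also have "?R * ?R ^ 12 = ?R ^ 13" by (simp add: power_Suc[symmetric] del: power_Suc)
  finally have "real (54 * ((tdepth d \<epsilon> + 1) * (samples c n d \<epsilon> * (n * ?R)))) \<le> real (54 * (3 * (512 * (c + 6))) * ?R ^ 13 * (n * ?L))"
    by (rule of_nat_mono)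
  also have "\<dots> = 54 * (3 * (512 * (real c + 6))) * real (?R ^ 13) * (real n * real ?L)" by simp
  also have "\<dots> \<le> 54 * (3 * (512 * (real c + 6))) * (16 ^ 13 * (real d + 1 / \<epsilon>) ^ 26) * (real n * (2 * log 2 (real n + 1)))"
    using rad_pow_le[of 13 d] L \<epsilon> by (intro mult_mono mult_left_mono mult_nonneg_nonneg) auto
  also have "\<dots> = 2 * B * (real n * log 2 (real n + 1))" by (simp add: B_def)
  finally show "real (54 * ((tdepth d \<epsilon> + 1) * (samples c n d \<epsilon> * (n * ?R)))) \<le> 2 * B * (real n * log 2 (real n + 1))" .
  have "(tdepth d \<epsilon> + 1) * (samples c n d \<epsilon> * 2) = 2 * ((tdepth d \<epsilon> + 1) * samples c n d \<epsilon>)" by (simp only: mult_ac)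
  also have "\<dots> \<le> 54 * (3 * (512 * (c + 6)) * ?L * ?R ^ 12)"
    by (rule mult_le_mono[OF _ DM]) simp
  finally have "real ((tdepth d \<epsilon> + 1) * (samples c n d \<epsilon> * 2)) \<le> real (54 * (3 * (512 * (c + 6)) * ?L * ?R ^ 12))"
    by (rule of_nat_mono)
  also have "\<dots> = 54 * (3 * (512 * (real c + 6))) * real (?R ^ 12) * real ?L" by simp
  also have "\<dots> \<le> 54 * (3 * (512 * (real c + 6))) * (16 ^ 13 * (real d + 1 / \<epsilon>) ^ 26) * (2 * log 2 (real n + 1))"
    using rad_pow_le[of 12 d] L \<epsilon> by (intro mult_mono mult_left_mono mult_nonneg_nonneg) auto
  also have "\<dots> = 2 * B * log 2 (real n + 1)" by (simp add: B_def)
  finally show "real ((tdepth d \<epsilon> + 1) * (samples c n d \<epsilon> * 2)) \<le> 2 * B * log 2 (real n + 1)" .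
qed

lemma word_size_ge:
  assumes n: "1 \<le> n"
  shows "(real n + real d + 1 / \<epsilon>) ^ k \<le> 2 ^ word_size k n d \<epsilon>"
proof -
  let ?Y = "real n + real d + 1 / \<epsilon>"
  have Y: "?Y > 0" using \<epsilon> n by (simp add: add_pos_nonneg)
  have "real k * log 2 ?Y \<le> real (word_size k n d \<epsilon>)"
    unfolding word_size_def by (rule real_nat_ceiling_ge)
  then have "2 powr (real k * log 2 ?Y) \<le> 2 powr real (word_size k n d \<epsilon>)" by simp
  also have "2 powr (real k * log 2 ?Y) = (2 powr log 2 ?Y) powr real k" by (simp add: powr_powr mult.commute)
  also have "2 powr log 2 ?Y = ?Y" using Y by simp
  finally show ?thesis using Y by (simp add: powr_realpow)
qed

text \<open>\<open>Y > 2\<close>, so constants can be paid in powers of \<open>Y\<close>: the left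
  side is at most \<open>2 ^ (54 + c) * Y ^ 19\<close>, and replacing the power of two by
  \<open>Y ^ (57 + c)\<close> gives the exponent \<open>76 + c\<close>.\<close>

lemma word_bounds:
  assumes n: "1 \<le> n"
  shows "2 * samples c n d \<epsilon> + 2 < 2 ^ word_size (76 + c) n d \<epsilon>"
    and "2 * n + 4 < 2 ^ word_size (76 + c) n d \<epsilon>"
proof -
  let ?Y = "real n + real d + 1 / \<epsilon>" and ?X = "real d + 1 / \<epsilon>" and ?R = "rad d \<epsilon>" and ?L = "clog (n + 1)"
  have e1: "1 < 1 / \<epsilon>" using \<epsilon> by simp
  have Y: "2 < ?Y" "real n \<le> ?Y" "0 \<le> ?X" "?X \<le> ?Y" using e1 n by auto
  have "1 \<le> samples c n d \<epsilon>" using samples_ge(1)[OF n, of d \<epsilon> c] rad_ge(1)[of d \<epsilon>] by linarith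
  then have "real (2 * samples c n d \<epsilon> + 2) \<le> 4 * real (samples c n d \<epsilon>)" by simp
  also have "\<dots> \<le> 4 * real (512 * (c + 6) * ?L * ?R ^ 9)" using of_nat_mono[OF samples_le] by simp
  also have "\<dots> = 2048 * (real c + 6) * real ?L * real ?R ^ 9" by simp
  also have "\<dots> \<le> 2048 * 2 ^ (c + 6) * (2 * ?Y) * (16 * ?Y\<^sup>2) ^ 9"
  proof (intro mult_mono)
    show "real c + 6 \<le> 2 ^ (c + 6)"
      using of_nat_mono[OF less_imp_le[OF less_exp[of "c + 6"]]] by simp
    have "real ?L \<le> real (n + 1)" using clog_le[of "n + 1"] by (rule of_nat_mono)
    then show "real ?L \<le> 2 * ?Y" using Y n by simp
    have "real ?R \<le> 16 * ?X\<^sup>2" by (rule rad_le)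
    also have "\<dots> \<le> 16 * ?Y\<^sup>2" using Y by (intro mult_left_mono power_mono) auto
    finally show "real ?R ^ 9 \<le> (16 * ?Y\<^sup>2) ^ 9" by (rule power_mono) simp
  qed (use Y in auto)
  also have "\<dots> = 2 ^ (54 + c) * ?Y ^ 19"
  proof -
    have "(16 * ?Y\<^sup>2) ^ 9 = 2 ^ 36 * ?Y ^ 18" by (simp only: power_mult_distrib power_mult[symmetric]) simp
    moreover have "(2::real) ^ (54 + c) = 2048 * 2 ^ (c + 6) * 2 * 2 ^ 36" by (simp add: power_add)
    moreover have "?Y ^ 19 = ?Y * ?Y ^ 18" by (simp add: power_Suc[symmetric] del: power_Suc)
    ultimately show ?thesis by (simp only: mult_ac)
  qed
  also have "\<dots> < ?Y ^ (57 + c) * ?Y ^ 19"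
  proof (rule mult_strict_right_mono)
    have "(2::real) ^ (54 + c) < 2 ^ (57 + c)" by (rule power_strict_increasing) auto
    also have "\<dots> \<le> ?Y ^ (57 + c)" using Y by (intro power_mono) auto
    finally show "2 ^ (54 + c) < ?Y ^ (57 + c)" .
  qed (use Y in auto)
  also have "\<dots> = ?Y ^ (76 + c)" by (simp add: power_add[symmetric])
  also have "\<dots> \<le> 2 ^ word_size (76 + c) n d \<epsilon>" by (rule word_size_ge[OF n])
  finally have "real (2 * samples c n d \<epsilon> + 2) < real (2 ^ word_size (76 + c) n d \<epsilon>)" by simp
  then show "2 * samples c n d \<epsilon> + 2 < 2 ^ word_size (76 + c) n d \<epsilon>" by (rule of_nat_less_imp_less)
  have "real (2 * n + 4) \<le> 2 * ?Y + 2 * ?Y" using Y(1,2) by simp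
  also have "\<dots> < 2 ^ 3 * ?Y" using Y by simp
  also have "\<dots> \<le> ?Y ^ (75 + c) * ?Y"
  proof (rule mult_right_mono)
    have "(2::real) ^ 3 \<le> 2 ^ (75 + c)" by (rule power_increasing) auto
    also have "\<dots> \<le> ?Y ^ (75 + c)" using Y by (intro power_mono) auto
    finally show "2 ^ 3 \<le> ?Y ^ (75 + c)" .
  qed (use Y in auto)
  also have "\<dots> = ?Y ^ (76 + c)" using power_add[of ?Y "75 + c" 1] by (simp add: add_ac)
  also have "\<dots> \<le> 2 ^ word_size (76 + c) n d \<epsilon>" by (rule word_size_ge[OF n])
  finally have "real (2 * n + 4) < real (2 ^ word_size (76 + c) n d \<epsilon>)" by simp
  then show "2 * n + 4 < 2 ^ word_size (76 + c) n d \<epsilon>" by (rule of_nat_less_imp_less)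
qed

lemma error_bound:
  fixes n c d :: nat
  assumes n: "1 \<le> n" and f: "f \<in> cube n \<rightarrow> {-1, 1}"
  defines "T \<equiv> sampling.rtree n (clog (rad d \<epsilon>)) (samples c n d \<epsilon>) f (tdepth d \<epsilon>)"
  shows "\<P>(\<omega> in coins. fdist n (tree_eval (T \<omega>)) f \<le> 4 * opt n d f + \<epsilon>) \<ge> 1 - 1 / (real n + 1) ^ c"
proof -
  let ?R = "rad d \<epsilon>" and ?D = "tdepth d \<epsilon>" and ?m = "samples c n d \<epsilon>" and ?a = "clog (rad d \<epsilon>)"
  interpret sampling n ?a ?m f by unfold_locales (use n f in auto)
  define \<eta> where "\<eta> = 1 / (16 * real ?R ^ 3)"
  let ?E = "{\<omega>. fdist n (tree_eval (T \<omega>)) f \<le> 4 * opt n d f + \<epsilon>}"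
  have R: "16 \<le> ?R" by (rule rad_ge)
  have m: "0 < ?m" using samples_ge(1)[OF n, of d \<epsilon> c] R by linarith
  have \<eta>0: "0 \<le> \<eta>" by (simp add: \<eta>_def)
  have "\<omega> \<in> ?E" if g: "\<omega> \<in> good \<eta> ?D" for \<omega>
  proof -
    let ?F = "fdist n (tree_eval (T \<omega>)) f"
    \<comment> \<open>The good event does not mention the competing tree, so the bound holds for all
      of them at once and passes to the infimum \<open>opt\<close>.\<close>
    have "(?F - \<epsilon>) / 4 \<le> opt n d f"
      unfolding opt_def
    proof (rule cINF_greatest)
      show "{T. dtree_on n T \<and> depth T \<le> d} \<noteq> {}" by (auto intro!: exI[of _ "Leaf 1"])
      fix T' assume "T' \<in> {T. dtree_on n T \<and> depth T \<le> d}"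
      then have T': "dtree_on n T'" "depth T' \<le> d" by auto
      have "1 \<le> ?a" using le_clog[of ?R] R by (cases ?a) auto
      then have "?F \<le> 4 * fdist n f (tree_eval T') + 4 / scale \<epsilon>"
        unfolding T_def
        by (intro good_error[OF g m T'])
           (use scale_ge[of \<epsilon>] le_clog[of ?R] clog_upper[of ?R] R in \<open>auto simp: rad_def tdepth_def \<eta>_def\<close>)
      moreover have "4 / scale \<epsilon> \<le> 4 / (8 / \<epsilon>)"
        using scale_lower scale_ge[of \<epsilon>] \<epsilon> by (intro divide_left_mono) auto
      ultimately show "(?F - \<epsilon>) / 4 \<le> fdist n f (tree_eval T')" using \<epsilon> by simp
    qed
    then show ?thesis by simp
  qed
  then have sub: "good \<eta> ?D \<subseteq> ?E" by blast
  have "?E \<in> sets coins"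
  proof (rule measurable_depends_set)
    show "depends_on (\<Union>q<(?D + 1) * ?m. block n ?a q) (\<lambda>\<omega>. fdist n (tree_eval (T \<omega>)) f \<le> 4 * opt n d f + \<epsilon>)"
      using rtree_depends[of ?D] unfolding depends_on_def T_def by metis
  qed simp
  then have "coin.prob (good \<eta> ?D) \<le> coin.prob ?E" by (rule coin.finite_measure_mono[OF sub])
  moreover have "real ?m * \<eta>\<^sup>2 / 2 = real (2 * ?D + (c + 2)) * real (clog (n + 1))"
  proof -
    have "(real ?R ^ 3)\<^sup>2 = real ?R ^ 6" by (simp add: power_mult[symmetric])
    moreover have "real ?m = 512 * (real (2 * ?D + (c + 2)) * (real (clog (n + 1)) * real ?R ^ 6))"
      by (simp only: samples_def of_nat_mult of_nat_power of_nat_numeral)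
    ultimately show ?thesis using R by (simp add: \<eta>_def power_divide power_mult_distrib del: of_nat_add)
  qed
  then have "1 - 1 / (real n + 1) ^ c \<le> coin.prob (good \<eta> ?D)"
    using prob_good(2)[OF m \<eta>0, of ?D] failure_bound[OF n le_clog, of ?D c] by simp
  ultimately show ?thesis by simp
qed

end

text \<open>Consistency, depth and costs hold for every tape, since the tree is defined by whatever
  choices the tape dictates; only accuracy is probabilistic. The exponent \<open>c\<close> is chosen
  after the depth and distance constants because it affects the sample size alone.\<close>

theorem theorem4p1:
  shows "\<exists>(C_depth :: real) (C_opt :: real). \<forall>c :: nat.
    \<exists>(P :: com) (k :: nat) (C :: real) (e :: nat). k > 0 \<and>
      (\<forall>(n :: nat) (d :: nat) (\<epsilon> :: real) (f :: (nat \<Rightarrow> int) \<Rightarrow> int).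
        n \<ge> 1 \<longrightarrow> 0 < \<epsilon> \<longrightarrow> \<epsilon> < 1 \<longrightarrow> f \<in> cube n \<rightarrow> {-1, 1} \<longrightarrow>
        (\<exists>T :: (nat \<Rightarrow> bool) \<Rightarrow> dtree.
          (\<forall>\<omega>. dtree_on n (T \<omega>) \<and>
               provides_query_access P (word_size k n d \<epsilon>) n d \<epsilon> f \<omega>
                 (C * (real d + 1 / \<epsilon>) ^ e * (real n * log 2 (real n + 1)))
                 (C * (real d + 1 / \<epsilon>) ^ e * log 2 (real n + 1))
                 (T \<omega>) \<and>
               real (depth (T \<omega>)) \<le> C_depth * real d ^ 3 / \<epsilon>\<^sup>2) \<and>
          \<P>(\<omega> in coins. fdist n (tree_eval (T \<omega>)) f \<le> C_opt * opt n d f + \<epsilon>)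
            \<ge> 1 - 1 / (real n + 1) ^ c))"
proof (rule exI[of _ 512], rule exI[of _ 4], rule allI)
  fix c :: nat
  \<comment> \<open>The factor 2 comes from \<open>clog_log\<close>, 54 from
    \<open>program_correct\<close>, 3 and \<open>512 * (c + 6)\<close> from the depth and the
    samples, and \<open>16 ^ 13\<close> from \<open>rad_le\<close> at the thirteenth power.\<close>
  define C where "C = 2 * (54 * (3 * (512 * (real c + 6))) * 16 ^ 13)"
  have main: "\<exists>T. (\<forall>\<omega>. dtree_on n (T \<omega>) \<and>
       provides_query_access (program c) (word_size (76 + c) n d \<epsilon>) n d \<epsilon> f \<omega>
         (C * (real d + 1 / \<epsilon>) ^ 26 * (real n * log 2 (real n + 1)))
         (C * (real d + 1 / \<epsilon>) ^ 26 * log 2 (real n + 1)) (T \<omega>) \<and>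
       real (depth (T \<omega>)) \<le> 512 * real d ^ 3 / \<epsilon>\<^sup>2) \<and>
     \<P>(\<omega> in coins. fdist n (tree_eval (T \<omega>)) f \<le> 4 * opt n d f + \<epsilon>) \<ge> 1 - 1 / (real n + 1) ^ c"
    if n: "n \<ge> 1" and \<epsilon>: "0 < \<epsilon>" "\<epsilon> < 1" and f: "f \<in> cube n \<rightarrow> {-1, 1}" for n d \<epsilon> f
  proof (intro exI conjI allI)
    let ?T = "sampling.rtree n (clog (rad d \<epsilon>)) (samples c n d \<epsilon>) f (tdepth d \<epsilon>)"
    interpret sampling n "clog (rad d \<epsilon>)" "samples c n d \<epsilon>" f by unfold_locales (use n f in auto)
    fix \<omega>
    show "dtree_on n (?T \<omega>)" by (rule rtree_on)
    show "real (depth (?T \<omega>)) \<le> 512 * real d ^ 3 / \<epsilon>\<^sup>2"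
      unfolding depth_rtree using \<epsilon> by (rule tdepth_le)
    show "provides_query_access (program c) (word_size (76 + c) n d \<epsilon>) n d \<epsilon> f \<omega>
         (C * (real d + 1 / \<epsilon>) ^ 26 * (real n * log 2 (real n + 1)))
         (C * (real d + 1 / \<epsilon>) ^ 26 * log 2 (real n + 1)) (?T \<omega>)"
      unfolding provides_query_access_def
    proof
      fix x assume "x \<in> cube n"
      from program_correct[OF \<epsilon> n f this refl word_bounds[OF \<epsilon> n]] obtain t q s where
        run: "exec (word_size (76 + c) n d \<epsilon>) n f \<omega> (program c) (init_state n d \<epsilon> x) t q s"
          "answer_of s = tree_eval (?T \<omega>) x"
        and t: "t \<le> 54 * ((tdepth d \<epsilon> + 1) * (samples c n d \<epsilon> * (n * rad d \<epsilon>)))"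
        and q: "q \<le> (tdepth d \<epsilon> + 1) * (samples c n d \<epsilon> * 2)" by blast
      have "real t \<le> C * (real d + 1 / \<epsilon>) ^ 26 * (real n * log 2 (real n + 1))"
        using order_trans[OF of_nat_mono[OF t] time_bounds(1)[OF \<epsilon> n]] by (simp only: C_def mult.assoc)
      moreover have "real q \<le> C * (real d + 1 / \<epsilon>) ^ 26 * log 2 (real n + 1)"
        using order_trans[OF of_nat_mono[OF q] time_bounds(2)[OF \<epsilon> n]] by (simp only: C_def mult.assoc)
      ultimately show "\<exists>t q s. exec (word_size (76 + c) n d \<epsilon>) n f \<omega> (program c) (init_state n d \<epsilon> x) t q s \<and>
          answer_of s = tree_eval (?T \<omega>) x \<and> real t \<le> C * (real d + 1 / \<epsilon>) ^ 26 * (real n * log 2 (real n + 1)) \<and>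
          real q \<le> C * (real d + 1 / \<epsilon>) ^ 26 * log 2 (real n + 1)"
        using run by blast
    qed
    show "\<P>(\<omega> in coins. fdist n (tree_eval (?T \<omega>)) f \<le> 4 * opt n d f + \<epsilon>) \<ge> 1 - 1 / (real n + 1) ^ c"
      by (rule error_bound[OF \<epsilon> n f])
  qed
  show "\<exists>(P :: com) (k :: nat) (C :: real) (e :: nat). k > 0 \<and>
      (\<forall>(n :: nat) (d :: nat) (\<epsilon> :: real) (f :: (nat \<Rightarrow> int) \<Rightarrow> int).
        n \<ge> 1 \<longrightarrow> 0 < \<epsilon> \<longrightarrow> \<epsilon> < 1 \<longrightarrow> f \<in> cube n \<rightarrow> {-1, 1} \<longrightarrow>
        (\<exists>T :: (nat \<Rightarrow> bool) \<Rightarrow> dtree.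
          (\<forall>\<omega>. dtree_on n (T \<omega>) \<and>
               provides_query_access P (word_size k n d \<epsilon>) n d \<epsilon> f \<omega>
                 (C * (real d + 1 / \<epsilon>) ^ e * (real n * log 2 (real n + 1)))
                 (C * (real d + 1 / \<epsilon>) ^ e * log 2 (real n + 1))
                 (T \<omega>) \<and>
               real (depth (T \<omega>)) \<le> 512 * real d ^ 3 / \<epsilon>\<^sup>2) \<and>
          \<P>(\<omega> in coins. fdist n (tree_eval (T \<omega>)) f \<le> 4 * opt n d f + \<epsilon>)
            \<ge> 1 - 1 / (real n + 1) ^ c))"
    by (intro exI[of _ "program c"] exI[of _ "76 + c"] exI[of _ C] exI[of _ 26] conjI allI impI main) simp_all
qed

end
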